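(* Let $k$ be an algebraically closed field and let $\gamma\subseteq\beta$ be partitions. Put $\mathbb V={}_2\mathbb V_\gamma^\beta$ and $\mathcal D={}_2\mathcal D_\gamma^\beta$. Then the set $\{\mathbb V_\Delta:\Delta\in\mathcal D\}$ forms a stratification of $\mathbb V$ in the following sense: (1) each $\mathbb V_\Delta$ $(\Delta\in\mathcal D)$ is locally closed in $\mathbb V$; (2) $\mathbb V$ is the disjoint union of the sets $\mathbb V_\Delta$, $\Delta\in\mathcal D$; (3) for each $\Delta\in\mathcal D$ there is a finite subset $U_\Delta\subset\mathcal D$ such that the closure $\overline{\mathbb V}_\Delta$ of $\mathbb V_\Delta$ in $\mathbb V$ is equal to the union $\bigcup_{\Gamma\in U_\Delta}\mathbb V_\Gamma$.
   Context: Partitions and operators. For a partition $\lambda=(\lambda_1\ge\dots\ge\lambda_s)$ put $|\lambda|=\sum_i\lambda_i$, and let $N_\lambda=\bigoplus_i k[T]/(T^{\lambda_i})$, viewed as a nilpotent linear operator (multiplication by $T$). Zero parts of partitions are ignored. Category of invariant subspaces. $\mathcal S=\mathcal S(k)$ is the category whose objects are triples $(N_\alpha,N_\beta,f)$ with $f:N_\alpha\to N_\beta$ a $k[T]$-monomorphism ($\alpha,\beta$ any partitions); a morphism $(N_\alpha,N_\beta,f)\to(N_{\alpha'},N_{\beta'},g)$ is a pair $(h_1:N_\alpha\to N_{\alpha'},\,h_2:N_\beta\to N_{\beta'})$ of $k[T]$-homomorphisms with $gh_1=h_2f$. $\mathcal S_2(k)$ is the full subcategory of objects with $\alpha_1\le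 2$. An object $(N_\alpha,N_\beta,f)$ has type $(\beta,\gamma)$ if $\mathrm{Coker}\,f\cong N_\gamma$. ${}_2\mathcal S_\gamma^\beta$ is the full subcategory of $\mathcal S_2(k)$ of all objects of type $(\beta,\gamma)$. Indecomposables of $\mathcal S_2(k)$. Every object of $\mathcal S_2(k)$ is a direct sum, unique up to isomorphism and order, of pickets $P_\ell^m$ ($m\ge1$, $0\le\ell\le\min\{2,m\}$), where $P_\ell^m$ is the inclusion of the unique $T$-invariant $\ell$-dimensional subspace into $k[T]/(T^m)$, and bipickets $B_2^{m,r}$ ($1\le r\le m-2$), where $B_2^{m,r}=(N_{(2)},N_{(m,r)},\delta)$ with $\delta(1)=(T^{m-2},T^{r-1})$. Arc diagrams. An arc diagram consists of a finite multiset of arcs (pairs $(m,r)$ of integers, $m>r\ge1$), a finite multiset of poles (integers $m\ge1$) and a finite multiset of loops (also called circles; integers $m\ge1$). The arc diagram $\Delta(X)$ of an object $X$ of $\mathcal S_2(k)$ is obtained as follows: in a decomposition of $X$ into indecomposables, first pair off summands $P_2^s$ with summands $P_0^{s-1}$ until no unpaired $P_2^s$ and unpaired $P_0^{s-1}$ remain, for each $s$. Each pair $P_2^s\oplus P_0^{s-1}$ contributes an arc $(s,s-1)$; each $B_2^{m,r}$ an arc $(m,r)$; each $P_1^m$ a pole at $m$; each unpaired $P_2^m$ a loop at $m$; each unpaired $P_0^m$ contributes nothing. ${}_2\mathcal D_\gamma^\beta$ is the set of all arc diagrams of the form $\Delta(X)$ with $X\in{}_2\mathcal S_\gamma^\beta$.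 Representation space. Put $b=|\beta|$, $a=|\beta|-|\gamma|$. ${}_2\mathbb V_\gamma^\beta$ is the set of all triples $(f_1,f,f_2)$ with $f_1\in\mathrm{End}_k(k^a)$, $f\in\mathrm{Hom}_k(k^a,k^b)$, $f_2\in\mathrm{End}_k(k^b)$ (given as matrices) such that $f_1^2=0$, $ff_1=f_2f$, $f_2$ is nilpotent of Jordan type $\beta$, $f$ has maximal rank $a$, and the operator induced by $f_2$ on $\mathrm{Coker}\,f$ is nilpotent of Jordan type $\gamma$. It carries the topology induced from the Zariski topology of the affine space of all triples. The group $G=GL_a(k)\times GL_b(k)$ acts by $(g,h)\cdot(f_1,f,f_2)=(gf_1g^{-1},hfg^{-1},hf_2h^{-1})$; the $G$-orbits correspond to the isomorphism classes of objects in ${}_2\mathcal S_\gamma^\beta$. For $\Delta\in{}_2\mathcal D_\gamma^\beta$, $\mathbb V_\Delta$ denotes the set (a $G$-orbit) of all points of ${}_2\mathbb V_\gamma^\beta$ whose corresponding object has arc diagram $\Delta$. *)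

theory Defs
  imports
    "Jordan_Normal_Form.Jordan_Normal_Form"
    "Jordan_Normal_Form.DL_Rank"
    "HOL-Analysis.Abstract_Topology"
    "HOL-Library.Disjoint_Sets"
    "HOL-Library.Multiset"
begin

definition is_partition :: "nat list \<Rightarrow> bool" where
  "is_partition \<mu> \<longleftrightarrow> sorted_wrt (\<ge>) \<mu> \<and> 0 \<notin> set \<mu>"

definition partition_le :: "nat list \<Rightarrow> nat list \<Rightarrow> bool" where
  "partition_le \<gamma> \<beta> \<longleftrightarrow> length \<gamma> \<le> length \<beta> \<and> (\<forall>i < length \<gamma>. \<gamma> ! i \<le> \<beta> ! i)"

text \<open>
  \<open>nil_op \<mu>\<close> is the matrix of multiplication by \<open>T\<close> on \<open>N\<^sub>\<mu>\<close>, the direct sum of the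
  \<open>k[T]/(T\<^bsup>\<mu>\<^sub>i\<^esup>)\<close>. Since the library's Jordan blocks carry their ones above the diagonal, the
  basis of \<open>k[T]/(T\<^sup>m)\<close> is ordered as \<open>T\<^bsup>m-1\<^esup>, \<dots>, T, 1\<close>. Zero parts give empty blocks.
\<close>

definition nil_op :: "nat list \<Rightarrow> 'k::field mat" where
  "nil_op \<mu> = jordan_matrix (map (\<lambda>m. (m, 0)) \<mu>)"

definition nilpotent_of_type :: "'k::field mat \<Rightarrow> nat list \<Rightarrow> bool" where
  "nilpotent_of_type A \<mu> \<longleftrightarrow> jordan_nf A (map (\<lambda>m. (m, 0)) \<mu>)"

text \<open>The coordinate vector of \<open>T\<^sup>e\<close> in \<open>k[T]/(T\<^sup>m)\<close>; it is zero for \<open>e \<ge> m\<close>.\<close>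

definition T_pow :: "nat \<Rightarrow> nat \<Rightarrow> 'k::field vec" where
  "T_pow m e = vec m (\<lambda>i. if i + e + 1 = m then 1 else 0)"

text \<open>The \<open>k[T]\<close>-homomorphism from \<open>k[T]/(T\<^sup>l)\<close> to \<open>(k\<^sup>n, B)\<close> that sends \<open>1\<close> to \<open>v\<close>
  (it exists if \<open>B\<^sup>l v = 0\<close>).\<close>

definition cyclic_hom :: "nat \<Rightarrow> 'k::field mat \<Rightarrow> 'k vec \<Rightarrow> 'k mat" where
  "cyclic_hom l B v = mat_of_cols (dim_row B) (map (\<lambda>j. (B ^\<^sub>m (l - 1 - j)) *\<^sub>v v) [0..<l])"

text \<open>
  A triple \<open>(A, F, B)\<close> stands for a map \<open>F\<close> from \<open>k\<^sup>a\<close> with operator \<open>A\<close> to \<open>k\<^sup>b\<close> with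
  operator \<open>B\<close>. Points \<open>(f\<^sub>1, f, f\<^sub>2)\<close> of the representation space are of this form, and the
  object \<open>(N\<^sub>\<alpha>, N\<^sub>\<beta>, f)\<close> is written \<open>(nil_op \<alpha>, f, nil_op \<beta>)\<close>.
\<close>

type_synonym 'k triple = "'k mat \<times> 'k mat \<times> 'k mat"

fun is_morphism :: "'k::field triple \<Rightarrow> 'k triple \<Rightarrow> 'k mat \<times> 'k mat \<Rightarrow> bool" where
  "is_morphism (A, F, B) (A', F', B') (H1, H2) \<longleftrightarrow>
     H1 \<in> carrier_mat (dim_row A') (dim_row A) \<and> H2 \<in> carrier_mat (dim_row B') (dim_row B) \<and>
     H1 * A = A' * H1 \<and> H2 * B = B' * H2 \<and> F' * H1 = H2 * F"

definition isomorphic :: "'k::field triple \<Rightarrow> 'k triple \<Rightarrow> bool" where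
  "isomorphic X Y \<longleftrightarrow> (\<exists>H1 H2 K1 K2.
     is_morphism X Y (H1, H2) \<and> is_morphism Y X (K1, K2) \<and>
     K1 * H1 = 1\<^sub>m (dim_col H1) \<and> H1 * K1 = 1\<^sub>m (dim_row H1) \<and>
     K2 * H2 = 1\<^sub>m (dim_col H2) \<and> H2 * K2 = 1\<^sub>m (dim_row H2))"

definition direct_sum :: "'k::field triple list \<Rightarrow> 'k triple" where
  "direct_sum Xs = (diag_block_mat (map fst Xs),
     diag_block_mat (map (fst \<circ> snd) Xs), diag_block_mat (map (snd \<circ> snd) Xs))"

definition im_coset :: "'k::field mat \<Rightarrow> 'k vec \<Rightarrow> 'k vec set" where
  "im_coset F v = {v + F *\<^sub>v u | u. u \<in> carrier_vec (dim_col F)}"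

text \<open>
  \<open>Coker F\<close>, as the set of cosets of the image of \<open>F\<close> with the operator induced by \<open>B\<close>, is
  isomorphic to \<open>N\<^sub>\<gamma>\<close> as a \<open>k[T]\<close>-module; equivalently, the operator induced by \<open>B\<close> on
  \<open>Coker F\<close> is nilpotent of Jordan type \<open>\<gamma>\<close>.
\<close>

definition coker_iso :: "'k::field mat \<Rightarrow> 'k mat \<Rightarrow> nat list \<Rightarrow> bool" where
  "coker_iso F B \<gamma> \<longleftrightarrow> (\<exists>\<phi>.
     bij_betw \<phi> (im_coset F ` carrier_vec (dim_row F)) (carrier_vec (sum_list \<gamma>)) \<and>
     (\<forall>v \<in> carrier_vec (dim_row F). \<forall>w \<in> carrier_vec (dim_row F).
        \<phi> (im_coset F (v + w)) = \<phi> (im_coset F v) + \<phi> (im_coset F w)) \<and>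
     (\<forall>c. \<forall>v \<in> carrier_vec (dim_row F).
        \<phi> (im_coset F (c \<cdot>\<^sub>v v)) = c \<cdot>\<^sub>v \<phi> (im_coset F v)) \<and>
     (\<forall>v \<in> carrier_vec (dim_row F).
        \<phi> (im_coset F (B *\<^sub>v v)) = nil_op \<gamma> *\<^sub>v \<phi> (im_coset F v)))"

definition is_mono :: "nat list \<Rightarrow> nat list \<Rightarrow> 'k::field mat \<Rightarrow> bool" where
  "is_mono \<alpha> \<beta> F \<longleftrightarrow> F \<in> carrier_mat (sum_list \<beta>) (sum_list \<alpha>) \<and>
     F * nil_op \<alpha> = nil_op \<beta> * F \<and> inj_on ((*\<^sub>v) F) (carrier_vec (sum_list \<alpha>))"

definition S2_objects :: "nat list \<Rightarrow> nat list \<Rightarrow> 'k::field triple set" where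
  "S2_objects \<beta> \<gamma> = {(nil_op \<alpha>, F, nil_op \<beta>) | \<alpha> F.
     is_partition \<alpha> \<and> (\<forall>m \<in> set \<alpha>. m \<le> 2) \<and> is_mono \<alpha> \<beta> F \<and> coker_iso F (nil_op \<beta>) \<gamma>}"

text \<open>\<open>Picket l m\<close> is \<open>P\<^sub>l\<^sup>m\<close> and \<open>Bipicket m r\<close> is \<open>B\<^sub>2\<^bsup>m,r\<^esup>\<close>.\<close>

datatype indec = Picket nat nat | Bipicket nat nat

fun valid_indec :: "indec \<Rightarrow> bool" where
  "valid_indec (Picket l m) \<longleftrightarrow> 1 \<le> m \<and> l \<le> min 2 m"
| "valid_indec (Bipicket m r) \<longleftrightarrow> 1 \<le> r \<and> r + 2 \<le> m"

text \<open>The \<open>l\<close>-dimensional invariant subspace of \<open>k[T]/(T\<^sup>m)\<close> is generated by \<open>T\<^bsup>m-l\<^esup>\<close>.\<close>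

fun indec_triple :: "indec \<Rightarrow> 'k::field triple" where
  "indec_triple (Picket l m) =
     (nil_op [l], cyclic_hom l (nil_op [m]) (T_pow m (m - l)), nil_op [m])"
| "indec_triple (Bipicket m r) =
     (nil_op [2], cyclic_hom 2 (nil_op [m, r]) (T_pow m (m - 2) @\<^sub>v T_pow r (r - 1)),
      nil_op [m, r])"

definition decomposes_as :: "'k::field triple \<Rightarrow> indec list \<Rightarrow> bool" where
  "decomposes_as X xs \<longleftrightarrow>
     (\<forall>x \<in> set xs. valid_indec x) \<and> isomorphic X (direct_sum (map indec_triple xs))"

datatype arc_diagram =
  Arc_Diagram (arcs: "(nat \<times> nat) multiset") (poles: "nat multiset") (loops: "nat multiset")

text \<open>
  \<open>P2\<close> lists the \<open>s\<close> of the summands \<open>P\<^sub>2\<^sup>s\<close> and \<open>P0\<close> lists \<open>m + 1\<close> for the summands \<open>P\<^sub>0\<^sup>m\<close>, so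
  that their multiset intersection consists of the \<open>s\<close> of the pairs formed by \<open>P\<^sub>2\<^sup>s\<close> and
  \<open>P\<^sub>0\<^bsup>s-1\<^esup>\<close> when the pairing is maximal.
\<close>

definition diagram_of :: "indec list \<Rightarrow> arc_diagram" where
  "diagram_of xs =
    (let P2 = mset [m. Picket l m \<leftarrow> xs, l = 2];
         P0 = mset [m + 1. Picket l m \<leftarrow> xs, l = 0];
         paired = P2 \<inter># P0
     in Arc_Diagram
          (mset [(m, r). Bipicket m r \<leftarrow> xs] + image_mset (\<lambda>s. (s, s - 1)) paired)
          (mset [m. Picket l m \<leftarrow> xs, l = 1])
          (P2 - paired))"

text \<open>
  \<open>has_arc_diagram X \<Delta>\<close> expresses that \<open>\<Delta>\<close> is obtained from some decomposition of \<open>X\<close>. As the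
  decomposition is unique up to order and isomorphism, this is the graph of the function that
  sends an object to its arc diagram.
\<close>

definition has_arc_diagram :: "'k::field triple \<Rightarrow> arc_diagram \<Rightarrow> bool" where
  "has_arc_diagram X \<Delta> \<longleftrightarrow> (\<exists>xs. decomposes_as X xs \<and> diagram_of xs = \<Delta>)"

definition arc_diagrams :: "'k::field itself \<Rightarrow> nat list \<Rightarrow> nat list \<Rightarrow> arc_diagram set" where
  "arc_diagrams _ \<beta> \<gamma> = {\<Delta>. \<exists>X \<in> (S2_objects \<beta> \<gamma> :: 'k triple set). has_arc_diagram X \<Delta>}"

definition triple_space :: "nat \<Rightarrow> nat \<Rightarrow> 'k::field triple set" where
  "triple_space a b = carrier_mat a a \<times> carrier_mat b a \<times> carrier_mat b b"

inductive_set poly_functions :: "nat \<Rightarrow> nat \<Rightarrow> ('k::field triple \<Rightarrow> 'k) set"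
  for a b :: nat where
  const: "(\<lambda>_. c) \<in> poly_functions a b"
| coord1: "i < a \<Longrightarrow> j < a \<Longrightarrow> (\<lambda>(f1, f, f2). f1 $$ (i, j)) \<in> poly_functions a b"
| coord: "i < b \<Longrightarrow> j < a \<Longrightarrow> (\<lambda>(f1, f, f2). f $$ (i, j)) \<in> poly_functions a b"
| coord2: "i < b \<Longrightarrow> j < b \<Longrightarrow> (\<lambda>(f1, f, f2). f2 $$ (i, j)) \<in> poly_functions a b"
| add: "p \<in> poly_functions a b \<Longrightarrow> q \<in> poly_functions a b \<Longrightarrow>
    (\<lambda>x. p x + q x) \<in> poly_functions a b"
| mult: "p \<in> poly_functions a b \<Longrightarrow> q \<in> poly_functions a b \<Longrightarrow>
    (\<lambda>x. p x * q x) \<in> poly_functions a b"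

definition zariski_open :: "nat \<Rightarrow> nat \<Rightarrow> 'k::field triple set \<Rightarrow> bool" where
  "zariski_open a b U \<longleftrightarrow>
     (\<exists>P \<subseteq> poly_functions a b. U = triple_space a b - {x. \<forall>p \<in> P. p x = 0})"

lemma istopology_zariski_open: "istopology (zariski_open a b :: 'k::field triple set \<Rightarrow> bool)"
  unfolding istopology_def
proof (intro conjI allI impI)
  fix S T :: "'k triple set"
  assume "zariski_open a b S" and "zariski_open a b T"
  then obtain P Q where P: "P \<subseteq> poly_functions a b"
      "S = triple_space a b - {x. \<forall>p \<in> P. p x = 0}"
    and Q: "Q \<subseteq> poly_functions a b" "T = triple_space a b - {x. \<forall>p \<in> Q. p x = 0}"
    unfolding zariski_open_def by (elim exE conjE)
  define R where "R = {\<lambda>x. p x * q x | p q. p \<in> P \<and> q \<in> Q}"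
  have R: "R \<subseteq> poly_functions a b"
  proof
    fix r assume "r \<in> R"
    then obtain p q where r: "r = (\<lambda>x. p x * q x)" "p \<in> P" "q \<in> Q"
      unfolding R_def mem_Collect_eq by (elim exE conjE)
    show "r \<in> poly_functions a b"
      unfolding r(1) using r(2,3) P(1) Q(1) by (intro poly_functions.mult) (erule (1) subsetD[rotated])+
  qed
  have zero: "(\<forall>p \<in> R. p x = 0) \<longleftrightarrow> (\<forall>p \<in> P. p x = 0) \<or> (\<forall>q \<in> Q. q x = 0)" for x
  proof
    assume *: "\<forall>p \<in> R. p x = 0"
    have "p x * q x = 0" if "p \<in> P" "q \<in> Q" for p q
    proof -
      have "(\<lambda>x. p x * q x) \<in> R"
        unfolding R_def mem_Collect_eq using that by (intro exI conjI) (rule refl)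
      with * show ?thesis by (rule bspec)
    qed
    then show "(\<forall>p \<in> P. p x = 0) \<or> (\<forall>q \<in> Q. q x = 0)"
      unfolding mult_eq_0_iff by blast
  next
    assume *: "(\<forall>p \<in> P. p x = 0) \<or> (\<forall>q \<in> Q. q x = 0)"
    show "\<forall>p \<in> R. p x = 0"
    proof
      fix r assume "r \<in> R"
      then obtain p q where r: "r = (\<lambda>x. p x * q x)" "p \<in> P" "q \<in> Q"
        unfolding R_def mem_Collect_eq by (elim exE conjE)
      show "r x = 0"
        unfolding r(1) mult_eq_0_iff using * r(2,3) by blast
    qed
  qed
  have "S \<inter> T = triple_space a b - {x. \<forall>p \<in> R. p x = 0}"
    unfolding P(2) Q(2) zero by blast
  with R show "zariski_open a b (S \<inter> T)"
    unfolding zariski_open_def by (intro exI conjI)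
next
  fix K :: "'k triple set set"
  assume K: "\<forall>U \<in> K. zariski_open a b U"
  define P where "P = {p \<in> poly_functions a b.
    \<exists>U \<in> K. \<forall>x \<in> triple_space a b. p x \<noteq> 0 \<longrightarrow> x \<in> U}"
  have "\<Union>K = triple_space a b - {x. \<forall>p \<in> P. p x = 0}"
  proof (intro equalityI subsetI)
    fix x assume "x \<in> \<Union>K"
    then obtain U where U: "U \<in> K" "x \<in> U" by (rule UnionE)
    from K U(1) have "zariski_open a b U" by (rule bspec)
    then obtain Q where Q: "Q \<subseteq> poly_functions a b"
        "U = triple_space a b - {x. \<forall>p \<in> Q. p x = 0}"
      unfolding zariski_open_def by (elim exE conjE)
    from U(2) obtain q where q: "q \<in> Q" "q x \<noteq> 0" "x \<in> triple_space a b"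
      unfolding Q(2) by blast
    have "\<forall>y \<in> triple_space a b. q y \<noteq> 0 \<longrightarrow> y \<in> U"
      unfolding Q(2) using q(1) by blast
    with q(1) Q(1) U(1) have "q \<in> P"
      unfolding P_def by blast
    with q(2,3) show "x \<in> triple_space a b - {x. \<forall>p \<in> P. p x = 0}"
      by blast
  next
    fix x assume "x \<in> triple_space a b - {x. \<forall>p \<in> P. p x = 0}"
    then show "x \<in> \<Union>K"
      unfolding P_def by blast
  qed
  moreover have "P \<subseteq> poly_functions a b"
    unfolding P_def by (rule Collect_subset)
  ultimately show "zariski_open a b (\<Union>K)"
    unfolding zariski_open_def by (intro exI conjI)
qed

definition zariski :: "nat \<Rightarrow> nat \<Rightarrow> 'k::field triple topology" where
  "zariski a b = topology (zariski_open a b)"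

lemma openin_zariski: "openin (zariski a b) = zariski_open a b"
  unfolding zariski_def by (rule topology_inverse'[OF istopology_zariski_open])

definition locally_closed_in :: "'a topology \<Rightarrow> 'a set \<Rightarrow> bool" where
  "locally_closed_in X S \<longleftrightarrow> (\<exists>U C. openin X U \<and> closedin X C \<and> S = U \<inter> C)"

definition rep_space :: "nat list \<Rightarrow> nat list \<Rightarrow> 'k::field triple set" where
  "rep_space \<beta> \<gamma> =
    (let b = sum_list \<beta>; a = sum_list \<beta> - sum_list \<gamma>
     in {(f1, f, f2). (f1, f, f2) \<in> triple_space a b \<and>
           f1 * f1 = 0\<^sub>m a a \<and> f * f1 = f2 * f \<and> nilpotent_of_type f2 \<beta> \<and>
           vec_space.rank b f = a \<and> coker_iso f f2 \<gamma>})"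

definition rep_topology :: "nat list \<Rightarrow> nat list \<Rightarrow> 'k::field triple topology" where
  "rep_topology \<beta> \<gamma> =
     subtopology (zariski (sum_list \<beta> - sum_list \<gamma>) (sum_list \<beta>)) (rep_space \<beta> \<gamma>)"

text \<open>The object corresponding to a point is the one isomorphic to it as a triple.\<close>

definition stratum :: "nat list \<Rightarrow> nat list \<Rightarrow> arc_diagram \<Rightarrow> 'k::field triple set" where
  "stratum \<beta> \<gamma> \<Delta> =
     {x \<in> rep_space \<beta> \<gamma>. \<exists>X \<in> S2_objects \<beta> \<gamma>. isomorphic x X \<and> has_arc_diagram X \<Delta>}"

end

theory Submission
  imports Defs "Jordan_Normal_Form.Jordan_Normal_Form_Uniqueness"
begin

text \<open>
  A point of the representation space is a triple \<open>(A, F, B)\<close>: an operator \<open>A\<close> with \<open>A\<^sup>2 = 0\<close>, a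
  nilpotent operator \<open>B\<close> on a space \<open>N\<close>, and an injective \<open>F\<close> with \<open>F A = B F\<close>. Write \<open>T\<close> for \<open>B\<close> and
  \<open>U\<close> for the image of \<open>F\<close>, so that \<open>U\<close> is \<open>T\<close>-invariant and \<open>T\<^sup>2 U = 0\<close>. Three facts about such
  triples carry the theorem.

  Every triple is a direct sum of pickets and bipickets (\<open>s2_triple_decomposes\<close>). Summands are split
  off one at a time. Let \<open>m\<close> be least with \<open>T\<^sup>m = 0\<close> and let \<open>S = T\<^bsup>m-1\<^esup> N\<close>. A functional \<open>\<phi>\<close> that does
  not vanish on \<open>S\<close> gives, through \<open>\<phi>, \<phi>T, \<dots>, \<phi>T\<^bsup>m-1\<^esup>\<close>, a projection of \<open>N\<close> onto a Jordan block of size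
  \<open>m\<close>. If \<open>S\<close> is not contained in \<open>U\<close>, then \<open>\<phi>\<close> can be chosen to vanish on \<open>U\<close>, and a summand \<open>P\<^sub>0\<^sup>m\<close>
  appears; if \<open>S\<close> is contained in \<open>U\<close> but not in \<open>T U\<close>, then \<open>\<phi>\<close> can be chosen to vanish on \<open>T U\<close>, and a
  summand \<open>P\<^sub>1\<^sup>m\<close> appears. Otherwise some \<open>s \<noteq> 0\<close> in \<open>S\<close> is \<open>T u\<close> with \<open>u\<close> in \<open>U\<close>; let \<open>r - 1\<close> be the largest
  height of such a \<open>u\<close>, that is, the largest \<open>k\<close> with \<open>u\<close> in \<open>T\<^sup>k N\<close>. If \<open>r = m - 1\<close> the summand is
  \<open>P\<^sub>2\<^sup>m\<close>, and if \<open>r \<le> m - 2\<close> it is \<open>B\<^sub>2\<^bsup>m,r\<^esup>\<close>: maximality of the height is exactly what makes the linear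
  system for the two functionals defining the projection solvable (\<open>indec_step\<close>).

  The numbers \<open>d\<^bsub>j,i\<^esub> = dim {u \<in> U. u \<in> T\<^sup>j N, T u \<in> T\<^sup>i N}\<close> are isomorphism invariants and additive, and
  on an indecomposable they count whether \<open>j\<close> and \<open>i\<close> are below its parameters. Inclusion-exclusion
  recovers the summands with nonzero submodule from them, and \<open>\<beta>\<close> then yields the summands \<open>P\<^sub>0\<^sup>m\<close>
  (\<open>mset_eq_if_height_dims_eq\<close>). On the other hand \<open>d\<^bsub>j,i\<^esub>\<close> is, up to a constant depending on \<open>\<beta>\<close> and
  \<open>\<gamma>\<close>, minus the rank of a matrix whose entries are polynomials in the coordinates of the point
  (\<open>rank_height_mat\<close>). So a stratum is given by finitely many rank equations, each of which is the
  intersection of an open and a closed condition; this gives (1), and the disjointness in (2).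

  The diagram together with \<open>\<beta>\<close> also determines the summands, because bipickets never give arcs
  \<open>(s, s - 1)\<close> (\<open>mset_eq_if_diagram_eq\<close>). So a stratum is a single orbit of the group of base changes.
  The group acts by homeomorphisms, so the closure of an orbit is a union of orbits, and there are
  only finitely many diagrams; this gives (3).
\<close>

section \<open>Matrix algebra\<close>

text \<open>
  The rules of matrix algebra with their size conditions as equations between dimensions: unlike
  membership in a carrier set, these mention no sizes that the rewriter would have to guess, so
  products of many matrices can be normalized (to the right) by the simplifier.
\<close>

lemma mult_assoc:
  "dim_col A = dim_row B \<Longrightarrow> dim_col B = dim_row C \<Longrightarrow> A * B * C = A * (B * (C :: 'a :: semiring_0 mat))"
  by (rule assoc_mult_mat[of A "dim_row A" "dim_row B" B "dim_row C" C "dim_col C"]) auto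

lemma mult_add_left:
  "dim_row A = dim_row B \<Longrightarrow> dim_col A = dim_col B \<Longrightarrow> dim_col B = dim_row C \<Longrightarrow>
    (A + B) * C = A * C + B * (C :: 'a :: semiring_0 mat)"
  by (rule add_mult_distrib_mat[of A "dim_row A" "dim_row C" B C "dim_col C"]) auto

lemma mult_add_right:
  "dim_row B = dim_row C \<Longrightarrow> dim_col B = dim_col C \<Longrightarrow> dim_col A = dim_row B \<Longrightarrow>
    A * (B + C) = A * B + A * (C :: 'a :: semiring_0 mat)"
  by (rule mult_add_distrib_mat[of A "dim_row A" "dim_row B" B "dim_col B" C]) auto

lemma mult_diff_left:
  "dim_row A = dim_row B \<Longrightarrow> dim_col A = dim_col B \<Longrightarrow> dim_col B = dim_row C \<Longrightarrow>
    (A - B) * C = A * C - B * (C :: 'a :: ring mat)"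
  by (rule minus_mult_distrib_mat[of A "dim_row A" "dim_row C" B C "dim_col C"]) auto

lemma mult_diff_right:
  "dim_row B = dim_row C \<Longrightarrow> dim_col B = dim_col C \<Longrightarrow> dim_col A = dim_row B \<Longrightarrow>
    A * (B - C) = A * B - A * (C :: 'a :: ring mat)"
  by (rule mult_minus_distrib_mat[of A "dim_row A" "dim_row B" B "dim_col B" C]) auto

lemma mult_zero_left: "dim_row A = k \<Longrightarrow> 0\<^sub>m n k * A = 0\<^sub>m n (dim_col (A :: 'a :: semiring_0 mat))"
  by (intro eq_matI) auto

lemma mult_zero_right: "dim_col A = k \<Longrightarrow> A * 0\<^sub>m k n = 0\<^sub>m (dim_row (A :: 'a :: semiring_0 mat)) n"
  by (intro eq_matI) auto

lemma mult_one_left: "dim_row A = n \<Longrightarrow> 1\<^sub>m n * A = (A :: 'a :: semiring_1 mat)"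
  by (intro eq_matI) auto

lemma mult_one_right: "dim_col A = n \<Longrightarrow> A * 1\<^sub>m n = (A :: 'a :: semiring_1 mat)"
  by (intro eq_matI) auto

lemma add_zero_mat:
  "dim_row A = n \<Longrightarrow> dim_col A = k \<Longrightarrow> A + 0\<^sub>m n k = (A :: 'a :: monoid_add mat)"
  "dim_row A = n \<Longrightarrow> dim_col A = k \<Longrightarrow> 0\<^sub>m n k + A = (A :: 'a :: monoid_add mat)"
  by (intro eq_matI; auto)+

lemma diff_zero_mat:
  "dim_row A = n \<Longrightarrow> dim_col A = k \<Longrightarrow> A - 0\<^sub>m n k = (A :: 'a :: group_add mat)"
  by (intro eq_matI) auto

lemma diff_self_mat: "A - A = 0\<^sub>m (dim_row A) (dim_col (A :: 'a :: group_add mat))"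
  by (intro eq_matI) auto

lemma diff_eq_zero_matD:
  assumes "A - B = 0\<^sub>m n k" "dim_row A = dim_row B" "dim_col A = dim_col (B :: 'a :: group_add mat)"
  shows "A = B"
proof (rule eq_matI)
  fix i j assume ij: "i < dim_row B" "j < dim_col B"
  have "dim_row (A - B) = n" "dim_col (A - B) = k" unfolding assms(1) by auto
  then have "dim_row B = n" "dim_col B = k" by auto
  with assms(1) ij have "(A - B) $$ (i, j) = 0" by simp
  with ij show "A $$ (i, j) = B $$ (i, j)" by simp
qed (use assms in auto)

lemmas mat_simps = mult_assoc mult_add_left mult_add_right mult_diff_left mult_diff_right
  mult_zero_left mult_zero_right mult_one_left mult_one_right add_zero_mat diff_zero_mat diff_self_mat

lemma add_eq_mat_diff: "A + B = C \<Longrightarrow> dim_row A = dim_row B \<Longrightarrow> dim_col A = dim_col B \<Longrightarrow> B = C - (A :: 'a :: ab_group_add mat)"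
  by (intro eq_matI) auto

text \<open>The form in which an equation \<open>A * B = C\<close> rewrites right-associated products.\<close>

lemma mult_reassoc:
  assumes "A * B = C" "dim_col A = dim_row B"
  shows "dim_col B = dim_row Z \<Longrightarrow> A * (B * Z) = C * (Z :: 'a :: semiring_0 mat)"
  using assms by (simp flip: mult_assoc)

lemma if_mult_zero:
  "(if b then x else 0) * y = (if b then x * y else (0 :: 'a :: mult_zero))"
  "y * (if b then x else 0) = (if b then y * x else (0 :: 'a :: mult_zero))"
  by auto

definition hcat :: "'a mat \<Rightarrow> 'a mat \<Rightarrow> 'a mat" where
  "hcat A B = mat (dim_row A) (dim_col A + dim_col B)
     (\<lambda>(i, j). if j < dim_col A then A $$ (i, j) else B $$ (i, j - dim_col A))"

definition vcat :: "'a mat \<Rightarrow> 'a mat \<Rightarrow> 'a mat" where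
  "vcat A B = mat (dim_row A + dim_row B) (dim_col A)
     (\<lambda>(i, j). if i < dim_row A then A $$ (i, j) else B $$ (i - dim_row A, j))"

lemma dim_hcat [simp]: "dim_row (hcat A B) = dim_row A" "dim_col (hcat A B) = dim_col A + dim_col B"
  by (auto simp: hcat_def)

lemma dim_vcat [simp]: "dim_row (vcat A B) = dim_row A + dim_row B" "dim_col (vcat A B) = dim_col A"
  by (auto simp: vcat_def)

lemma index_hcat: "i < dim_row A \<Longrightarrow> j < dim_col A + dim_col B \<Longrightarrow>
   hcat A B $$ (i, j) = (if j < dim_col A then A $$ (i, j) else B $$ (i, j - dim_col A))"
  by (simp add: hcat_def)

lemma index_vcat: "i < dim_row A + dim_row B \<Longrightarrow> j < dim_col A \<Longrightarrow>
   vcat A B $$ (i, j) = (if i < dim_row A then A $$ (i, j) else B $$ (i - dim_row A, j))"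
  by (simp add: vcat_def)

lemma mult_hcat: "dim_row A = dim_row B \<Longrightarrow> dim_col C = dim_row A \<Longrightarrow>
    C * hcat A B = hcat (C * A) (C * (B :: 'a :: semiring_0 mat))"
  by (intro eq_matI) (auto simp: index_hcat scalar_prod_def intro!: sum.cong)

lemma vcat_mult: "dim_col A = dim_col B \<Longrightarrow> dim_row C = dim_col A \<Longrightarrow>
    vcat A B * C = vcat (A * C) (B * (C :: 'a :: semiring_0 mat))"
  by (intro eq_matI) (auto simp: index_vcat scalar_prod_def intro!: sum.cong)

lemma hcat_mult_vcat:
  assumes "dim_row A = dim_row B" "dim_col C = dim_col D" "dim_col A = dim_row C" "dim_col B = dim_row D"
  shows "hcat A B * vcat C D = A * C + B * (D :: 'a :: semiring_0 mat)"
proof (rule eq_matI)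
  fix i j assume "i < dim_row (A * C + B * D)" "j < dim_col (A * C + B * D)"
  then have ij: "i < dim_row B" "j < dim_col D" by auto
  have "(hcat A B * vcat C D) $$ (i, j) =
     (\<Sum>k = 0..<dim_col A + dim_col B. hcat A B $$ (i, k) * vcat C D $$ (k, j))"
    using ij assms by (simp add: scalar_prod_def)
  also have "\<dots> = (\<Sum>k = 0..<dim_col A. hcat A B $$ (i, k) * vcat C D $$ (k, j)) +
     (\<Sum>k = dim_col A..<dim_col A + dim_col B. hcat A B $$ (i, k) * vcat C D $$ (k, j))"
    by (rule sum.atLeastLessThan_concat[symmetric]) auto
  also have "(\<Sum>k = dim_col A..<dim_col A + dim_col B. hcat A B $$ (i, k) * vcat C D $$ (k, j)) =
     (\<Sum>k = 0..<dim_col B. hcat A B $$ (i, k + dim_col A) * vcat C D $$ (k + dim_col A, j))"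
    using sum.shift_bounds_nat_ivl[of "\<lambda>k. hcat A B $$ (i, k) * vcat C D $$ (k, j)" 0 "dim_col A" "dim_col B"]
    by (simp add: add.commute)
  finally show "(hcat A B * vcat C D) $$ (i, j) = (A * C + B * D) $$ (i, j)"
    using ij assms by (simp add: scalar_prod_def index_hcat index_vcat)
qed (use assms in auto)

lemma hcat_add: "dim_row A = dim_row B \<Longrightarrow> dim_row C = dim_row A \<Longrightarrow> dim_row D = dim_row A \<Longrightarrow>
   dim_col A = dim_col C \<Longrightarrow> dim_col B = dim_col D \<Longrightarrow>
   hcat A B + hcat C D = hcat (A + C) (B + D)"
  by (intro eq_matI) (auto simp: index_hcat)

lemma four_block_eq_vcat:
  "dim_row A = dim_row B \<Longrightarrow> dim_row C = dim_row D \<Longrightarrow> dim_col A = dim_col C \<Longrightarrow> dim_col B = dim_col D \<Longrightarrow>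
   four_block_mat A B C D = vcat (hcat A B) (hcat C D)"
  by (intro eq_matI) (auto simp: index_hcat index_vcat)

lemma vcat_inject: "vcat A B = vcat C D \<Longrightarrow> dim_row A = dim_row C \<Longrightarrow> dim_row B = dim_row D \<Longrightarrow>
   dim_col A = dim_col B \<Longrightarrow> dim_col C = dim_col D \<Longrightarrow> A = C \<and> B = D"
proof (intro conjI eq_matI)
  assume *: "vcat A B = vcat C D" "dim_row A = dim_row C" "dim_row B = dim_row D"
   "dim_col A = dim_col B" "dim_col C = dim_col D"
  then have c: "dim_col A = dim_col C" by (metis dim_vcat(2))
  with * show "dim_col A = dim_col C" "dim_col B = dim_col D" by auto
  fix i j
  { assume "i < dim_row C" "j < dim_col C"
    moreover have "vcat A B $$ (i, j) = vcat C D $$ (i, j)" using * by simp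
    ultimately show "A $$ (i, j) = C $$ (i, j)" using *(2-) c by (simp add: index_vcat) }
  { assume "i < dim_row D" "j < dim_col D"
    moreover have "vcat A B $$ (i + dim_row A, j) = vcat C D $$ (i + dim_row A, j)" using * by simp
    ultimately show "B $$ (i, j) = D $$ (i, j)" using *(2-) c by (simp add: index_vcat) }
qed auto

lemma vcat_split:
  assumes "dim_row U = n + k"
  obtains U1 U2 where "U = vcat U1 U2" "dim_row U1 = n" "dim_row U2 = k" "dim_col U1 = dim_col U" "dim_col U2 = dim_col U"
proof
  show "U = vcat (mat n (dim_col U) (\<lambda>(i, j). U $$ (i, j))) (mat k (dim_col U) (\<lambda>(i, j). U $$ (n + i, j)))"
    using assms by (intro eq_matI) (auto simp: index_vcat)
qed auto

lemma vcat_zero: "vcat (0\<^sub>m n k) (0\<^sub>m l k) = 0\<^sub>m (n + l) k"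
  by (intro eq_matI) (auto simp: index_vcat)

lemma hcat_inject: "hcat A B = hcat C D \<Longrightarrow> dim_col A = dim_col C \<Longrightarrow> dim_col B = dim_col D \<Longrightarrow>
   dim_row A = dim_row B \<Longrightarrow> dim_row C = dim_row D \<Longrightarrow> A = C \<and> B = D"
proof (intro conjI eq_matI)
  assume *: "hcat A B = hcat C D" "dim_col A = dim_col C" "dim_col B = dim_col D"
   "dim_row A = dim_row B" "dim_row C = dim_row D"
  then have c: "dim_row A = dim_row C" by (metis dim_hcat(1))
  with * show "dim_row A = dim_row C" "dim_row B = dim_row D" by auto
  fix i j
  { assume "i < dim_row C" "j < dim_col C"
    moreover have "hcat A B $$ (i, j) = hcat C D $$ (i, j)" using * by simp
    ultimately show "A $$ (i, j) = C $$ (i, j)" using *(2-) c by (simp add: index_hcat) }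
  { assume "i < dim_row D" "j < dim_col D"
    moreover have "hcat A B $$ (i, j + dim_col A) = hcat C D $$ (i, j + dim_col A)" using * by simp
    ultimately show "B $$ (i, j) = D $$ (i, j)" using *(2-) c by (simp add: index_hcat) }
qed auto

lemma hcat_split:
  assumes "dim_col U = n + k"
  obtains U1 U2 where "U = hcat U1 U2" "dim_col U1 = n" "dim_col U2 = k" "dim_row U1 = dim_row U" "dim_row U2 = dim_row U"
proof
  show "U = hcat (mat (dim_row U) n (\<lambda>(i, j). U $$ (i, j))) (mat (dim_row U) k (\<lambda>(i, j). U $$ (i, n + j)))"
    using assms by (intro eq_matI) (auto simp: index_hcat)
qed auto

lemma hcat_zero: "hcat (0\<^sub>m n k) (0\<^sub>m n l) = 0\<^sub>m n (k + l)"
  by (intro eq_matI) (auto simp: index_hcat)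

lemma four_block_mult_vcat:
  assumes "dim_row A = dim_row B" "dim_row C = dim_row D" "dim_col A = dim_col C" "dim_col B = dim_col D"
    "dim_col A = dim_row U" "dim_col B = dim_row V" "dim_col U = dim_col V"
  shows "four_block_mat A B C D * vcat U V = vcat (A * U + B * V) (C * U + D * (V :: 'a :: semiring_0 mat))"
  using assms by (simp add: four_block_eq_vcat vcat_mult hcat_mult_vcat)

lemma hcat_mult_four_block:
  assumes "dim_row A = dim_row B" "dim_row C = dim_row D" "dim_col A = dim_col C" "dim_col B = dim_col D"
    "dim_row A = dim_col U" "dim_row C = dim_col V" "dim_row U = dim_row V"
  shows "hcat U V * four_block_mat A B C D = hcat (U * A + V * C) (U * B + V * (D :: 'a :: semiring_0 mat))"
  using assms by (simp add: four_block_eq_vcat hcat_mult_vcat mult_hcat hcat_add)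

lemma hcat_vcat:
  "dim_row A = dim_row B \<Longrightarrow> dim_row C = dim_row D \<Longrightarrow> dim_col A = dim_col C \<Longrightarrow> dim_col B = dim_col D \<Longrightarrow>
   hcat (vcat A C) (vcat B D) = vcat (hcat A B) (hcat C D)"
  by (intro eq_matI) (auto simp: index_hcat index_vcat)

lemma vcat_mult_hcat:
  assumes "dim_col P = dim_col R" "dim_row Q = dim_row S" "dim_col P = dim_row Q"
  shows "vcat P R * hcat Q S = four_block_mat (P * Q) (P * S) (R * Q) (R * (S :: 'a :: semiring_0 mat))"
  using assms by (simp add: four_block_eq_vcat vcat_mult mult_hcat hcat_vcat)

lemma four_block_mult_four_block:
  assumes "dim_row A = dim_row B" "dim_row C = dim_row D" "dim_col A = dim_col C" "dim_col B = dim_col D"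
    "dim_row A' = dim_row B'" "dim_row C' = dim_row D'" "dim_col A' = dim_col C'" "dim_col B' = dim_col D'"
    "dim_col A = dim_row A'" "dim_col B = dim_row C'"
  shows "four_block_mat A B C D * four_block_mat A' B' C' D' =
    four_block_mat (A * A' + B * C') (A * B' + B * D') (C * A' + D * C') (C * B' + D * (D' :: 'a :: semiring_0 mat))"
  using assms by (intro mult_four_block_mat[of A "dim_row A" "dim_col A" B "dim_col B" C "dim_row C" D A' "dim_col A'" B' "dim_col B'"]) auto

lemma four_block_one: "four_block_mat (1\<^sub>m n) (0\<^sub>m n k) (0\<^sub>m k n) (1\<^sub>m k) = (1\<^sub>m (n + k) :: 'a :: semiring_1 mat)"
  by simp

definition dsum :: "'a :: zero mat \<Rightarrow> 'a mat \<Rightarrow> 'a mat" where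
  "dsum A B = four_block_mat A (0\<^sub>m (dim_row A) (dim_col B)) (0\<^sub>m (dim_row B) (dim_col A)) B"

lemma dim_dsum [simp]: "dim_row (dsum A B) = dim_row A + dim_row B" "dim_col (dsum A B) = dim_col A + dim_col B"
  by (auto simp: dsum_def)

lemma diag_block_mat_Cons: "diag_block_mat (A # As) = dsum A (diag_block_mat As)"
  by (simp add: dsum_def Let_def)

lemma dsum_mult_dsum: "dim_col A = dim_row A' \<Longrightarrow> dim_col B = dim_row B' \<Longrightarrow>
   dsum A B * dsum A' B' = dsum (A * A') (B * (B' :: 'a :: semiring_0 mat))"
  unfolding dsum_def by (subst four_block_mult_four_block) (auto simp: mat_simps)

lemma dsum_mult_vcat: "dim_col A = dim_row U \<Longrightarrow> dim_col B = dim_row V \<Longrightarrow> dim_col U = dim_col V \<Longrightarrow>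
   dsum A B * vcat U V = vcat (A * U) (B * (V :: 'a :: semiring_0 mat))"
  unfolding dsum_def by (subst four_block_mult_vcat) (auto simp: mat_simps)

lemma hcat_mult_dsum: "dim_row A = dim_col U \<Longrightarrow> dim_row B = dim_col V \<Longrightarrow> dim_row U = dim_row V \<Longrightarrow>
   hcat U V * dsum A B = hcat (U * A) (V * (B :: 'a :: semiring_0 mat))"
  unfolding dsum_def by (subst hcat_mult_four_block) (auto simp: mat_simps)

lemma dsum_one: "dsum (1\<^sub>m n) (1\<^sub>m k) = (1\<^sub>m (n + k) :: 'a :: semiring_1 mat)"
  by (simp add: dsum_def)

lemma dsum_pow: "dim_row A = dim_col A \<Longrightarrow> dim_row B = dim_col B \<Longrightarrow>
   dsum A B ^\<^sub>m k = dsum (A ^\<^sub>m k) ((B :: 'a :: semiring_1 mat) ^\<^sub>m k)"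
  by (induction k) (auto simp: dsum_one dsum_mult_dsum)

section \<open>Rank factorizations\<close>

text \<open>
  Padding \<open>X\<close> and \<open>Y\<close> by zeros to square matrices turns \<open>X Y = 1\<close> into \<open>Y X = 1\<close>, which fails at the
  padded diagonal positions. All comparisons of dimensions below reduce to this.
\<close>

lemma inverse_pair_le:
  fixes X Y :: "'k :: field mat"
  assumes X: "X \<in> carrier_mat r s" and Y: "Y \<in> carrier_mat s r" and XY: "X * Y = 1\<^sub>m r"
  shows "r \<le> s"
proof (rule ccontr)
  assume "\<not> r \<le> s"
  then have sr: "s < r" by simp
  define X' where "X' = hcat X (0\<^sub>m r (r - s))"
  define Y' where "Y' = vcat Y (0\<^sub>m (r - s) r)"
  have c: "X' \<in> carrier_mat r r" "Y' \<in> carrier_mat r r"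
    using X Y sr by (auto simp: X'_def Y'_def)
  have "X' * Y' = 1\<^sub>m r"
    unfolding X'_def Y'_def using X Y XY by (subst hcat_mult_vcat) (auto simp: mat_simps)
  then have *: "Y' * X' = 1\<^sub>m r" using c by (metis mat_mult_left_right_inverse)
  have "(Y' * X') $$ (s, s) = 0"
    using X Y sr by (auto simp: X'_def Y'_def scalar_prod_def index_vcat index_hcat)
  with * sr show False by simp
qed

text \<open>
  Rank by factorization: \<open>P M Q = 1\<close> says that \<open>M\<close> has rank at least \<open>r\<close>, and \<open>M Q P M = M\<close> that it
  factors through dimension \<open>r\<close>. The witness \<open>Q P\<close> is a generalized inverse of \<open>M\<close>, and this is
  the form in which ranks are used for solving linear systems.
\<close>

definition is_rank :: "'k :: field mat \<Rightarrow> nat \<Rightarrow> bool" where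
  "is_rank M r \<longleftrightarrow> (\<exists>P Q. P \<in> carrier_mat r (dim_row M) \<and> Q \<in> carrier_mat (dim_col M) r \<and>
      P * M * Q = 1\<^sub>m r \<and> M * Q * P * M = M)"

definition rank_ge :: "'k :: field mat \<Rightarrow> nat \<Rightarrow> bool" where
  "rank_ge M r \<longleftrightarrow> (\<exists>P Q. P \<in> carrier_mat r (dim_row M) \<and> Q \<in> carrier_mat (dim_col M) r \<and>
      P * M * Q = 1\<^sub>m r)"

text \<open>
  Take \<open>P M Q = 1\<close> of maximal size. If \<open>E = M - M Q P M\<close> had a nonzero entry, then \<open>P\<close> could be
  extended by a row and \<open>Q\<close> by a column, so \<open>E = 0\<close>.
\<close>

lemma ex_is_rank: "\<exists>r. is_rank (M :: 'k :: field mat) r"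
proof -
  let ?n = "dim_row M" and ?k = "dim_col M"
  have bd: "r \<le> ?n" if r: "rank_ge M r" for r
  proof -
    from r obtain P Q where "P \<in> carrier_mat r ?n" "Q \<in> carrier_mat ?k r" "P * M * Q = 1\<^sub>m r"
      unfolding rank_ge_def by blast
    then show ?thesis
      by (intro inverse_pair_le[of P r ?n "M * Q"]) (auto simp: mat_simps)
  qed
  have "rank_ge M 0" unfolding rank_ge_def
    by (intro exI[of _ "0\<^sub>m 0 ?n"] exI[of _ "0\<^sub>m ?k 0"]) auto
  with bd have "\<exists>r. rank_ge M r \<and> (\<forall>r'. rank_ge M r' \<longrightarrow> r' \<le> r)"
    using Nat.ex_has_greatest_nat[of "rank_ge M" 0 ?n] by blast
  then obtain r where r: "rank_ge M r" "\<not> rank_ge M (Suc r)" by fastforce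
  from r(1) obtain P Q where PQ: "P \<in> carrier_mat r ?n" "Q \<in> carrier_mat ?k r" "P * M * Q = 1\<^sub>m r"
    unfolding rank_ge_def by blast
  note d = carrier_matD[OF PQ(1)] carrier_matD[OF PQ(2)]
  have one: "P * (M * Q) = 1\<^sub>m r" using PQ(3) d by (simp add: mat_simps)
  note one' = mult_reassoc[OF one] mult_reassoc[OF mult_reassoc[OF one]]
  have one2: "P * (M * (Q * Z)) = Z" if "dim_row Z = r" for Z
    using one that d by (simp add: mult_one_left flip: mult_assoc)
  define E where "E = M - M * Q * P * M"
  have dE: "dim_row E = ?n" "dim_col E = ?k" by (auto simp: E_def)
  have "E = 0\<^sub>m ?n ?k"
  proof (rule ccontr)
    assume "E \<noteq> 0\<^sub>m ?n ?k"
    then obtain i j where ij: "i < ?n" "j < ?k" "E $$ (i, j) \<noteq> 0"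
      using dE by (metis eq_matI index_zero_mat)
    \<comment> \<open>\<open>x E y = 1\<close> for multiples of unit vectors; the corrections make \<open>x' M Q = 0\<close> and \<open>P M y' = 0\<close>\<close>
    define x where "x = mat 1 ?n (\<lambda>(a, b). if b = i then 1 / E $$ (i, j) else 0)"
    define y where "y = mat ?k 1 (\<lambda>(a, b). if a = j then (1 :: 'k) else 0)"
    define x' where "x' = x - x * M * Q * P"
    define y' where "y' = y - Q * P * M * y"
    have dx: "dim_row x = 1" "dim_col x = ?n" "dim_row y = ?k" "dim_col y = 1"
       "dim_row x' = 1" "dim_col x' = ?n" "dim_row y' = ?k" "dim_col y' = 1"
      using d by (auto simp: x_def y_def x'_def y'_def)
    have Ey: "E * y = mat ?n 1 (\<lambda>(a, b). E $$ (a, j))"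
      using dE dx ij by (intro eq_matI) (auto simp: y_def scalar_prod_def if_mult_zero)
    have xEy: "x * (E * y) = 1\<^sub>m 1"
      unfolding Ey using dE dx ij
      by (intro eq_matI) (auto simp: x_def scalar_prod_def if_mult_zero)
    have 1: "P * (M * y') = 0\<^sub>m r 1"
      using d dx by (simp add: y'_def mat_simps one2)
    have 2: "x' * (M * Q) = 0\<^sub>m 1 r"
      using d dx one by (simp add: x'_def mat_simps)
    have EQ: "E * Q = 0\<^sub>m ?n r" using d dx one by (simp add: E_def mat_simps)
    have "x' * (M * y') = x * (E * y)"
      using d dx
      by (simp add: x'_def y'_def E_def mat_simps one2)
    with xEy have 3: "x' * (M * y') = 1\<^sub>m 1" by simp
    have "vcat P x' * M * hcat Q y' = 1\<^sub>m (r + 1)"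
    proof -
      have "vcat P x' * M * hcat Q y' = vcat P x' * hcat (M * Q) (M * y')"
        using d dx by (simp add: mult_assoc mult_hcat[of Q y' M])
      also have "\<dots> = four_block_mat (1\<^sub>m r) (0\<^sub>m r 1) (0\<^sub>m 1 r) (1\<^sub>m 1)"
        using d dx by (simp add: vcat_mult_hcat one 1 2 3 del: four_block_one_mat)
      finally show ?thesis unfolding four_block_one .
    qed
    then have "rank_ge M (Suc r)" unfolding rank_ge_def
      using d dx by (intro exI[of _ "vcat P x'"] exI[of _ "hcat Q y'"]) auto
    with r show False by simp
  qed
  then have "M * Q * P * M = M" unfolding E_def by (metis diff_eq_zero_matD[of M "M * Q * P * M"] dim_col_mat index_mult_mat(2,3))
  with PQ show ?thesis unfolding is_rank_def by blast
qed

lemma is_rankE: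
  assumes "is_rank M r"
  obtains P Q where "dim_row P = r" "dim_col P = dim_row M" "dim_row Q = dim_col M" "dim_col Q = r"
    "P * (M * Q) = 1\<^sub>m r" "M * (Q * (P * M)) = M"
proof -
  from assms obtain P Q where PQ: "P \<in> carrier_mat r (dim_row M)" "Q \<in> carrier_mat (dim_col M) r"
      "P * M * Q = 1\<^sub>m r" "M * Q * P * M = M" unfolding is_rank_def by blast
  then show thesis by (intro that[of P Q]) (auto simp: mat_simps)
qed

lemma is_rankI:
  assumes "dim_row P = r" "dim_col P = dim_row M" "dim_row Q = dim_col M" "dim_col Q = r"
    "P * (M * Q) = 1\<^sub>m r" "M * (Q * (P * M)) = M"
  shows "is_rank M r"
  unfolding is_rank_def using assms by (intro exI[of _ P] exI[of _ Q]) (auto simp: mat_simps)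

lemma is_rank_unique_le:
  assumes "is_rank M r" "rank_ge M s"
  shows "s \<le> r"
proof -
  obtain P Q where 1: "dim_row P = r" "dim_col P = dim_row M" "dim_row Q = dim_col M" "dim_col Q = r"
    "M * (Q * (P * M)) = M" using assms(1) by (elim is_rankE)
  obtain P' Q' where 2: "P' \<in> carrier_mat s (dim_row M)" "Q' \<in> carrier_mat (dim_col M) s" "P' * M * Q' = 1\<^sub>m s"
    using assms(2) unfolding rank_ge_def by blast
  note d = 1(1-4) carrier_matD[OF 2(1)] carrier_matD[OF 2(2)]
  have "(P' * (M * Q)) * (P * (M * Q')) = P' * ((M * (Q * (P * M))) * Q')"
    using d by (simp add: mat_simps)
  also have "\<dots> = 1\<^sub>m s" using 2 d unfolding 1(5) by (simp add: mat_simps)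
  finally show ?thesis
    using d by (intro inverse_pair_le[of "P' * (M * Q)" s r "P * (M * Q')"]) auto
qed

lemma rank_ge_iff:
  assumes "is_rank M r"
  shows "rank_ge M s \<longleftrightarrow> s \<le> r"
proof
  assume sr: "s \<le> r"
  obtain P Q where 1: "dim_row P = r" "dim_col P = dim_row M" "dim_row Q = dim_col M" "dim_col Q = r"
    "P * (M * Q) = 1\<^sub>m r" using assms by (elim is_rankE)
  define I where "I = mat s r (\<lambda>(i, j). if i = j then (1 :: 'a) else 0)"
  define J where "J = mat r s (\<lambda>(i, j). if i = j then (1 :: 'a) else 0)"
  have d: "dim_row I = s" "dim_col I = r" "dim_row J = r" "dim_col J = s" by (auto simp: I_def J_def)
  have IJ: "I * J = 1\<^sub>m s" unfolding I_def J_def using sr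
    by (intro eq_matI) (auto simp: scalar_prod_def if_mult_zero)
  have "(I * P) * M * (Q * J) = I * ((P * (M * Q)) * J)"
    using 1(1-4) d by (simp add: mat_simps)
  also have "\<dots> = 1\<^sub>m s" using d IJ by (simp add: 1(5) mat_simps)
  finally show "rank_ge M s" unfolding rank_ge_def
    using d 1(1-4) by (intro exI[of _ "I * P"] exI[of _ "Q * J"]) auto
qed (rule is_rank_unique_le[OF assms])

lemma is_rank_iff: "is_rank M r \<longleftrightarrow> rank_ge M r \<and> \<not> rank_ge M (Suc r)"
  using rank_ge_iff ex_is_rank[of M] by (metis le_antisym not_less_eq_eq order_refl)

lemma is_rank_unique: "is_rank M r \<Longrightarrow> is_rank M s \<Longrightarrow> r = s"
  by (meson le_antisym order_refl rank_ge_iff)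

lemma is_rank_equivalent:
  assumes M: "is_rank M r" and "S' * S = 1\<^sub>m (dim_row M)" "T * T' = 1\<^sub>m (dim_col M)"
   and d: "dim_col S = dim_row M" "dim_row S' = dim_row M" "dim_col S' = dim_row S"
     "dim_row T = dim_col M" "dim_col T' = dim_col M" "dim_row T' = dim_col T"
  shows "is_rank (S * M * T) r"
proof -
  obtain P Q where 1: "dim_row P = r" "dim_col P = dim_row M" "dim_row Q = dim_col M" "dim_col Q = r"
    "P * (M * Q) = 1\<^sub>m r" "M * (Q * (P * M)) = M" using M by (elim is_rankE)
  have S: "S' * (S * Z) = Z" if "dim_row Z = dim_row M" for Z
    using that assms(2) d by (simp add: mult_one_left flip: mult_assoc)
  have T: "T * (T' * Z) = Z" if "dim_row Z = dim_col M" for Z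
    using that assms(3) d by (simp add: mult_one_left flip: mult_assoc)
  have M': "M * (Q * (P * (M * Z))) = M * Z" if "dim_row Z = dim_col M" for Z
  proof -
    have "M * (Q * (P * (M * Z))) = M * (Q * (P * M)) * Z"
      using that 1(1-4) by (simp add: mult_assoc)
    then show ?thesis by (simp add: 1(6))
  qed
  show ?thesis
    by (rule is_rankI[of "P * S'" _ _ "T' * Q"]) (use 1(1-5) d in \<open>simp_all add: mult_assoc S T M'\<close>)
qed

text \<open>
  Solvability of \<open>\<psi> M = c\<close>: with a generalized inverse \<open>G\<close> of \<open>M\<close>, the columns of \<open>1 - G M\<close> lie in the
  kernel of \<open>M\<close>, so \<open>c = c G M\<close> and \<open>\<psi> = c G\<close> is a solution.
\<close>

lemma row_space_criterion:
  fixes M :: "'k :: field mat"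
  assumes d: "dim_col c = dim_col M"
    and ker: "\<And>V. dim_row V = dim_col M \<Longrightarrow> M * V = 0\<^sub>m (dim_row M) (dim_col V) \<Longrightarrow>
       c * V = 0\<^sub>m (dim_row c) (dim_col V)"
  obtains \<psi> where "dim_row \<psi> = dim_row c" "dim_col \<psi> = dim_row M" "\<psi> * M = c"
proof -
  obtain r where "is_rank M r" using ex_is_rank by blast
  then obtain P Q where 1: "dim_row P = r" "dim_col P = dim_row M" "dim_row Q = dim_col M" "dim_col Q = r"
    "P * (M * Q) = 1\<^sub>m r" "M * (Q * (P * M)) = M" by (elim is_rankE)
  have "c * (1\<^sub>m (dim_col M) - Q * P * M) = 0\<^sub>m (dim_row c) (dim_col M)"
    by (rule ker[THEN trans]) (use 1 in \<open>auto simp: mat_simps\<close>)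
  then have "c - c * (Q * (P * M)) = 0\<^sub>m (dim_row c) (dim_col M)"
    using d 1 by (simp add: mat_simps)
  then have "c = c * (Q * (P * M))"
    by (rule diff_eq_zero_matD) (use d 1(1-4) in auto)
  then have "c * Q * P * M = c"
    using d 1(1-4) by (metis mult_assoc index_mult_mat(2,3))
  then show thesis by (intro that[of "c * Q * P"]) (use d 1 in auto)
qed

text \<open>
  A vector outside the range of \<open>M\<close> is separated from the range by a functional: this is
  \<open>\<psi> (M | s) = (0 | 1)\<close>, and a vector in the kernel of \<open>(M | s)\<close> with nonzero last coordinate would
  express \<open>s\<close> through \<open>M\<close>.
\<close>

lemma separation:
  fixes M s :: "'k :: field mat"
  assumes d: "dim_row s = dim_row M" "dim_col s = 1"
    and s: "\<And>w. dim_row w = dim_col M \<Longrightarrow> dim_col w = 1 \<Longrightarrow> M * w \<noteq> s"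
  obtains \<phi> where "dim_row \<phi> = 1" "dim_col \<phi> = dim_row M" "\<phi> * M = 0\<^sub>m 1 (dim_col M)" "\<phi> * s = 1\<^sub>m 1"
proof -
  let ?M = "hcat M s" and ?c = "hcat (0\<^sub>m 1 (dim_col M)) (1\<^sub>m 1) :: 'k mat"
  obtain \<phi> where phi: "dim_row \<phi> = dim_row ?c" "dim_col \<phi> = dim_row ?M" "\<phi> * ?M = ?c"
  proof (rule row_space_criterion[of ?c ?M])
    fix V assume V: "dim_row V = dim_col ?M" "?M * V = 0\<^sub>m (dim_row ?M) (dim_col V)"
    have "dim_row V = dim_col M + 1" using V d by simp
    then obtain V1 V2 where V12: "V = vcat V1 V2" "dim_row V1 = dim_col M" "dim_row V2 = 1" "dim_col V1 = dim_col V" "dim_col V2 = dim_col V"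
      by (rule vcat_split)
    have cV: "?c * V = V2"
      using V12(2-5) by (subst V12(1), subst hcat_mult_vcat) (simp_all add: mat_simps)
    have MV: "M * V1 + s * V2 = 0\<^sub>m (dim_row M) (dim_col V)"
      using V(2) V12(2-5) d by (subst (asm) V12(1), subst (asm) hcat_mult_vcat) simp_all
    have "V2 = 0\<^sub>m 1 (dim_col V)"
    proof (rule ccontr)
      assume "V2 \<noteq> 0\<^sub>m 1 (dim_col V)"
      then obtain j where j: "j < dim_col V" "V2 $$ (0, j) \<noteq> 0"
        using V12(3,5) by (metis eq_matI index_zero_mat less_one)
      \<comment> \<open>column \<open>j\<close> of \<open>V\<close>, scaled so that its last coordinate is \<open>- 1\<close>, writes \<open>s\<close> as \<open>M w\<close>\<close>
      define E where "E = mat (dim_col V) 1 (\<lambda>(i, _). if i = j then - 1 / V2 $$ (0, j) else 0)"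
      have dE: "dim_row E = dim_col V" "dim_col E = 1" by (auto simp: E_def)
      have V2E: "V2 * E = 0\<^sub>m 1 1 - 1\<^sub>m 1"
        using V12(3,5) j by (intro eq_matI) (simp_all add: E_def scalar_prod_def if_mult_zero)
      have "M * (V1 * E) + s * (V2 * E) = (M * V1 + s * V2) * E"
        using d dE V12(2-5) by (simp add: mat_simps)
      also have "\<dots> = 0\<^sub>m (dim_row M) 1" unfolding MV using dE by (simp add: mat_simps)
      finally have "M * (V1 * E) + (0\<^sub>m (dim_row M) 1 - s) = 0\<^sub>m (dim_row M) 1"
        unfolding V2E using d by (simp add: mat_simps)
      then have e: "(M * (V1 * E) + (0\<^sub>m (dim_row M) 1 - s)) $$ (i, 0) = 0" if "i < dim_row M" for i using that by simp
      have "M * (V1 * E) = s"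
      proof (rule eq_matI)
        fix i j' assume "i < dim_row s" "j' < dim_col s"
        then show "(M * (V1 * E)) $$ (i, j') = s $$ (i, j')"
          using e[of i] d dE V12(2-5) by (simp del: index_mult_mat(1))
      qed (use d dE in auto)
      then show False using s[of "V1 * E"] V12(2) dE by simp
    qed
    then show "?c * V = 0\<^sub>m (dim_row ?c) (dim_col V)" unfolding cV by simp
  qed (use d in auto)
  have "hcat (\<phi> * M) (\<phi> * s) = ?c" using phi d by (simp add: mult_hcat)
  then have "\<phi> * M = 0\<^sub>m 1 (dim_col M) \<and> \<phi> * s = 1\<^sub>m 1" using phi(1,2) d by (intro hcat_inject) auto
  then show thesis using that[of \<phi>] phi(1,2) by simp
qed

text \<open>
  Quantifying over matrices \<open>V\<close> instead of column vectors keeps injectivity within matrix algebra;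
  \<open>inj_mat_iff_vec\<close> shows that it makes no difference.
\<close>

definition inj_mat :: "'k :: field mat \<Rightarrow> bool" where
  "inj_mat M \<longleftrightarrow> (\<forall>V. dim_row V = dim_col M \<longrightarrow> M * V = 0\<^sub>m (dim_row M) (dim_col V) \<longrightarrow>
      V = 0\<^sub>m (dim_row V) (dim_col V))"

lemma inj_matI: "(\<And>V. dim_row V = dim_col M \<Longrightarrow> M * V = 0\<^sub>m (dim_row M) (dim_col V) \<Longrightarrow>
      V = 0\<^sub>m (dim_col M) (dim_col V)) \<Longrightarrow> inj_mat M"
  unfolding inj_mat_def by auto

lemma inj_matD: "inj_mat M \<Longrightarrow> dim_row V = dim_col M \<Longrightarrow> M * V = 0\<^sub>m n k \<Longrightarrow> V = 0\<^sub>m (dim_col M) (dim_col V)"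
  unfolding inj_mat_def by (metis index_mult_mat(2,3) index_zero_mat(2,3))

lemma inj_mat_left_inverse:
  assumes "inj_mat M"
  obtains Z where "dim_row Z = dim_col M" "dim_col Z = dim_row M" "Z * M = 1\<^sub>m (dim_col M)"
proof (rule row_space_criterion[of "1\<^sub>m (dim_col M)" M])
  fix V assume "dim_row V = dim_col M" "M * V = 0\<^sub>m (dim_row M) (dim_col V)"
  then show "1\<^sub>m (dim_col M) * V = 0\<^sub>m (dim_row (1\<^sub>m (dim_col M))) (dim_col V)"
    using inj_matD[OF assms] by (auto simp: mult_one_left)
qed (use that in auto)

lemma left_inverse_inj_mat:
  assumes "Z * M = 1\<^sub>m (dim_col M)" "dim_col Z = dim_row M"
  shows "inj_mat M"
proof (rule inj_matI)
  fix V assume V: "dim_row V = dim_col M" "M * V = 0\<^sub>m (dim_row M) (dim_col V)"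
  have "dim_row Z = dim_col M" by (metis assms(1) index_mult_mat(2) index_one_mat(2))
  moreover have "Z * (M * V) = V" using assms V(1) by (simp add: mult_one_left flip: mult_assoc)
  ultimately show "V = 0\<^sub>m (dim_col M) (dim_col V)" using assms unfolding V(2) by (simp add: mat_simps)
qed

text \<open>
  A retraction \<open>P\<close> with section \<open>Q\<close> has a complementary retraction and section: they come from a rank
  factorization of the idempotent \<open>1 - Q P\<close>.
\<close>

lemma complement:
  fixes P Q :: "'k :: field mat"
  assumes d: "dim_row P = m" "dim_col P = n" "dim_row Q = n" "dim_col Q = m" and PQ: "P * Q = 1\<^sub>m m"
  obtains r P' Q' where "dim_row P' = r" "dim_col P' = n" "dim_row Q' = n" "dim_col Q' = r" "n = m + r"
    "P' * Q' = 1\<^sub>m r" "P * Q' = 0\<^sub>m m r" "P' * Q = 0\<^sub>m r m" "Q * P + Q' * P' = 1\<^sub>m n"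
proof -
  have PQ': "P * (Q * Z) = Z" if "dim_row Z = m" for Z
    using that PQ d by (simp add: mult_one_left flip: mult_assoc)
  define E where "E = 1\<^sub>m n - Q * P"
  have dE: "dim_row E = n" "dim_col E = n" using d by (auto simp: E_def)
  have E: "E * E = E" "P * E = 0\<^sub>m m n" "E * Q = 0\<^sub>m n m"
  proof -
    show "P * E = 0\<^sub>m m n" "E * Q = 0\<^sub>m n m"
      using d by (auto simp: E_def mat_simps PQ PQ')
    then have "Q * P * E = 0\<^sub>m n n" using d dE by (simp add: mat_simps)
    then show "E * E = E" using d dE by (subst (1) E_def) (auto simp: mat_simps)
  qed
  have E': "E * (E * Z) = E * Z" "P * (E * Z) = 0\<^sub>m m (dim_col Z)" if "dim_row Z = n" for Z
    using that E dE d by (simp_all add: mult_zero_left flip: mult_assoc)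
  obtain r where "is_rank E r" using ex_is_rank by blast
  then obtain U V where 1: "dim_row U = r" "dim_col U = n" "dim_row V = n" "dim_col V = r"
    "U * (E * V) = 1\<^sub>m r" "E * (V * (U * E)) = E" using dE by (elim is_rankE) auto
  let ?P = "U * E" and ?Q = "E * V"
  have dim: "dim_row ?P = r" "dim_col ?P = n" "dim_row ?Q = n" "dim_col ?Q = r"
    and PQn: "?P * ?Q = 1\<^sub>m r" "P * ?Q = 0\<^sub>m m r" "?P * Q = 0\<^sub>m r m"
    using 1 d dE by (auto simp: mat_simps E' E)
  have sum: "Q * P + ?Q * ?P = 1\<^sub>m n"
  proof -
    have "?Q * ?P = E" using 1 dE by (simp add: mult_assoc)
    then show ?thesis using d by (auto simp: E_def)
  qed
  have "vcat P ?P * hcat Q ?Q = 1\<^sub>m (m + r)"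
    using dim d by (simp add: vcat_mult_hcat PQ PQn)
  then have "m + r \<le> n"
    using dim d by (intro inverse_pair_le[of "vcat P ?P" _ _ "hcat Q ?Q"]) auto
  moreover have "hcat Q ?Q * vcat P ?P = 1\<^sub>m n"
    using dim d sum by (simp add: hcat_mult_vcat)
  then have "n \<le> m + r"
    using dim d by (intro inverse_pair_le[of "hcat Q ?Q" _ _ "vcat P ?P"]) auto
  ultimately show thesis using that[OF dim _ PQn sum] by simp
qed

section \<open>Isomorphisms and direct sums of triples\<close>

lemma triple_space_iff:
  "(A, F, B) \<in> triple_space a b \<longleftrightarrow> dim_row A = a \<and> dim_col A = a \<and> dim_row F = b \<and> dim_col F = a \<and>
     dim_row B = b \<and> dim_col B = b"
  unfolding triple_space_def carrier_mat_def by simp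

lemma cancel_left:
  "g' * g = 1\<^sub>m n \<Longrightarrow> dim_col g' = dim_row g \<Longrightarrow> dim_col g = n \<Longrightarrow> dim_row Z = n \<Longrightarrow> g' * (g * Z) = (Z :: 'a :: semiring_1 mat)"
  by (simp add: mult_one_left flip: mult_assoc)

definition inverse_pair :: "nat \<Rightarrow> 'a :: semiring_1 mat \<Rightarrow> 'a mat \<Rightarrow> bool" where
  "inverse_pair n g g' \<longleftrightarrow> dim_row g = n \<and> dim_col g = n \<and> dim_row g' = n \<and> dim_col g' = n \<and>
     g * g' = 1\<^sub>m n \<and> g' * g = 1\<^sub>m n"

lemma inverse_pairD:
  assumes "inverse_pair n g g'"
  shows "dim_row g = n" "dim_col g = n" "dim_row g' = n" "dim_col g' = n" "g * g' = 1\<^sub>m n" "g' * g = 1\<^sub>m n"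
    and "dim_row Z = n \<Longrightarrow> g * (g' * Z) = Z" "dim_row Z = n \<Longrightarrow> g' * (g * Z) = Z"
  using assms cancel_left[of g g' n Z] cancel_left[of g' g n Z] by (simp_all add: inverse_pair_def)

lemma inverse_pair_one: "inverse_pair n (1\<^sub>m n) (1\<^sub>m n)"
  by (simp add: inverse_pair_def mult_one_left)

lemma inverse_pair_mult: "inverse_pair n g g' \<Longrightarrow> inverse_pair n k k' \<Longrightarrow> inverse_pair n (k * g) (g' * k')"
  using inverse_pairD[of n g g'] inverse_pairD[of n k k'] unfolding inverse_pair_def[of n "k * g"]
  by (simp add: mult_assoc)

lemma inverse_pair_dsum:
  "inverse_pair n g g' \<Longrightarrow> inverse_pair m k k' \<Longrightarrow> inverse_pair (n + m) (dsum g k) (dsum g' k')"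
  by (simp add: inverse_pair_def dsum_mult_dsum dsum_one)

lemma inj_mat_square_inverse:
  assumes "inj_mat M" "dim_row M = n" "dim_col M = n"
  obtains Z where "inverse_pair n M Z"
proof -
  obtain Z where Z: "dim_row Z = n" "dim_col Z = n" "Z * M = 1\<^sub>m n" using inj_mat_left_inverse[OF assms(1)] assms by metis
  moreover from this have "M * Z = 1\<^sub>m n"
    using mat_mult_left_right_inverse[of Z n M] assms by auto
  ultimately show thesis using that[of Z] assms by (simp add: inverse_pair_def)
qed

text \<open>The base changes \<open>g\<close> and \<open>k\<close> differ when \<open>A\<close> and \<open>A'\<close> are the embeddings \<open>F\<close> of two triples.\<close>

lemma intertwiner_inverse:
  assumes "g * A = A' * k" "inverse_pair n g g'" "inverse_pair m k k'"
    "dim_row A = n" "dim_col A = m" "dim_row A' = n" "dim_col A' = m"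
  shows "g' * A' = A * k'"
proof -
  note d = assms(4-) inverse_pairD[OF assms(2)] inverse_pairD[OF assms(3)]
  have "g' * A' = g' * ((A' * k) * k')" by (simp add: d mult_assoc mult_one_right)
  also have "\<dots> = A * k'" unfolding assms(1)[symmetric] by (simp add: d mult_assoc)
  finally show ?thesis .
qed

lemma intertwiner_mult:
  assumes "g * A = A' * g'" "k * A' = A'' * k'" "dim_col k = dim_row g" "dim_col g = dim_row A"
    "dim_col A' = dim_row g'" "dim_row A' = dim_col k" "dim_col A'' = dim_row k'" "dim_col k' = dim_row g'"
  shows "(k * g) * A = A'' * (k' * (g' :: 'a :: semiring_0 mat))"
proof -
  have "(k * g) * A = k * (A' * g')" using assms(3-) by (simp add: mult_assoc assms(1))
  also have "\<dots> = (A'' * k') * g'" unfolding assms(2)[symmetric] using assms(3-) by (simp add: mult_assoc)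
  finally show ?thesis using assms(3-) by (simp add: mult_assoc)
qed

lemma isomorphicI:
  assumes "(A, F, B) \<in> triple_space a b" "(A', F', B') \<in> triple_space a b"
    and g: "inverse_pair a g g'" "inverse_pair b h h'"
    and eqs: "g * A = A' * g" "h * B = B' * h" "F' * g = h * F"
  shows "isomorphic (A, F, B) (A', F', B')"
proof -
  note d = assms(1,2)[unfolded triple_space_iff] inverse_pairD[OF g(1)] inverse_pairD[OF g(2)]
  have "g' * A' = A * g'" by (rule intertwiner_inverse[OF eqs(1) g(1) g(1)]) (simp_all add: d)
  moreover have "h' * B' = B * h'" by (rule intertwiner_inverse[OF eqs(2) g(2) g(2)]) (simp_all add: d)
  moreover have "h' * F' = F * g'" by (rule intertwiner_inverse[OF eqs(3)[symmetric] g(2,1)]) (simp_all add: d)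
  moreover have "g \<in> carrier_mat a a" "h \<in> carrier_mat b b" "g' \<in> carrier_mat a a" "h' \<in> carrier_mat b b"
    by (rule carrier_matI; simp add: d)+
  ultimately have "is_morphism (A, F, B) (A', F', B') (g, h)" "is_morphism (A', F', B') (A, F, B) (g', h')"
    using eqs by (simp_all add: d)
  then show ?thesis unfolding isomorphic_def
    by (rule_tac exI[of _ g], rule_tac exI[of _ h], rule_tac exI[of _ g'], rule_tac exI[of _ h']) (simp add: d)
qed

text \<open>
  Isomorphic triples have equal dimensions, and then an isomorphism is a pair of invertible base
  changes.
\<close>

lemma isomorphicE:
  assumes "isomorphic (A, F, B) (A', F', B')" "(A, F, B) \<in> triple_space a b" "(A', F', B') \<in> triple_space a' b'"
  obtains g g' h h' where "a' = a" "b' = b" "inverse_pair a g g'" "inverse_pair b h h'"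
    "g * A = A' * g" "h * B = B' * h" "F' * g = h * F"
proof -
  note d = assms(2,3)[unfolded triple_space_iff]
  from assms(1) obtain g h g' h' where *:
    "is_morphism (A, F, B) (A', F', B') (g, h)" "is_morphism (A', F', B') (A, F, B) (g', h')"
    "g' * g = 1\<^sub>m (dim_col g)" "g * g' = 1\<^sub>m (dim_row g)"
    "h' * h = 1\<^sub>m (dim_col h)" "h * h' = 1\<^sub>m (dim_row h)" unfolding isomorphic_def by blast
  have c: "g \<in> carrier_mat a' a" "h \<in> carrier_mat b' b" "g' \<in> carrier_mat a a'" "h' \<in> carrier_mat b b'"
    using *(1,2) d by auto
  note dd = carrier_matD[OF c(1)] carrier_matD[OF c(2)] carrier_matD[OF c(3)] carrier_matD[OF c(4)]
  note inv = *(3-6)[unfolded dd]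
  have "a' \<le> a" by (rule inverse_pair_le[OF c(1,3) inv(2)])
  moreover have "a \<le> a'" by (rule inverse_pair_le[OF c(3,1) inv(1)])
  moreover have "b' \<le> b" by (rule inverse_pair_le[OF c(2,4) inv(4)])
  moreover have "b \<le> b'" by (rule inverse_pair_le[OF c(4,2) inv(3)])
  ultimately have ab: "a' = a" "b' = b" by auto
  show thesis
    by (rule that[of g g' h h']) (use *(1,2) dd inv ab in \<open>auto simp: inverse_pair_def\<close>)
qed

lemma isomorphic_refl: "X \<in> triple_space a b \<Longrightarrow> isomorphic X X"
  by (cases X, clarify, rule isomorphicI[OF _ _ inverse_pair_one inverse_pair_one])
     (auto simp: triple_space_iff mult_one_left mult_one_right)

lemma isomorphic_dims:
  "isomorphic X Y \<Longrightarrow> X \<in> triple_space a b \<Longrightarrow> Y \<in> triple_space a' b' \<Longrightarrow> a' = a \<and> b' = b"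
  by (cases X, cases Y, clarify, erule isomorphicE, assumption, assumption, simp)

lemma isomorphic_sym:
  assumes "isomorphic X Y"
  shows "isomorphic Y X"
proof -
  obtain g h g' h' where *: "is_morphism X Y (g, h)" "is_morphism Y X (g', h')"
    "g' * g = 1\<^sub>m (dim_col g)" "g * g' = 1\<^sub>m (dim_row g)"
    "h' * h = 1\<^sub>m (dim_col h)" "h * h' = 1\<^sub>m (dim_row h)" using assms unfolding isomorphic_def by blast
  have "dim_row g' = dim_col g" "dim_col g' = dim_row g" "dim_row h' = dim_col h" "dim_col h' = dim_row h"
    using arg_cong[OF *(3), of dim_row] arg_cong[OF *(4), of dim_col]
      arg_cong[OF *(5), of dim_row] arg_cong[OF *(6), of dim_col] by simp_all
  with * show ?thesis unfolding isomorphic_def by metis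
qed

lemma isomorphic_trans:
  assumes iso: "isomorphic X Y" "isomorphic Y Z"
    and sp: "X \<in> triple_space a b" "Y \<in> triple_space a' b'" "Z \<in> triple_space a'' b''"
  shows "isomorphic X Z"
proof -
  obtain A F B A' F' B' A'' F'' B'' where eq: "X = (A, F, B)" "Y = (A', F', B')" "Z = (A'', F'', B'')"
    by (cases X, cases Y, cases Z)
  have dims: "a' = a" "b' = b" "a'' = a" "b'' = b"
    using isomorphic_dims[OF iso(1) sp(1,2)] isomorphic_dims[OF iso(2) sp(2,3)] by auto
  note sp = sp[unfolded eq dims]
  obtain g g' h h' where 1: "inverse_pair a g g'" "inverse_pair b h h'"
    "g * A = A' * g" "h * B = B' * h" "F' * g = h * F" by (rule isomorphicE[OF iso(1)[unfolded eq] sp(1,2)])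
  obtain k k' l l' where 2: "inverse_pair a k k'" "inverse_pair b l l'"
    "k * A' = A'' * k" "l * B' = B'' * l" "F'' * k = l * F'" by (rule isomorphicE[OF iso(2)[unfolded eq] sp(2,3)])
  note d = sp[unfolded triple_space_iff] 1(1,2)[THEN inverse_pairD(1)] 1(1,2)[THEN inverse_pairD(2)]
    2(1,2)[THEN inverse_pairD(1)] 2(1,2)[THEN inverse_pairD(2)]
  show ?thesis unfolding eq
  proof (rule isomorphicI[OF sp(1,3) inverse_pair_mult[OF 1(1) 2(1)] inverse_pair_mult[OF 1(2) 2(2)]])
    show "(k * g) * A = A'' * (k * g)" by (rule intertwiner_mult[OF 1(3) 2(3)]) (simp_all add: d)
    show "(l * h) * B = B'' * (l * h)" by (rule intertwiner_mult[OF 1(4) 2(4)]) (simp_all add: d)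
    show "F'' * (k * g) = (l * h) * F"
      by (rule intertwiner_mult[OF 1(5)[symmetric] 2(5)[symmetric], symmetric]) (simp_all add: d)
  qed
qed

fun tsum :: "'k :: field triple \<Rightarrow> 'k triple \<Rightarrow> 'k triple" where
  "tsum (A, F, B) (A', F', B') = (dsum A A', dsum F F', dsum B B')"

lemma tsum_triple_space: "X \<in> triple_space a b \<Longrightarrow> Y \<in> triple_space a' b' \<Longrightarrow> tsum X Y \<in> triple_space (a + a') (b + b')"
  by (cases X, cases Y) (auto simp: triple_space_iff)

lemma direct_sum_Nil: "direct_sum [] = (0\<^sub>m 0 0, 0\<^sub>m 0 0, 0\<^sub>m 0 0)"
  by (simp add: direct_sum_def)

lemma direct_sum_Cons: "direct_sum (X # Xs) = tsum X (direct_sum Xs)"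
  by (cases X) (simp only: direct_sum_def list.map diag_block_mat_Cons tsum.simps o_def fst_conv snd_conv)

lemma tsum_cong:
  assumes "isomorphic X X'" "isomorphic Y Y'" "X \<in> triple_space a b" "X' \<in> triple_space a b"
   "Y \<in> triple_space c d" "Y' \<in> triple_space c d"
  shows "isomorphic (tsum X Y) (tsum X' Y')"
proof -
  obtain A F B A' F' B' A2 F2 B2 A2' F2' B2' where eq: "X = (A, F, B)" "X' = (A', F', B')" "Y = (A2, F2, B2)" "Y' = (A2', F2', B2')"
    by (cases X, cases Y, cases X', cases Y')
  note a = assms[unfolded eq]
  note d = a(3-6)[unfolded triple_space_iff]
  obtain g g' h h' where 1: "inverse_pair a g g'" "inverse_pair b h h'"
    "g * A = A' * g" "h * B = B' * h" "F' * g = h * F" by (rule isomorphicE[OF a(1,3,4)])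
  obtain k k' l l' where 2: "inverse_pair c k k'" "inverse_pair d l l'"
    "k * A2 = A2' * k" "l * B2 = B2' * l" "F2' * k = l * F2" by (rule isomorphicE[OF a(2,5,6)])
  note dims = 1(1,2)[THEN inverse_pairD(1)] 1(1,2)[THEN inverse_pairD(2)]
    2(1,2)[THEN inverse_pairD(1)] 2(1,2)[THEN inverse_pairD(2)]
  show ?thesis unfolding eq tsum.simps
    by (rule isomorphicI[OF _ _ inverse_pair_dsum[OF 1(1) 2(1)] inverse_pair_dsum[OF 1(2) 2(2)]])
       (simp_all add: d dims 1(3-) 2(3-) triple_space_iff dsum_mult_dsum)
qed

lemma dsum_assoc: "dsum (dsum A B) C = dsum A (dsum B C)"
  unfolding dsum_def by (rule assoc_four_block_mat[symmetric])

lemma tsum_assoc: "tsum (tsum X Y) Z = tsum X (tsum Y Z)"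
  by (cases X, cases Y, cases Z) (simp add: dsum_assoc)

definition swap_mat :: "nat \<Rightarrow> nat \<Rightarrow> 'a :: semiring_1 mat" where
  "swap_mat n k = four_block_mat (0\<^sub>m k n) (1\<^sub>m k) (1\<^sub>m n) (0\<^sub>m n k)"

lemma dim_swap_mat [simp]: "dim_row (swap_mat n k) = n + k" "dim_col (swap_mat n k) = n + k"
  by (auto simp: swap_mat_def)

lemma inverse_pair_swap_mat: "inverse_pair (n + k) (swap_mat n k) (swap_mat k n)"
proof -
  have "swap_mat k n * swap_mat n k = (1\<^sub>m (n + k) :: 'a mat)" for n k
    unfolding swap_mat_def by (subst four_block_mult_four_block) (auto simp: mat_simps add.commute[of k n])
  from this[of k n] this[of n k] show ?thesis by (simp add: inverse_pair_def add.commute)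
qed

lemma swap_mat_dsum:
  "dim_row A = n \<Longrightarrow> dim_col A = n' \<Longrightarrow> dim_row B = k \<Longrightarrow> dim_col B = k' \<Longrightarrow>
    swap_mat n k * dsum A B = dsum B A * (swap_mat n' k' :: 'a :: semiring_1 mat)"
  unfolding swap_mat_def dsum_def by (subst (1 2) four_block_mult_four_block) (auto simp: mat_simps)

lemma tsum_commute:
  assumes "X \<in> triple_space a b" "Y \<in> triple_space c d"
  shows "isomorphic (tsum X Y) (tsum Y X)"
proof -
  obtain A F B A2 F2 B2 where eq: "X = (A, F, B)" "Y = (A2, F2, B2)"
    by (cases X, cases Y)
  note d = assms[unfolded eq triple_space_iff]
  show ?thesis unfolding eq tsum.simps
    by (rule isomorphicI[OF _ _ inverse_pair_swap_mat[of a c] inverse_pair_swap_mat[of b d]])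
       (simp_all add: d triple_space_iff swap_mat_dsum)
qed

lemma tsum_left_commute:
  assumes "X \<in> triple_space a b" "Y \<in> triple_space c d" "Z \<in> triple_space a' b'"
  shows "isomorphic (tsum X (tsum Y Z)) (tsum Y (tsum X Z))"
proof -
  have "tsum Y X \<in> triple_space (a + c) (b + d)" using tsum_triple_space[OF assms(2,1)] by (simp add: add.commute)
  then show ?thesis
    unfolding tsum_assoc[symmetric]
    by (intro tsum_cong[OF tsum_commute[OF assms(1,2)] isomorphic_refl[OF assms(3)] tsum_triple_space[OF assms(1,2)] _ assms(3,3)])
qed

section \<open>Splitting off a direct summand\<close>

text \<open>
  The triples to be decomposed, up to a choice of bases. Nilpotency of \<open>B\<close> replaces the Jordan type,
  which a direct summand does not inherit.
\<close>

definition s2_triple :: "nat \<Rightarrow> nat \<Rightarrow> 'k :: field triple \<Rightarrow> bool" where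
  "s2_triple a b X \<longleftrightarrow> X \<in> triple_space a b \<and> (case X of (A, F, B) \<Rightarrow> A * A = 0\<^sub>m a a \<and> F * A = B * F \<and>
     inj_mat F \<and> (\<exists>n. B ^\<^sub>m n = 0\<^sub>m b b))"

lemma pow_mat_commute_intertwiner:
  fixes B :: "'k :: semiring_1 mat"
  assumes "P * B = B' * P" "dim_row B = b" "dim_col B = b" "dim_row B' = b'" "dim_col B' = b'" "dim_col P = b" "dim_row P = b'"
  shows "P * B ^\<^sub>m k = B' ^\<^sub>m k * P"
proof (induction k)
  case (Suc k)
  have "P * B ^\<^sub>m Suc k = (P * B ^\<^sub>m k) * B" using assms by (simp add: mult_assoc)
  also have "\<dots> = B' ^\<^sub>m k * (P * B)" using assms(2-) by (simp add: Suc mult_assoc)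
  also have "\<dots> = B' ^\<^sub>m Suc k * P" using assms(2-) by (simp add: assms(1) mult_assoc)
  finally show ?case .
qed (use assms in \<open>auto simp: mult_one_left mult_one_right\<close>)

text \<open>
  An idempotent endomorphism of a triple splits: the complements of the two components of a
  retraction onto \<open>Y\<close> carry the other summand, and the defining properties pass to it because its
  operators are compressions \<open>P' B Q'\<close> along intertwiners.
\<close>

lemma split_retract:
  fixes A :: "'k :: field mat"
  assumes X: "s2_triple a b (A, F, B)" and Y: "(A0, F0, B0) \<in> triple_space a0 b0"
    and d: "dim_row Q1 = a" "dim_col Q1 = a0" "dim_row P1 = a0" "dim_col P1 = a"
      "dim_row Q2 = b" "dim_col Q2 = b0" "dim_row P2 = b0" "dim_col P2 = b"
    and Q: "A * Q1 = Q1 * A0" "B * Q2 = Q2 * B0" "F * Q1 = Q2 * F0"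
    and P: "A0 * P1 = P1 * A" "B0 * P2 = P2 * B" "F0 * P1 = P2 * F"
    and PQ: "P1 * Q1 = 1\<^sub>m a0" "P2 * Q2 = 1\<^sub>m b0"
  obtains a' b' X' where "s2_triple a' b' X'" "a = a0 + a'" "b = b0 + b'"
    "isomorphic (A, F, B) (tsum (A0, F0, B0) X')"
proof -
  note Xd = X[unfolded s2_triple_def split triple_space_iff] and Yd = Y[unfolded triple_space_iff]
  have dX: "dim_row A = a" "dim_col A = a" "dim_row F = b" "dim_col F = a" "dim_row B = b" "dim_col B = b"
    and AA: "A * A = 0\<^sub>m a a" and FA: "F * A = B * F" and injF: "inj_mat F" using Xd by auto
  obtain n where n: "B ^\<^sub>m n = 0\<^sub>m b b" using Xd by auto
  obtain a' P1' Q1' where 1: "dim_row P1' = a'" "dim_col P1' = a" "dim_row Q1' = a" "dim_col Q1' = a'"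
    "a = a0 + a'" "P1' * Q1' = 1\<^sub>m a'" "P1 * Q1' = 0\<^sub>m a0 a'" "P1' * Q1 = 0\<^sub>m a' a0" "Q1 * P1 + Q1' * P1' = 1\<^sub>m a"
    by (rule complement[OF d(3,4,1,2) PQ(1)])
  obtain b' P2' Q2' where 2: "dim_row P2' = b'" "dim_col P2' = b" "dim_row Q2' = b" "dim_col Q2' = b'"
    "b = b0 + b'" "P2' * Q2' = 1\<^sub>m b'" "P2 * Q2' = 0\<^sub>m b0 b'" "P2' * Q2 = 0\<^sub>m b' b0" "Q2 * P2 + Q2' * P2' = 1\<^sub>m b"
    by (rule complement[OF d(7,8,5,6) PQ(2)])
  note dd = d dX 1(1-4) 2(1-4)
  define A' where "A' = P1' * A * Q1'"
  define F' where "F' = P2' * F * Q1'"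
  define B' where "B' = P2' * B * Q2'"
  have dX': "dim_row A' = a'" "dim_col A' = a'" "dim_row F' = b'" "dim_col F' = a'" "dim_row B' = b'" "dim_col B' = b'"
    using dd by (auto simp: A'_def F'_def B'_def)
  have res1: "Q1' * (P1' * Z) = Z - Q1 * (P1 * Z)" if "dim_row Z = a" for Z
  proof -
    have "Q1 * (P1 * Z) + Q1' * (P1' * Z) = Z"
      using arg_cong[OF 1(9), of "\<lambda>M. M * Z"] that dd by (simp add: mat_simps)
    then show ?thesis using dd that by (intro add_eq_mat_diff) auto
  qed
  have res2: "Q2' * (P2' * Z) = Z - Q2 * (P2 * Z)" if "dim_row Z = b" for Z
  proof -
    have "Q2 * (P2 * Z) + Q2' * (P2' * Z) = Z"
      using arg_cong[OF 2(9), of "\<lambda>M. M * Z"] that dd by (simp add: mat_simps)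
    then show ?thesis using dd that by (intro add_eq_mat_diff) auto
  qed
  have c1: "A * Q1' = Q1' * A'"
  proof -
    have "P1 * (A * Q1') = A0 * (P1 * Q1')" using dd Yd by (simp flip: mult_assoc add: P)
    then show ?thesis using dd Yd by (simp add: A'_def mult_assoc res1 1(7) mat_simps)
  qed
  have c2: "B * Q2' = Q2' * B'"
  proof -
    have "P2 * (B * Q2') = B0 * (P2 * Q2')" using dd Yd by (simp flip: mult_assoc add: P)
    then show ?thesis using dd Yd by (simp add: B'_def mult_assoc res2 2(7) mat_simps)
  qed
  have c3: "F * Q1' = Q2' * F'"
  proof -
    have "P2 * (F * Q1') = F0 * (P1 * Q1')" using dd Yd by (simp flip: mult_assoc add: P)
    then show ?thesis using dd Yd by (simp add: F'_def mult_assoc res2 1(7) mat_simps)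
  qed
  have PA: "P1' * A = A' * P1'"
  proof -
    have "P1' * (A * (Q1 * P1)) = (P1' * Q1) * (A0 * P1)" using dd Yd
      by (simp add: Q mult_assoc mult_reassoc[OF Q(1)])
    then show ?thesis using dd Yd res1[of "1\<^sub>m a"] by (simp add: A'_def mult_assoc 1(8) mat_simps)
  qed
  have PB: "P2' * B = B' * P2'"
  proof -
    have "P2' * (B * (Q2 * P2)) = (P2' * Q2) * (B0 * P2)" using dd Yd
      by (simp add: Q mult_assoc mult_reassoc[OF Q(2)])
    then show ?thesis using dd Yd res2[of "1\<^sub>m b"] by (simp add: B'_def mult_assoc 2(8) mat_simps)
  qed
  have PF: "P2' * F = F' * P1'"
  proof -
    have "P2' * (F * (Q1 * P1)) = (P2' * Q2) * (F0 * P1)" using dd Yd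
      by (simp add: Q mult_assoc mult_reassoc[OF Q(3)])
    then show ?thesis using dd Yd res1[of "1\<^sub>m a"] by (simp add: F'_def mult_assoc 2(8) mat_simps)
  qed
  have "s2_triple a' b' (A', F', B')"
    unfolding s2_triple_def split triple_space_iff
  proof (intro conjI)
    show "A' * A' = 0\<^sub>m a' a'"
    proof -
      have "A' * A' = P1' * (A * (Q1' * A'))" using dd dX' by (simp add: A'_def mult_assoc)
      also have "\<dots> = P1' * (A * A * Q1')" using dd dX' by (simp add: mult_assoc flip: c1)
      also have "\<dots> = 0\<^sub>m a' a'" using dd by (simp add: AA mat_simps)
      finally show ?thesis .
    qed
    show "F' * A' = B' * F'"
    proof -
      have "F' * A' = P2' * (F * (Q1' * A'))" using dd dX' by (simp add: F'_def mult_assoc)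
      also have "\<dots> = P2' * ((F * A) * Q1')" using dd dX' by (simp add: mult_assoc flip: c1)
      also have "\<dots> = (P2' * B) * (F * Q1')" using dd dX' by (simp add: mult_assoc FA)
      also have "\<dots> = B' * F'" using dd dX' by (simp add: mult_assoc PB F'_def)
      finally show ?thesis .
    qed
    show "inj_mat F'"
    proof (rule inj_matI)
      fix V assume V: "dim_row V = dim_col F'" "F' * V = 0\<^sub>m (dim_row F') (dim_col V)"
      then have "Q2' * (F' * V) = 0\<^sub>m b (dim_col V)" using dd dX' by (simp add: mat_simps)
      then have "F * (Q1' * V) = 0\<^sub>m b (dim_col V)" using dd dX' V(1) by (simp add: c3 flip: mult_assoc)
      then have "Q1' * V = 0\<^sub>m a (dim_col V)" using inj_matD[OF injF, of "Q1' * V"] dd dX' V(1) by auto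
      then have "P1' * (Q1' * V) = 0\<^sub>m a' (dim_col V)" using dd by (simp add: mat_simps)
      then show "V = 0\<^sub>m (dim_col F') (dim_col V)" using 1(6) dd dX' V(1) by (simp add: cancel_left)
    qed
    have "B' ^\<^sub>m n = B' ^\<^sub>m n * (P2' * Q2')" using 2(6) dX' by (simp add: mult_one_right)
    also have "\<dots> = P2' * B ^\<^sub>m n * Q2'"
      unfolding pow_mat_commute_intertwiner[OF PB dX(5,6) dX'(5,6) 2(2,1)] using dd dX' by (simp add: mult_assoc)
    also have "\<dots> = 0\<^sub>m b' b'" unfolding n using dd by (simp add: mat_simps)
    finally show "\<exists>n. B' ^\<^sub>m n = 0\<^sub>m b' b'" ..
  qed (use dX' in auto)
  moreover have "isomorphic (A, F, B) (tsum (A0, F0, B0) (A', F', B'))"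
    unfolding tsum.simps
  proof (rule isomorphicI[of _ _ _ a b _ _ _ "vcat P1 P1'" "hcat Q1 Q1'" "vcat P2 P2'" "hcat Q2 Q2'"])
    show "inverse_pair a (vcat P1 P1') (hcat Q1 Q1')" "inverse_pair b (vcat P2 P2') (hcat Q2 Q2')"
      using dd PQ 1(5-9) 2(5-9) by (simp_all add: inverse_pair_def vcat_mult_hcat hcat_mult_vcat)
    show "vcat P1 P1' * A = dsum A0 A' * vcat P1 P1'"
      using dd dX' Yd by (simp add: vcat_mult dsum_mult_vcat P PA)
    show "vcat P2 P2' * B = dsum B0 B' * vcat P2 P2'"
      using dd dX' Yd by (simp add: vcat_mult dsum_mult_vcat P PB)
    show "dsum F0 F' * vcat P1 P1' = vcat P2 P2' * F"
      using dd dX' Yd by (simp add: vcat_mult dsum_mult_vcat P PF)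
  qed (use dd dX' Yd 1(5) 2(5) in \<open>auto simp: triple_space_iff\<close>)
  ultimately show thesis using that 1(5) 2(5) by blast
qed

text \<open>
  The kernel of an endomorphism \<open>E\<close> is \<open>J\<close>-invariant, so if it is nonzero it meets the kernel of the
  nilpotent \<open>J\<close>.
\<close>

lemma inj_mat_if_inj_on_kernel:
  fixes E J :: "'k :: field mat"
  assumes d: "dim_row J = n" "dim_col J = n" "dim_row E = n" "dim_col E = n" and comm: "E * J = J * E"
    and nil: "J ^\<^sub>m N = 0\<^sub>m n n"
    and ker: "\<And>V. dim_row V = n \<Longrightarrow> J * V = 0\<^sub>m n (dim_col V) \<Longrightarrow> E * V = 0\<^sub>m n (dim_col V) \<Longrightarrow> V = 0\<^sub>m n (dim_col V)"
  shows "inj_mat E"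
proof (rule inj_matI)
  fix V assume V: "dim_row V = dim_col E" "E * V = 0\<^sub>m (dim_row E) (dim_col V)"
  have "J ^\<^sub>m k * V = 0\<^sub>m n (dim_col V) \<Longrightarrow> dim_row V = n \<Longrightarrow> E * V = 0\<^sub>m n (dim_col V) \<Longrightarrow> V = 0\<^sub>m n (dim_col V)" for k V
  proof (induction k arbitrary: V)
    case 0
    then show ?case using d by (simp add: mult_one_left)
  next
    case (Suc k)
    have "J ^\<^sub>m k * (J * V) = 0\<^sub>m n (dim_col (J * V))" using Suc.prems d by (simp add: mult_assoc)
    moreover have "E * (J * V) = J * (E * V)" using d Suc.prems(2) by (simp add: comm flip: mult_assoc)
    ultimately have "J * V = 0\<^sub>m n (dim_col (J * V))" using d Suc.prems by (intro Suc.IH) (auto simp: mat_simps)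
    then show ?case using Suc.prems by (intro ker) auto
  qed
  from this[of N V] V d show "V = 0\<^sub>m (dim_col E) (dim_col V)" by (simp add: nil mat_simps)
qed

text \<open>
  It suffices that the composite \<open>Y \<rightarrow> X \<rightarrow> Y\<close> is injective on the kernel of the operator \<open>B0\<close>: then
  it is an automorphism of \<open>Y\<close>, and composing the second map with its inverse gives a retraction.
\<close>

lemma split_summand:
  fixes A :: "'k :: field mat"
  assumes X: "s2_triple a b (A, F, B)" and Y: "s2_triple a0 b0 (A0, F0, B0)"
    and d: "dim_row Q1 = a" "dim_col Q1 = a0" "dim_row P1 = a0" "dim_col P1 = a"
      "dim_row Q2 = b" "dim_col Q2 = b0" "dim_row P2 = b0" "dim_col P2 = b"
    and Q: "A * Q1 = Q1 * A0" "B * Q2 = Q2 * B0" "F * Q1 = Q2 * F0"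
    and P: "A0 * P1 = P1 * A" "B0 * P2 = P2 * B" "F0 * P1 = P2 * F"
    and ker: "\<And>V. dim_row V = b0 \<Longrightarrow> B0 * V = 0\<^sub>m b0 (dim_col V) \<Longrightarrow> P2 * (Q2 * V) = 0\<^sub>m b0 (dim_col V) \<Longrightarrow> V = 0\<^sub>m b0 (dim_col V)"
  obtains a' b' X' where "s2_triple a' b' X'" "a = a0 + a'" "b = b0 + b'"
    "isomorphic (A, F, B) (tsum (A0, F0, B0) X')"
proof -
  have dX: "dim_row A = a" "dim_col A = a" "dim_row F = b" "dim_col F = a" "dim_row B = b" "dim_col B = b"
    using X by (auto simp: s2_triple_def triple_space_iff)
  have dY: "dim_row A0 = a0" "dim_col A0 = a0" "dim_row F0 = b0" "dim_col F0 = a0" "dim_row B0 = b0" "dim_col B0 = b0"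
    and inj0: "inj_mat F0" using Y by (auto simp: s2_triple_def triple_space_iff)
  obtain N where N: "B0 ^\<^sub>m N = 0\<^sub>m b0 b0" using Y by (auto simp: s2_triple_def)
  note dd = d dX dY
  define E1 where "E1 = P1 * Q1"
  define E2 where "E2 = P2 * Q2"
  have dE: "dim_row E1 = a0" "dim_col E1 = a0" "dim_row E2 = b0" "dim_col E2 = b0" using d by (auto simp: E1_def E2_def)
  have cA: "E1 * A0 = A0 * E1"
  proof -
    have "E1 * A0 = P1 * (A * Q1)" using dd by (simp add: E1_def mult_assoc Q)
    also have "\<dots> = A0 * E1" using dd by (simp add: E1_def P flip: mult_assoc)
    finally show ?thesis .
  qed
  have cB: "E2 * B0 = B0 * E2"
  proof -
    have "E2 * B0 = P2 * (B * Q2)" using dd by (simp add: E2_def mult_assoc Q)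
    also have "\<dots> = B0 * E2" using dd by (simp add: E2_def P flip: mult_assoc)
    finally show ?thesis .
  qed
  have cF: "E2 * F0 = F0 * E1"
  proof -
    have "E2 * F0 = P2 * (F * Q1)" using dd by (simp add: E2_def mult_assoc Q)
    also have "\<dots> = F0 * E1" using dd by (simp add: E1_def P flip: mult_assoc)
    finally show ?thesis .
  qed
  have inj2: "inj_mat E2"
    by (rule inj_mat_if_inj_on_kernel[OF dY(5,6) dE(3,4) cB N]) (use ker dd in \<open>auto simp: E2_def mult_assoc\<close>)
  have inj1: "inj_mat E1"
  proof (rule inj_matI)
    fix V assume V: "dim_row V = dim_col E1" "E1 * V = 0\<^sub>m (dim_row E1) (dim_col V)"
    have "E2 * (F0 * V) = F0 * (E1 * V)" using dE dY V(1) by (simp add: cF flip: mult_assoc)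
    then have "E2 * (F0 * V) = 0\<^sub>m b0 (dim_col V)" using V dE dY by (simp add: mat_simps)
    then have "F0 * V = 0\<^sub>m b0 (dim_col V)" using inj_matD[OF inj2, of "F0 * V"] dE dY V by auto
    then show "V = 0\<^sub>m (dim_col E1) (dim_col V)" using inj_matD[OF inj0, of V] dE dY V by auto
  qed
  obtain Z1 where "inverse_pair a0 E1 Z1" by (rule inj_mat_square_inverse[OF inj1 dE(1,2)])
  note EZ1 = this and Z1 = inverse_pairD(3,4,6)[OF this]
  obtain Z2 where "inverse_pair b0 E2 Z2" by (rule inj_mat_square_inverse[OF inj2 dE(3,4)])
  note EZ2 = this and Z2 = inverse_pairD(3,4,6)[OF this]
  have zA: "Z1 * A0 = A0 * Z1" by (rule intertwiner_inverse[OF cA EZ1 EZ1]) (use dY in auto)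
  have zB: "Z2 * B0 = B0 * Z2" by (rule intertwiner_inverse[OF cB EZ2 EZ2]) (use dY in auto)
  have zF: "Z2 * F0 = F0 * Z1" by (rule intertwiner_inverse[OF cF EZ2 EZ1]) (use dY in auto)
  show thesis
  proof (rule split_retract[OF X _ d(1,2) _ _ d(5,6) _ _ Q])
    show "(A0, F0, B0) \<in> triple_space a0 b0" using Y by (simp add: s2_triple_def)
    show "A0 * (Z1 * P1) = Z1 * P1 * A" using dd Z1(1,2) by (simp add: mult_assoc flip: P zA) (simp flip: mult_assoc zA)
    show "B0 * (Z2 * P2) = Z2 * P2 * B" using dd Z2(1,2) by (simp add: mult_assoc flip: P zB) (simp flip: mult_assoc zB)
    show "F0 * (Z1 * P1) = Z2 * P2 * F" using dd Z1(1,2) Z2(1,2) by (simp add: mult_assoc flip: P zF) (simp flip: mult_assoc zF)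
    show "Z1 * P1 * Q1 = 1\<^sub>m a0" "Z2 * P2 * Q2 = 1\<^sub>m b0"
      using dd Z1 Z2 by (simp_all add: E1_def E2_def mult_assoc)
  qed (use that Z1 Z2 dd in auto)
qed

section \<open>The indecomposable triples\<close>

text \<open>
  The nilpotent Jordan block, which is multiplication by \<open>T\<close> on \<open>k[T]/(T\<^sup>m)\<close> with basis vector \<open>i\<close>
  standing for \<open>T\<^bsup>m-1-i\<^esup>\<close>; its kernel is spanned by basis vector \<open>0\<close>.
\<close>

abbreviation J :: "nat \<Rightarrow> 'k :: field mat" where "J m \<equiv> jordan_block m 0"

lemma nil_op_Nil: "nil_op [] = 0\<^sub>m 0 0"
  by (simp add: nil_op_def jordan_matrix_def)

lemma nil_op_Cons: "nil_op (m # \<mu>) = dsum (J m) (nil_op \<mu> :: 'k :: field mat)"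
  by (simp add: nil_op_def jordan_matrix_def dsum_def Let_def)

lemma dim_nil_op [simp]: "dim_row (nil_op \<mu>) = sum_list \<mu>" "dim_col (nil_op \<mu>) = sum_list \<mu>"
  by (induction \<mu>) (auto simp: nil_op_Nil nil_op_Cons)

lemma dsum_zero_right: "dsum A (0\<^sub>m 0 0) = A"
  by (intro eq_matI) (auto simp: dsum_def)

lemma nil_op_single: "nil_op [m] = (J m :: 'k :: field mat)"
  by (simp add: nil_op_Cons nil_op_Nil dsum_zero_right)

lemma nil_op_pair: "nil_op [m, r] = (dsum (J m) (J r) :: 'k :: field mat)"
  by (simp add: nil_op_Cons nil_op_Nil dsum_zero_right)

lemma index_J_pow: "i < m \<Longrightarrow> j < m \<Longrightarrow> (J m ^\<^sub>m k :: 'k :: field mat) $$ (i, j) = (if i + k = j then 1 else 0)"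
proof -
  assume "i < m" "j < m"
  moreover have "i + k < j \<Longrightarrow> of_nat (k choose (j - i)) = (0 :: 'k)" by (simp add: binomial_eq_0)
  ultimately show ?thesis by (cases "i + k < j") (auto simp: jordan_block_pow)
qed

lemma J_pow_zero: "m \<le> k \<Longrightarrow> (J m ^\<^sub>m k :: 'k :: field mat) = 0\<^sub>m m m"
  by (intro eq_matI) (auto simp: index_J_pow)

lemma index_J_mult:
  assumes "dim_row V = m" "i < m" "j < dim_col V"
  shows "(J m * V) $$ (i, j) = (if Suc i < m then V $$ (Suc i, j) else (0 :: 'k :: field))"
proof -
  have "(J m * V) $$ (i, j) = (\<Sum>k = 0..<m. (if k = Suc i then 1 else 0) * V $$ (k, j))"
    using assms by (auto simp: scalar_prod_def intro!: sum.cong)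
  then show ?thesis using assms by (simp add: if_mult_zero)
qed

lemma index_mult_J:
  assumes "dim_col V = m" "i < dim_row V" "j < m"
  shows "(V * J m) $$ (i, j) = (if j = 0 then (0 :: 'k :: field) else V $$ (i, j - 1))"
proof -
  have "(V * J m) $$ (i, j) = (\<Sum>k = 0..<m. V $$ (i, k) * (if Suc k = j then 1 else 0))"
    using assms by (auto simp: scalar_prod_def intro!: sum.cong)
  also have "\<dots> = (\<Sum>k = 0..<m. (if j \<noteq> 0 \<and> k = j - 1 then V $$ (i, k) else 0))"
    by (intro sum.cong) auto
  finally show ?thesis using assms by (cases j) simp_all
qed

text \<open>
  For \<open>l \<le> m\<close> this is the inclusion of the \<open>l\<close>-dimensional submodule of \<open>k[T]/(T\<^sup>m)\<close>, and for \<open>l \<ge> m\<close> a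
  projection.
\<close>

definition unit_mat :: "nat \<Rightarrow> nat \<Rightarrow> 'k :: field mat" where
  "unit_mat m l = mat m l (\<lambda>(i, j). if i = j then 1 else 0)"

lemma dim_unit_mat [simp]: "dim_row (unit_mat m l) = m" "dim_col (unit_mat m l) = l"
  by (auto simp: unit_mat_def)

lemma index_mult_unit_mat:
  assumes "dim_col V = m" "i < dim_row V" "j < l"
  shows "(V * unit_mat m l) $$ (i, j) = (if j < m then V $$ (i, j) else (0 :: 'k :: field))"
  using assms by (simp add: scalar_prod_def unit_mat_def if_mult_zero)

lemma unit_mat_left_inverse: "l \<le> m \<Longrightarrow> unit_mat l m * unit_mat m l = (1\<^sub>m l :: 'k :: field mat)"
  by (intro eq_matI, subst index_mult_unit_mat) (auto simp: unit_mat_def)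

lemma index_unit_mat_mult:
  assumes "dim_row V = l" "i < m" "j < dim_col V"
  shows "(unit_mat m l * V) $$ (i, j) = (if i < l then V $$ (i, j) else (0 :: 'k :: field))"
  using assms by (simp add: scalar_prod_def unit_mat_def if_mult_zero)

text \<open>
  The second component of the embedding of a bipicket: its generator, the basis vector \<open>1\<close>, goes to
  \<open>T\<^bsup>r-1\<^esup>\<close>, which is basis vector \<open>0\<close>.
\<close>

definition socle_mat :: "nat \<Rightarrow> 'k :: field mat" where
  "socle_mat r = mat r 2 (\<lambda>(i, j). if i = 0 \<and> j = 1 then 1 else 0)"

lemma dim_socle_mat [simp]: "dim_row (socle_mat r) = r" "dim_col (socle_mat r) = 2"
  by (auto simp: socle_mat_def)

lemma index_mult_socle_mat:
  assumes "dim_col V = r" "i < dim_row V" "j < 2" "r \<ge> 1"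
  shows "(V * socle_mat r) $$ (i, j) = (if j = 1 then V $$ (i, 0) else (0 :: 'k :: field))"
  using assms by (cases "j = 1") (simp_all add: scalar_prod_def socle_mat_def if_mult_zero)

lemma index_socle_mat_mult:
  assumes "dim_row V = 2" "i < r" "j < dim_col V"
  shows "(socle_mat r * V) $$ (i, j) = (if i = 0 then V $$ (1, j) else (0 :: 'k :: field))"
  using assms by (cases "i = 0") (simp_all add: scalar_prod_def socle_mat_def if_mult_zero)

lemma J_pow_mult_T_pow:
  assumes "i < m"
  shows "((J m ^\<^sub>m k) *\<^sub>v T_pow m e) $ i = (if i + k + e + 1 = m then 1 else (0 :: 'k :: field))"
proof -
  have "((J m ^\<^sub>m k) *\<^sub>v T_pow m e) $ i = (\<Sum>j = 0..<m. (if j = i + k then (if j + e + 1 = m then 1 else 0) else (0 :: 'k)))"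
  proof -
    have "((J m ^\<^sub>m k) *\<^sub>v T_pow m e) $ i = (\<Sum>j = 0..<m. (J m ^\<^sub>m k) $$ (i, j) * (T_pow m e :: 'k vec) $ j)"
      using assms by (simp add: scalar_prod_def T_pow_def)
    also have "\<dots> = (\<Sum>j = 0..<m. (if j = i + k then (if j + e + 1 = m then 1 else 0) else 0))"
      using assms by (intro sum.cong refl) (auto simp: index_J_pow T_pow_def)
    finally show ?thesis .
  qed
  then show ?thesis using assms by simp
qed

lemma indec_triple_Picket:
  assumes "l \<le> m"
  shows "indec_triple (Picket l m) = (J l, unit_mat m l, J m :: 'k :: field mat)"
proof -
  have "cyclic_hom l (J m) (T_pow m (m - l)) = (unit_mat m l :: 'k mat)"
  proof (rule eq_matI)
    fix i j assume "i < dim_row (unit_mat m l :: 'k mat)" "j < dim_col (unit_mat m l :: 'k mat)"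
    then have ij: "i < m" "j < l" by auto
    then have "cyclic_hom l (J m) (T_pow m (m - l)) $$ (i, j) = ((J m ^\<^sub>m (l - 1 - j)) *\<^sub>v (T_pow m (m - l) :: 'k vec)) $ i"
      by (simp add: cyclic_hom_def mat_of_cols_index)
    also have "\<dots> = (if i = j then 1 else 0)" using ij assms by (subst J_pow_mult_T_pow) auto
    finally show "cyclic_hom l (J m) (T_pow m (m - l)) $$ (i, j) = (unit_mat m l :: 'k mat) $$ (i, j)"
      using ij by (simp add: unit_mat_def)
  qed (auto simp: cyclic_hom_def)
  then show ?thesis by (simp add: nil_op_single)
qed

lemma indec_triple_Bipicket:
  assumes "1 \<le> r" "r + 2 \<le> m"
  shows "indec_triple (Bipicket m r) = (J 2, vcat (unit_mat m 2) (socle_mat r), dsum (J m) (J r) :: 'k :: field mat)"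
proof -
  let ?v = "T_pow m (m - 2) @\<^sub>v T_pow r (r - 1) :: 'k vec"
  have "cyclic_hom 2 (dsum (J m) (J r)) ?v = vcat (unit_mat m 2) (socle_mat r)"
  proof (rule eq_matI)
    fix i j assume "i < dim_row (vcat (unit_mat m 2) (socle_mat r) :: 'k mat)" "j < dim_col (vcat (unit_mat m 2) (socle_mat r) :: 'k mat)"
    then have ij: "i < m + r" "j < 2" by auto
    then have "cyclic_hom 2 (dsum (J m) (J r)) ?v $$ (i, j) = ((dsum (J m) (J r) ^\<^sub>m (1 - j)) *\<^sub>v ?v) $ i"
      by (simp add: cyclic_hom_def mat_of_cols_index)
    also have "dsum (J m) (J r) ^\<^sub>m (1 - j) = dsum (J m ^\<^sub>m (1 - j)) (J r ^\<^sub>m (1 - j) :: 'k mat)"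
      by (rule dsum_pow) auto
    also have "\<dots> *\<^sub>v ?v = ((J m ^\<^sub>m (1 - j)) *\<^sub>v T_pow m (m - 2)) @\<^sub>v ((J r ^\<^sub>m (1 - j)) *\<^sub>v T_pow r (r - 1))"
      unfolding dsum_def by (subst four_block_mat_mult_vec[of _ m m _ r _ r]) (auto simp: T_pow_def)
    also have "\<dots> $ i = vcat (unit_mat m 2) (socle_mat r) $$ (i, j)"
      using ij assms by (auto simp: index_vcat J_pow_mult_T_pow unit_mat_def socle_mat_def simp del: index_mult_mat_vec)
    finally show "cyclic_hom 2 (dsum (J m) (J r)) ?v $$ (i, j) = vcat (unit_mat m 2) (socle_mat r) $$ (i, j)" .
  qed (auto simp: cyclic_hom_def)
  then show ?thesis by (simp add: nil_op_single nil_op_pair)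
qed

fun sub_dim :: "indec \<Rightarrow> nat" where
  "sub_dim (Picket l m) = l"
| "sub_dim (Bipicket m r) = 2"

fun jordan_sizes :: "indec \<Rightarrow> nat list" where
  "jordan_sizes (Picket l m) = [m]"
| "jordan_sizes (Bipicket m r) = [m, r]"

lemma s2_triple_indec:
  assumes "valid_indec x"
  shows "s2_triple (sub_dim x) (sum_list (jordan_sizes x)) (indec_triple x :: 'k :: field triple)"
proof (cases x)
  case (Picket l m)
  have lm: "l \<le> m" "1 \<le> m" "l \<le> 2" using assms Picket by auto
  have 1: "J l * J l = (0\<^sub>m l l :: 'k mat)"
    using lm by (intro eq_matI) (auto simp: index_J_mult simp del: index_mult_mat(1))
  have 2: "unit_mat m l * J l = J m * (unit_mat m l :: 'k mat)"
    using lm by (intro eq_matI) (auto simp: index_mult_J index_J_mult unit_mat_def simp del: index_mult_mat(1))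
  have "inj_mat (unit_mat m l :: 'k mat)"
  proof (rule left_inverse_inj_mat)
    show "unit_mat l m * unit_mat m l = (1\<^sub>m (dim_col (unit_mat m l :: 'k mat)) :: 'k mat)"
      using lm by (simp add: unit_mat_left_inverse)
  qed auto
  with 1 2 show ?thesis using lm Picket J_pow_zero[of m m]
    by (auto simp add: indec_triple_Picket s2_triple_def triple_space_iff simp del: indec_triple.simps)
next
  case (Bipicket m r)
  have mr: "1 \<le> r" "r + 2 \<le> m" using assms Bipicket by auto
  have 1: "J 2 * J 2 = (0\<^sub>m 2 2 :: 'k mat)"
    by (intro eq_matI) (auto simp: index_J_mult simp del: index_mult_mat(1))
  have 2: "unit_mat m 2 * J 2 = J m * (unit_mat m 2 :: 'k mat)"
    using mr by (intro eq_matI) (auto simp: index_mult_J index_J_mult unit_mat_def simp del: index_mult_mat(1))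
  have 3: "socle_mat r * J 2 = J r * (socle_mat r :: 'k mat)"
    using mr by (intro eq_matI) (auto simp: index_mult_J index_J_mult socle_mat_def simp del: index_mult_mat(1))
  have "inj_mat (vcat (unit_mat m 2) (socle_mat r) :: 'k mat)"
  proof (rule left_inverse_inj_mat)
    have "unit_mat 2 m * unit_mat m 2 = (1\<^sub>m 2 :: 'k mat)"
      using mr by (simp add: unit_mat_left_inverse)
    then show "hcat (unit_mat 2 m) (0\<^sub>m 2 r) * vcat (unit_mat m 2) (socle_mat r) = (1\<^sub>m (dim_col (vcat (unit_mat m 2) (socle_mat r) :: 'k mat)) :: 'k mat)"
      by (simp add: hcat_mult_vcat mat_simps)
  qed auto
  moreover have "dsum (J m) (J r) ^\<^sub>m m = (0\<^sub>m (m + r) (m + r) :: 'k mat)"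
    using mr by (simp add: dsum_pow J_pow_zero) (simp add: dsum_def)
  ultimately show ?thesis using mr Bipicket 1 2 3
    by (auto simp add: indec_triple_Bipicket s2_triple_def triple_space_iff dsum_mult_vcat vcat_mult simp del: indec_triple.simps)
qed

section \<open>Existence of decompositions\<close>

lemma pow_Suc_left: "dim_row B = dim_col B \<Longrightarrow> B * B ^\<^sub>m k = (B ^\<^sub>m Suc k :: 'a :: semiring_1 mat)"
  by (induction k) (auto simp: mult_one_left mult_one_right simp flip: mult_assoc)

lemma pow_mat_add: "dim_row B = dim_col B \<Longrightarrow> B ^\<^sub>m (i + k) = B ^\<^sub>m i * (B ^\<^sub>m k :: 'a :: semiring_1 mat)"
  by (induction k) (auto simp: mult_one_right mult_assoc)

text \<open>
  The rows \<open>\<phi>, \<phi>B, \<dots>, \<phi>B\<^bsup>m-1\<^esup>\<close> form the coordinates of a homomorphism to a Jordan block of size \<open>m\<close>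
  (if \<open>\<phi>B\<^sup>m = 0\<close>), and the columns \<open>B\<^bsup>m-1\<^esup>y, \<dots>, By, y\<close> a homomorphism from such a block (if
  \<open>B\<^sup>m y = 0\<close>). Functionals are matrices with one row, and vectors matrices with one column.
\<close>

definition row_chain :: "'k :: field mat \<Rightarrow> 'k mat \<Rightarrow> nat \<Rightarrow> 'k mat" where
  "row_chain \<phi> B m = mat m (dim_col B) (\<lambda>(i, j). (\<phi> * B ^\<^sub>m i) $$ (0, j))"

definition col_chain :: "'k :: field mat \<Rightarrow> 'k mat \<Rightarrow> nat \<Rightarrow> 'k mat" where
  "col_chain B y m = mat (dim_row B) m (\<lambda>(i, j). (B ^\<^sub>m (m - 1 - j) * y) $$ (i, 0))"

lemma dim_chain [simp]: "dim_row (row_chain \<phi> B m) = m" "dim_col (row_chain \<phi> B m) = dim_col B"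
  "dim_row (col_chain B y m) = dim_row B" "dim_col (col_chain B y m) = m"
  by (auto simp: row_chain_def col_chain_def)

lemma index_row_chain_mult:
  assumes "dim_row \<phi> = 1" "dim_col \<phi> = b" "dim_row B = b" "dim_col B = b" "dim_row C = b" "i < m" "j < dim_col C"
  shows "(row_chain \<phi> B m * C) $$ (i, j) = (\<phi> * (B ^\<^sub>m i * C)) $$ (0, j)"
proof -
  have "\<phi> * (B ^\<^sub>m i * C) = (\<phi> * B ^\<^sub>m i) * C" using assms by (simp add: mult_assoc)
  moreover have "row (row_chain \<phi> B m) i = row (\<phi> * B ^\<^sub>m i) 0"
    using assms by (intro eq_vecI) (simp_all add: row_chain_def split: if_splits del: index_mult_mat(1))
  ultimately show ?thesis using assms by simp
qed

lemma index_mult_col_chain: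
  assumes "dim_col y = 1" "dim_row y = b" "dim_row B = b" "dim_col B = b" "dim_col C = b" "i < dim_row C" "j < m"
  shows "(C * col_chain B y m) $$ (i, j) = (C * (B ^\<^sub>m (m - 1 - j) * y)) $$ (i, 0)"
proof -
  have "col (col_chain B y m) j = col (B ^\<^sub>m (m - 1 - j) * y) 0"
    using assms by (intro eq_vecI) (auto simp: col_chain_def)
  then show ?thesis using assms by simp
qed

lemma row_chain_intertwines:
  assumes d: "dim_row \<phi> = 1" "dim_col \<phi> = b" "dim_row B = b" "dim_col B = b" and 0: "\<phi> * B ^\<^sub>m m = 0\<^sub>m 1 b"
  shows "J m * row_chain \<phi> B m = row_chain \<phi> B m * B"
proof (rule eq_matI)
  fix i j assume "i < dim_row (row_chain \<phi> B m * B)" "j < dim_col (row_chain \<phi> B m * B)"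
  then have ij: "i < m" "j < b" using d by auto
  have "(row_chain \<phi> B m * B) $$ (i, j) = (\<phi> * B ^\<^sub>m Suc i) $$ (0, j)"
    using ij d by (subst index_row_chain_mult[of _ b]) auto
  moreover have "(J m * row_chain \<phi> B m) $$ (i, j) = (if Suc i < m then row_chain \<phi> B m $$ (Suc i, j) else 0)"
    using ij d by (intro index_J_mult) auto
  moreover have "\<phi> * B ^\<^sub>m Suc i = 0\<^sub>m 1 b" if "\<not> Suc i < m"
  proof -
    have "m = Suc i" using ij that by auto
    with 0 show ?thesis by simp
  qed
  ultimately show "(J m * row_chain \<phi> B m) $$ (i, j) = (row_chain \<phi> B m * B) $$ (i, j)"
    using ij d by (cases "Suc i < m") (simp_all add: row_chain_def del: index_mult_mat(1) pow_mat.simps)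
qed (use d in auto)

lemma col_chain_intertwines:
  assumes d: "dim_col y = 1" "dim_row y = b" "dim_row B = b" "dim_col B = b" and 0: "B ^\<^sub>m m * y = 0\<^sub>m b 1"
  shows "B * col_chain B y m = col_chain B y m * J m"
proof (rule eq_matI)
  fix i j assume "i < dim_row (col_chain B y m * J m)" "j < dim_col (col_chain B y m * J m)"
  then have ij: "i < b" "j < m" using d by auto
  have "(B * col_chain B y m) $$ (i, j) = (B * (B ^\<^sub>m (m - 1 - j) * y)) $$ (i, 0)"
    using ij d by (subst index_mult_col_chain[of _ b]) auto
  also have "B * (B ^\<^sub>m (m - 1 - j) * y) = B ^\<^sub>m Suc (m - 1 - j) * y"
    using d by (simp add: pow_Suc_left del: pow_mat.simps flip: mult_assoc)
  also have "Suc (m - 1 - j) = m - j" using ij by auto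
  finally have "(B * col_chain B y m) $$ (i, j) = (B ^\<^sub>m (m - j) * y) $$ (i, 0)" .
  moreover have "(col_chain B y m * J m) $$ (i, j) = (if j = 0 then 0 else col_chain B y m $$ (i, j - 1))"
    using ij d by (intro index_mult_J) auto
  moreover have "m - Suc (j - Suc 0) = m - j" if "j \<noteq> 0" using that by auto
  ultimately show "(B * col_chain B y m) $$ (i, j) = (col_chain B y m * J m) $$ (i, j)"
    using ij d 0 by (auto simp: col_chain_def simp del: index_mult_mat(1) pow_mat.simps)
qed (use d in auto)

lemma J_kernel:
  assumes "dim_row V = m" "J m * V = 0\<^sub>m m (dim_col V)" "1 \<le> m"
  obtains v where "V = unit_mat m 1 * (v :: 'k :: field mat)" "dim_row v = 1" "dim_col v = dim_col V"
proof
  let ?v = "mat 1 (dim_col V) (\<lambda>(i, j). V $$ (i, j))"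
  show "V = unit_mat m 1 * ?v"
  proof (rule eq_matI)
    fix i j assume "i < dim_row (unit_mat m 1 * ?v :: 'k mat)" "j < dim_col (unit_mat m 1 * ?v :: 'k mat)"
    then have ij: "i < m" "j < dim_col V" by auto
    have "V $$ (i, j) = 0" if "i \<noteq> 0"
      using index_J_mult[of V m "i - 1" j] that ij assms(1,2) by (cases i) auto
    then show "V $$ (i, j) = (unit_mat m 1 * ?v) $$ (i, j)"
      using ij by (subst index_unit_mat_mult) auto
  qed (use assms in auto)
qed auto

lemma col_chain_socle:
  assumes "dim_col y = 1" "dim_row y = b" "dim_row B = b" "dim_col B = b" "1 \<le> m"
  shows "col_chain B y m * unit_mat m 1 = B ^\<^sub>m (m - 1) * y"
  using assms by (intro eq_matI) (auto simp: index_mult_unit_mat simp del: index_mult_mat(1), simp add: col_chain_def)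

lemma row_chain_socle:
  assumes "dim_row \<phi> = 1" "dim_col \<phi> = b" "dim_row B = b" "dim_col B = b" "dim_row z = b" "dim_col z = 1"
    "B * z = 0\<^sub>m b 1" "\<phi> * z = 1\<^sub>m 1"
  shows "row_chain \<phi> B m * z = unit_mat m 1"
proof (rule eq_matI)
  fix i j assume "i < dim_row (unit_mat m 1 :: 'a mat)" "j < dim_col (unit_mat m 1 :: 'a mat)"
  then have ij: "i < m" "j = 0" by auto
  have "(row_chain \<phi> B m * z) $$ (i, j) = (\<phi> * (B ^\<^sub>m i * z)) $$ (0, 0)"
    using ij assms by (subst index_row_chain_mult[of _ b]) auto
  moreover have "\<phi> * (B ^\<^sub>m i * z) = (if i = 0 then 1\<^sub>m 1 else 0\<^sub>m 1 1)"
    using assms by (cases i) (simp_all add: mat_simps)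
  ultimately show "(row_chain \<phi> B m * z) $$ (i, j) = (unit_mat m 1 :: 'a mat) $$ (i, j)"
    using ij by (auto simp: unit_mat_def)
qed (use assms in auto)

lemma row_chain_kills:
  assumes "dim_row \<phi> = 1" "dim_col \<phi> = b" "dim_row B = b" "dim_col B = b" "dim_row z = b" "dim_col z = 1"
    "B * z = 0\<^sub>m b 1" "\<phi> * z = 0\<^sub>m 1 1"
  shows "row_chain \<phi> B m * z = 0\<^sub>m m 1"
proof (rule eq_matI)
  fix i j assume "i < dim_row (0\<^sub>m m 1 :: 'a mat)" "j < dim_col (0\<^sub>m m 1 :: 'a mat)"
  then have ij: "i < m" "j = 0" by auto
  have "(row_chain \<phi> B m * z) $$ (i, j) = (\<phi> * (B ^\<^sub>m i * z)) $$ (0, 0)"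
    using ij assms by (subst index_row_chain_mult[of _ b]) auto
  moreover have "\<phi> * (B ^\<^sub>m i * z) = 0\<^sub>m 1 1"
    using assms by (cases i) (simp_all add: mat_simps)
  ultimately show "(row_chain \<phi> B m * z) $$ (i, j) = (0\<^sub>m m 1 :: 'a mat) $$ (i, j)"
    using ij by auto
qed (use assms in auto)

lemma triple_power_commute:
  assumes "s2_triple a b (A, F, B)"
  shows "F * A ^\<^sub>m i = B ^\<^sub>m i * F"
  using assms by (intro pow_mat_commute_intertwiner[where b = a and b' = b]) (auto simp: s2_triple_def triple_space_iff)

text \<open>
  The vectors \<open>w\<close> and \<open>y\<close> generate a copy of the picket, and the functionals \<open>\<phi> F\<close> and \<open>\<phi>\<close> cogenerate
  a morphism to it. On the socle the composite is multiplication by \<open>\<phi> B\<^bsup>m-1\<^esup> y = 1\<close>. The condition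
  \<open>\<phi> B\<^sup>l F = 0\<close> says that the projection maps the submodule into the \<open>l\<close>-dimensional one.
\<close>

lemma split_picket:
  fixes A :: "'k :: field mat"
  assumes X: "s2_triple a b (A, F, B)" and lm: "valid_indec (Picket l m)"
    and d: "dim_row w = a" "dim_col w = 1" "dim_row y = b" "dim_col y = 1" "dim_row \<phi> = 1" "dim_col \<phi> = b"
    and w: "A ^\<^sub>m l * w = 0\<^sub>m a 1" "F * w = B ^\<^sub>m (m - l) * y" and Bm: "B ^\<^sub>m m = 0\<^sub>m b b"
    and phi: "\<phi> * (B ^\<^sub>m l * F) = 0\<^sub>m 1 a" "\<phi> * (B ^\<^sub>m (m - 1) * y) = 1\<^sub>m 1"
  obtains a' b' X' where "s2_triple a' b' X'" "a = l + a'" "b = m + b'"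
    "isomorphic (A, F, B) (tsum (indec_triple (Picket l m)) X')"
proof -
  have dX: "dim_row A = a" "dim_col A = a" "dim_row F = b" "dim_col F = a" "dim_row B = b" "dim_col B = b"
    using X by (simp_all add: s2_triple_def triple_space_iff)
  have l: "l \<le> m" "1 \<le> m" using lm by auto
  note eq = indec_triple_Picket[OF l(1)]
  have Y: "s2_triple l m (J l, unit_mat m l, J m :: 'k mat)" using s2_triple_indec[OF lm] unfolding eq by simp
  note FA = triple_power_commute[OF X]
  \<comment> \<open>the projection of the submodule has no coordinates beyond the first \<open>l\<close>\<close>
  have BF0: "\<phi> * (B ^\<^sub>m i * F) = 0\<^sub>m 1 a" if "l \<le> i" for i
  proof -
    have "B ^\<^sub>m i * F = (B ^\<^sub>m l * F) * A ^\<^sub>m (i - l)"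
      using that dX pow_mat_add[of A l "i - l"] by (simp add: mult_assoc flip: FA)
    then have "\<phi> * (B ^\<^sub>m i * F) = (\<phi> * (B ^\<^sub>m l * F)) * A ^\<^sub>m (i - l)" using d dX by (simp add: mult_assoc)
    then show ?thesis using dX by (simp add: phi mat_simps)
  qed
  have s0: "B * (B ^\<^sub>m (m - 1) * y) = 0\<^sub>m b 1"
  proof -
    have "B * (B ^\<^sub>m (m - 1) * y) = B ^\<^sub>m Suc (m - 1) * y" using dX d
      by (simp add: pow_Suc_left del: pow_mat.simps flip: mult_assoc)
    then show ?thesis using l d by (simp add: Bm mat_simps del: pow_mat.simps)
  qed
  show thesis
  proof (rule split_summand[OF X Y])
    show "A * col_chain A w l = col_chain A w l * J l"
      by (rule col_chain_intertwines[of _ a]) (use d dX w in auto)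
    show "B * col_chain B y m = col_chain B y m * J m"
      by (rule col_chain_intertwines[of _ b]) (use d dX in \<open>auto simp: Bm mat_simps\<close>)
    show "J l * row_chain (\<phi> * F) A l = row_chain (\<phi> * F) A l * A"
      by (rule row_chain_intertwines[of _ a]) (use d dX phi in \<open>auto simp: mult_assoc FA\<close>)
    show "J m * row_chain \<phi> B m = row_chain \<phi> B m * B"
      by (rule row_chain_intertwines[of _ b]) (use d dX in \<open>auto simp: Bm mat_simps\<close>)
    show "F * col_chain A w l = col_chain B y m * unit_mat m l"
    proof (rule eq_matI)
      fix i j assume "i < dim_row (col_chain B y m * unit_mat m l)" "j < dim_col (col_chain B y m * unit_mat m l)"
      then have ij: "i < b" "j < l" "j < m" using dX l by auto
      have "(F * col_chain A w l) $$ (i, j) = (F * (A ^\<^sub>m (l - 1 - j) * w)) $$ (i, 0)"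
        using ij d dX by (subst index_mult_col_chain[of _ a]) auto
      also have "F * (A ^\<^sub>m (l - 1 - j) * w) = B ^\<^sub>m (l - 1 - j) * (F * w)"
        using d dX by (simp add: FA flip: mult_assoc)
      also have "\<dots> = B ^\<^sub>m (l - 1 - j + (m - l)) * y" unfolding w(2) using d dX by (simp add: pow_mat_add mult_assoc)
      also have "l - 1 - j + (m - l) = m - 1 - j" using ij l by auto
      finally show "(F * col_chain A w l) $$ (i, j) = (col_chain B y m * unit_mat m l) $$ (i, j)"
        using ij d dX by (subst index_mult_unit_mat) (auto simp: col_chain_def)
    qed (use dX in auto)
    show "unit_mat m l * row_chain (\<phi> * F) A l = row_chain \<phi> B m * F"
    proof (rule eq_matI)
      fix i j assume "i < dim_row (row_chain \<phi> B m * F)" "j < dim_col (row_chain \<phi> B m * F)"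
      then have ij: "i < m" "j < a" using dX l by auto
      have "(row_chain \<phi> B m * F) $$ (i, j) = (\<phi> * (B ^\<^sub>m i * F)) $$ (0, j)"
        using ij d dX by (subst index_row_chain_mult[of _ b]) auto
      moreover have "\<phi> * F * A ^\<^sub>m i = \<phi> * (B ^\<^sub>m i * F)" using d dX by (simp add: mult_assoc FA)
      ultimately show "(unit_mat m l * row_chain (\<phi> * F) A l) $$ (i, j) = (row_chain \<phi> B m * F) $$ (i, j)"
        using ij d dX BF0[of i]
        by (subst index_unit_mat_mult) (auto simp: row_chain_def simp del: index_mult_mat(1))
    qed (use dX in auto)
    fix V :: "'k mat"
    assume V: "dim_row V = m" "J m * V = 0\<^sub>m m (dim_col V)" "row_chain \<phi> B m * (col_chain B y m * V) = 0\<^sub>m m (dim_col V)"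
    obtain v where v: "V = unit_mat m 1 * v" "dim_row v = 1" "dim_col v = dim_col V"
      by (rule J_kernel[OF V(1,2) l(2)])
    have "row_chain \<phi> B m * (col_chain B y m * V) = row_chain \<phi> B m * ((col_chain B y m * unit_mat m 1) * v)"
      unfolding v(1) using v(2) dX by (simp add: mult_assoc)
    also have "col_chain B y m * unit_mat m 1 = B ^\<^sub>m (m - 1) * y"
      by (rule col_chain_socle) (use d dX l in auto)
    also have "row_chain \<phi> B m * (B ^\<^sub>m (m - 1) * y * v) = row_chain \<phi> B m * (B ^\<^sub>m (m - 1) * y) * v"
      using d dX v(2) by (simp add: mult_assoc)
    also have "row_chain \<phi> B m * (B ^\<^sub>m (m - 1) * y) = unit_mat m 1"
      by (rule row_chain_socle) (use d dX s0 phi in auto)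
    also have "unit_mat m 1 * v = V" by (rule v(1)[symmetric])
    finally show "V = 0\<^sub>m m (dim_col V)" using V(3) by simp
  qed (use that dX d in \<open>simp_all add: eq del: indec_triple.simps\<close>)
qed

text \<open>
  Here \<open>y\<close> and \<open>z\<close> generate the two Jordan blocks, and \<open>\<phi>\<close> and \<open>\<psi>\<close> cogenerate the projections onto them.
  The equation \<open>\<psi> F = \<phi> B F\<close> expresses that the projection maps the submodule into the one generated
  by \<open>\<delta>(1)\<close>, whose two coordinates \<open>T\<^bsup>m-2\<^esup>\<close> and \<open>T\<^bsup>r-1\<^esup>\<close> carry the same coefficient. On the socle the
  composite is triangular with ones on the diagonal, as \<open>\<psi>\<close> vanishes on \<open>B\<^bsup>m-1\<^esup> y\<close>.
\<close>

lemma split_bipicket: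
  fixes A :: "'k :: field mat"
  assumes X: "s2_triple a b (A, F, B)" and mr: "valid_indec (Bipicket m r)"
    and d: "dim_row w = a" "dim_col w = 1" "dim_row y = b" "dim_col y = 1" "dim_row z = b" "dim_col z = 1"
      "dim_row \<phi> = 1" "dim_col \<phi> = b" "dim_row \<psi> = 1" "dim_col \<psi> = b"
    and w: "F * w = B ^\<^sub>m (m - 2) * y + B ^\<^sub>m (r - 1) * z" "B ^\<^sub>m r * z = 0\<^sub>m b 1" and Bm: "B ^\<^sub>m m = 0\<^sub>m b b"
    and phi: "\<psi> * F = \<phi> * (B * F)" "\<psi> * B ^\<^sub>m r = 0\<^sub>m 1 b" "\<phi> * (B ^\<^sub>m (m - 1) * y) = 1\<^sub>m 1" "\<psi> * (B ^\<^sub>m (r - 1) * z) = 1\<^sub>m 1"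
  obtains a' b' X' where "s2_triple a' b' X'" "a = 2 + a'" "b = m + r + b'"
    "isomorphic (A, F, B) (tsum (indec_triple (Bipicket m r)) X')"
proof -
  have dX: "dim_row A = a" "dim_col A = a" "dim_row F = b" "dim_col F = a" "dim_row B = b" "dim_col B = b"
    and AA: "A * A = 0\<^sub>m a a" and FA1: "F * A = B * F"
    using X by (simp_all add: s2_triple_def triple_space_iff)
  have r: "1 \<le> r" "r + 2 \<le> m" "r \<le> m - 1" "1 \<le> m" using mr by auto
  note eq = indec_triple_Bipicket[OF r(1,2)]
  have Y: "s2_triple 2 (m + r) (J 2, vcat (unit_mat m 2) (socle_mat r), dsum (J m) (J r) :: 'k mat)"
    using s2_triple_indec[OF mr] unfolding eq by simp
  note FA = triple_power_commute[OF X]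
  have A2: "A ^\<^sub>m 2 = 0\<^sub>m a a" using dX AA by (simp add: numeral_2_eq_2 mult_one_left)
  have BF0: "B ^\<^sub>m i * F = 0\<^sub>m b a" if "2 \<le> i" for i
  proof -
    have "B ^\<^sub>m i * F = F * (A ^\<^sub>m 2 * A ^\<^sub>m (i - 2))"
    proof -
      have "A ^\<^sub>m i = A ^\<^sub>m 2 * A ^\<^sub>m (i - 2)" using that dX by (metis pow_mat_add le_add_diff_inverse)
      then show ?thesis by (simp flip: FA)
    qed
    then show ?thesis using dX by (simp add: A2 mat_simps)
  qed
  have s0: "B * (B ^\<^sub>m (m - 1) * y) = 0\<^sub>m b 1"
  proof -
    have "B * (B ^\<^sub>m (m - 1) * y) = B ^\<^sub>m Suc (m - 1) * y" using dX d
      by (simp add: pow_Suc_left del: pow_mat.simps flip: mult_assoc)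
    then show ?thesis using r d by (simp add: Bm mat_simps del: pow_mat.simps)
  qed
  have z0: "B * (B ^\<^sub>m (r - 1) * z) = 0\<^sub>m b 1"
  proof -
    have "B * (B ^\<^sub>m (r - 1) * z) = B ^\<^sub>m Suc (r - 1) * z" using dX d
      by (simp add: pow_Suc_left del: pow_mat.simps flip: mult_assoc)
    then show ?thesis using r d w by (simp del: pow_mat.simps)
  qed
  \<comment> \<open>because \<open>r \<le> m - 1\<close>; this makes the composite on the socle triangular\<close>
  have psi_s: "\<psi> * (B ^\<^sub>m (m - 1) * y) = 0\<^sub>m 1 1"
  proof -
    have "\<psi> * (B ^\<^sub>m (m - 1) * y) = (\<psi> * B ^\<^sub>m r) * (B ^\<^sub>m (m - 1 - r) * y)"
      using dX d r pow_mat_add[of B r "m - 1 - r"] by (simp add: mult_assoc)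
    then show ?thesis using dX d by (simp add: phi mat_simps)
  qed
  let ?Q2 = "hcat (col_chain B y m) (col_chain B z r)"
  let ?P2 = "vcat (row_chain \<phi> B m) (row_chain \<psi> B r)"
  show thesis
  proof (rule split_summand[OF X Y])
    show "A * col_chain A w 2 = col_chain A w 2 * J 2"
      by (rule col_chain_intertwines[of _ a]) (use d dX A2 in \<open>auto simp: mat_simps\<close>)
    have "B * col_chain B y m = col_chain B y m * J m"
      by (rule col_chain_intertwines[of _ b]) (use d dX in \<open>auto simp: Bm mat_simps\<close>)
    moreover have "B * col_chain B z r = col_chain B z r * J r"
      by (rule col_chain_intertwines[of _ b]) (use d dX w in \<open>auto simp: mat_simps\<close>)
    ultimately show "B * ?Q2 = ?Q2 * dsum (J m) (J r)"
      using dX by (simp add: mult_hcat hcat_mult_dsum)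
    show "J 2 * row_chain (\<phi> * F) A 2 = row_chain (\<phi> * F) A 2 * A"
      by (rule row_chain_intertwines[of _ a]) (use d dX A2 in \<open>auto simp: mat_simps\<close>)
    have "J m * row_chain \<phi> B m = row_chain \<phi> B m * B"
      by (rule row_chain_intertwines[of _ b]) (use d dX in \<open>auto simp: Bm mat_simps\<close>)
    moreover have "J r * row_chain \<psi> B r = row_chain \<psi> B r * B"
      by (rule row_chain_intertwines[of _ b]) (use d dX phi in \<open>auto simp: mat_simps\<close>)
    ultimately show "dsum (J m) (J r) * ?P2 = ?P2 * B"
      using dX by (simp add: vcat_mult dsum_mult_vcat)
    have "F * col_chain A w 2 = col_chain B y m * unit_mat m 2 + col_chain B z r * socle_mat r"
    proof (rule eq_matI)
      fix i j assume "i < dim_row (col_chain B y m * unit_mat m 2 + col_chain B z r * socle_mat r)"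
        "j < dim_col (col_chain B y m * unit_mat m 2 + col_chain B z r * socle_mat r)"
      then have ij: "i < b" "j < 2" "j < m" using dX r by auto
      have 1: "(F * col_chain A w 2) $$ (i, j) = (F * (A ^\<^sub>m (1 - j) * w)) $$ (i, 0)"
        using ij d dX by (subst index_mult_col_chain[of _ a]) auto
      have 2: "F * (A ^\<^sub>m (1 - j) * w) = B ^\<^sub>m (1 - j) * (F * w)"
        using d dX by (simp add: FA flip: mult_assoc)
      have 3: "B ^\<^sub>m (1 - j) * (F * w) = B ^\<^sub>m (1 - j + (m - 2)) * y + B ^\<^sub>m (1 - j + (r - 1)) * z"
        unfolding w(1) using d dX by (simp add: pow_mat_add mat_simps)
      have 4: "1 - j + (m - 2) = m - 1 - j" using ij r by auto
      have 5: "B ^\<^sub>m (1 - j + (r - 1)) * z = (if j = 1 then B ^\<^sub>m (r - 1) * z else 0\<^sub>m b 1)"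
        using ij r w(2) by (cases "j = 0") auto
      show "(F * col_chain A w 2) $$ (i, j) = (col_chain B y m * unit_mat m 2 + col_chain B z r * socle_mat r) $$ (i, j)"
        unfolding 1 2 3 4 5 using ij d dX r
        by (simp add: index_mult_unit_mat index_mult_socle_mat del: index_mult_mat(1)) (simp add: col_chain_def)
    qed (use dX in auto)
    then show "F * col_chain A w 2 = ?Q2 * vcat (unit_mat m 2) (socle_mat r)"
      using dX by (simp add: hcat_mult_vcat)
    have FAi: "\<phi> * F * A ^\<^sub>m i = \<phi> * (B ^\<^sub>m i * F)" for i using d dX by (simp add: mult_assoc FA)
    have "unit_mat m 2 * row_chain (\<phi> * F) A 2 = row_chain \<phi> B m * F"
    proof (rule eq_matI)
      fix i j assume "i < dim_row (row_chain \<phi> B m * F)" "j < dim_col (row_chain \<phi> B m * F)"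
      then have ij: "i < m" "j < a" using dX by auto
      have "(row_chain \<phi> B m * F) $$ (i, j) = (\<phi> * (B ^\<^sub>m i * F)) $$ (0, j)"
        using ij d dX by (subst index_row_chain_mult[of _ b]) auto
      moreover have "\<phi> * (B ^\<^sub>m i * F) = 0\<^sub>m 1 a" if "2 \<le> i" using BF0[OF that] d by (simp add: mat_simps)
      ultimately show "(unit_mat m 2 * row_chain (\<phi> * F) A 2) $$ (i, j) = (row_chain \<phi> B m * F) $$ (i, j)"
        using ij d dX FAi[of i]
        by (subst index_unit_mat_mult) (auto simp: row_chain_def simp del: index_mult_mat(1))
    qed (use dX in auto)
    moreover have "socle_mat r * row_chain (\<phi> * F) A 2 = row_chain \<psi> B r * F"
    proof (rule eq_matI)
      fix i j assume "i < dim_row (row_chain \<psi> B r * F)" "j < dim_col (row_chain \<psi> B r * F)"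
      then have ij: "i < r" "j < a" using dX by auto
      have 1: "(row_chain \<psi> B r * F) $$ (i, j) = (\<psi> * (B ^\<^sub>m i * F)) $$ (0, j)"
        using ij d dX by (subst index_row_chain_mult[of _ b]) auto
      have 2: "(socle_mat r * row_chain (\<phi> * F) A 2) $$ (i, j) = (if i = 0 then (\<phi> * (B * F)) $$ (0, j) else 0)"
        using ij d dX FAi[of 1]
        by (subst index_socle_mat_mult) (auto simp: row_chain_def mult_one_left simp del: index_mult_mat(1))
      have 3: "\<psi> * (B ^\<^sub>m i * F) = (if i = 0 then \<phi> * (B * F) else 0\<^sub>m 1 a)"
      proof (cases i)
        case (Suc n)
        have "\<psi> * (B ^\<^sub>m i * F) = (\<psi> * F) * A ^\<^sub>m i" using d dX by (simp add: mult_assoc FA)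
        also have "\<dots> = \<phi> * (B ^\<^sub>m Suc i * F)" unfolding phi(1) using d dX
          by (simp add: mult_assoc FA del: pow_mat.simps flip: pow_Suc_left)
        finally show ?thesis using Suc BF0[of "Suc i"] d by (simp add: mat_simps del: pow_mat.simps)
      qed (use d dX phi in \<open>simp add: mult_one_left\<close>)
      show "(socle_mat r * row_chain (\<phi> * F) A 2) $$ (i, j) = (row_chain \<psi> B r * F) $$ (i, j)"
        unfolding 1 2 3 using ij by simp
    qed (use dX in auto)
    ultimately show "vcat (unit_mat m 2) (socle_mat r) * row_chain (\<phi> * F) A 2 = ?P2 * F"
      using dX by (simp add: vcat_mult)
    fix V :: "'k mat"
    assume V: "dim_row V = m + r" "dsum (J m) (J r) * V = 0\<^sub>m (m + r) (dim_col V)" "?P2 * (?Q2 * V) = 0\<^sub>m (m + r) (dim_col V)"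
    obtain V1 V2 where V12: "V = vcat V1 V2" "dim_row V1 = m" "dim_row V2 = r" "dim_col V1 = dim_col V" "dim_col V2 = dim_col V"
      by (rule vcat_split[OF V(1)])
    let ?c = "dim_col V"
    have "vcat (J m * V1) (J r * V2) = vcat (0\<^sub>m m ?c) (0\<^sub>m r ?c)"
      using V(2) V12(2-5) by (subst (asm) V12(1)) (simp add: dsum_mult_vcat vcat_zero)
    then have J0: "J m * V1 = 0\<^sub>m m ?c" "J r * V2 = 0\<^sub>m r ?c" using V12(2-5) by (auto dest!: vcat_inject)
    obtain v1 where v1: "V1 = unit_mat m 1 * v1" "dim_row v1 = 1" "dim_col v1 = dim_col V1"
      by (rule J_kernel[of V1 m]) (use J0 V12(2-5) r in auto)
    obtain v2 where v2: "V2 = unit_mat r 1 * v2" "dim_row v2 = 1" "dim_col v2 = dim_col V2"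
      by (rule J_kernel[of V2 r]) (use J0 V12(2-5) r in auto)
    define s t where "s = B ^\<^sub>m (m - 1) * y" and "t = B ^\<^sub>m (r - 1) * z"
    have dst: "dim_row s = b" "dim_col s = 1" "dim_row t = b" "dim_col t = 1" using dX d by (simp_all add: s_def t_def)
    have 1: "col_chain B y m * unit_mat m 1 = s" unfolding s_def
      by (rule col_chain_socle) (use d dX r in auto)
    have 2: "col_chain B z r * unit_mat r 1 = t" unfolding t_def
      by (rule col_chain_socle) (use d dX r in auto)
    have QV: "?Q2 * V = s * v1 + t * v2"
      using V12(2-5) dX v1(2) v2(2)
      by (subst V12(1), subst hcat_mult_vcat) (simp_all add: v1(1) v2(1) flip: mult_assoc 1 2)
    have "vcat (row_chain \<phi> B m * (s * v1 + t * v2)) (row_chain \<psi> B r * (s * v1 + t * v2)) = vcat (0\<^sub>m m ?c) (0\<^sub>m r ?c)"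
      using V(3) dX dst v1(2,3) v2(2,3) V12(4,5) unfolding QV by (simp add: vcat_mult vcat_zero)
    then have 3: "row_chain \<phi> B m * (s * v1 + t * v2) = 0\<^sub>m m ?c" "row_chain \<psi> B r * (s * v1 + t * v2) = 0\<^sub>m r ?c"
      using v1(3) v2(3) V12(4,5) by (auto dest!: vcat_inject)
    have 4: "row_chain \<phi> B m * s = unit_mat m 1"
      by (rule row_chain_socle) (use d dX dst s0 phi in \<open>simp_all add: s_def\<close>)
    have 5: "row_chain \<psi> B r * t = unit_mat r 1"
      by (rule row_chain_socle) (use d dX dst z0 phi in \<open>simp_all add: t_def\<close>)
    have 6: "row_chain \<psi> B r * s = 0\<^sub>m r 1"
      by (rule row_chain_kills) (use d dX dst s0 psi_s in \<open>simp_all add: s_def\<close>)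
    have "row_chain \<psi> B r * (s * v1 + t * v2) = (row_chain \<psi> B r * s) * v1 + (row_chain \<psi> B r * t) * v2"
      using dX dst v1(2,3) v2(2,3) V12(4,5) by (simp add: mat_simps)
    also have "\<dots> = unit_mat r 1 * v2" unfolding 5 6 using v1(2,3) v2(2,3) V12(2-5) by (simp add: mat_simps)
    also have "\<dots> = V2" by (rule v2(1)[symmetric])
    finally have V20: "V2 = 0\<^sub>m r ?c" using 3 by simp
    have "v2 = 0\<^sub>m 1 ?c"
    proof (rule eq_matI)
      fix i j assume ij: "i < dim_row (0\<^sub>m 1 ?c :: 'k mat)" "j < dim_col (0\<^sub>m 1 ?c :: 'k mat)"
      have "V2 $$ (0, j) = v2 $$ (0, j)" using ij v2(2,3) V12(5) r
        by (subst v2(1), subst index_unit_mat_mult) auto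
      then show "v2 $$ (i, j) = (0\<^sub>m 1 ?c :: 'k mat) $$ (i, j)" using ij r V20 by simp
    qed (use v2(2,3) V12(5) in auto)
    then have "row_chain \<phi> B m * (s * v1 + t * v2) = (row_chain \<phi> B m * s) * v1"
      using dX dst v1(2,3) V12(4,5) by (simp add: mat_simps)
    also have "\<dots> = V1" unfolding 4 by (rule v1(1)[symmetric])
    finally have "V1 = 0\<^sub>m m ?c" using 3 by simp
    with V20 show "V = 0\<^sub>m (m + r) ?c" by (subst V12(1)) (simp add: vcat_zero)
  qed (use that dX d in \<open>simp_all add: eq del: indec_triple.simps\<close>)
qed

lemma direct_sum_triple_space:
  "\<forall>x\<in>set xs. valid_indec x \<Longrightarrow>
     (direct_sum (map indec_triple xs) :: 'k :: field triple) \<in> triple_space (sum_list (map sub_dim xs)) (sum_list (map (sum_list \<circ> jordan_sizes) xs))"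
proof (induction xs)
  case Nil
  then show ?case by (simp add: direct_sum_Nil triple_space_iff)
next
  case (Cons x xs)
  then show ?case using s2_triple_indec[of x]
    by (auto simp: direct_sum_Cons s2_triple_def intro!: tsum_triple_space simp del: indec_triple.simps)
qed

text \<open>
  One summand is split off, of the largest block size \<open>m\<close> of \<open>B\<close>. Which one it is depends on how the
  image \<open>S\<close> of \<open>B\<^bsup>m-1\<^esup>\<close> lies with respect to \<open>U = im F\<close> and \<open>B U\<close>.
\<close>

lemma indec_step:
  fixes X :: "'k :: field triple"
  assumes X: "s2_triple a b X" and b: "b > 0"
  obtains x a' b' X' where "valid_indec x" "s2_triple a' b' X'" "a = sub_dim x + a'"
    "b = sum_list (jordan_sizes x) + b'" "isomorphic X (tsum (indec_triple x) X')"
proof -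
  note result = that
  obtain A F B where eq: "X = (A, F, B)" by (cases X)
  note X' = X[unfolded eq]
  have dX: "dim_row A = a" "dim_col A = a" "dim_row F = b" "dim_col F = a" "dim_row B = b" "dim_col B = b"
    and AA: "A * A = 0\<^sub>m a a" and FA1: "F * A = B * F" and injF: "inj_mat F"
    using X' by (simp_all add: s2_triple_def triple_space_iff)
  have A2: "A ^\<^sub>m 2 = 0\<^sub>m a a" using dX AA by (simp add: numeral_2_eq_2 mult_one_left)
  have "\<exists>n. B ^\<^sub>m n = 0\<^sub>m b b" using X' by (simp add: s2_triple_def)
  then obtain m where m: "B ^\<^sub>m m = 0\<^sub>m b b" "\<And>n. n < m \<Longrightarrow> B ^\<^sub>m n \<noteq> 0\<^sub>m b b"
    using exists_least_iff[of "\<lambda>n. B ^\<^sub>m n = 0\<^sub>m b b"] by blast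
  have m1: "1 \<le> m"
  proof (rule ccontr)
    assume "\<not> 1 \<le> m"
    then have "m = 0" by simp
    then have "1\<^sub>m b = (0\<^sub>m b b :: 'k mat)" using m(1) dX by simp
    then have "(1\<^sub>m b :: 'k mat) $$ (0, 0) = 0" using b by simp
    then show False using b by simp
  qed
  let ?S = "B ^\<^sub>m (m - 1)"
  have dS: "dim_row ?S = b" "dim_col ?S = b" using dX by simp_all
  have BS: "B * ?S = 0\<^sub>m b b" using m m1 dX by (simp add: pow_Suc_left del: pow_mat.simps)
  \<comment> \<open>a picket with the largest block size; the three picket cases differ only in \<open>l\<close>, \<open>w\<close>, \<open>y\<close> and \<open>\<phi>\<close>\<close>
  have top: thesis if "valid_indec (Picket l m)" "dim_row w = a" "dim_col w = 1" "dim_row y = b" "dim_col y = 1"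
    "dim_row \<phi> = 1" "dim_col \<phi> = b" "A ^\<^sub>m l * w = 0\<^sub>m a 1" "F * w = B ^\<^sub>m (m - l) * y"
    "\<phi> * (B ^\<^sub>m l * F) = 0\<^sub>m 1 a" "\<phi> * (?S * y) = 1\<^sub>m 1" for l w y \<phi>
  proof -
    note t = that
    obtain a' b' X1 where "s2_triple a' b' X1" "a = l + a'" "b = m + b'"
      "isomorphic (A, F, B) (tsum (indec_triple (Picket l m)) X1)"
      by (rule split_picket[OF X' t(1-7) t(8,9) m(1) t(10,11)])
    then show thesis using result[of "Picket l m" a' b' X1] t(1) by (simp add: eq del: indec_triple.simps)
  qed
  consider
    (a) y where "dim_row y = b" "dim_col y = 1" "\<And>w. dim_row w = a \<Longrightarrow> dim_col w = 1 \<Longrightarrow> F * w \<noteq> ?S * y"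
  | (b) y w where "dim_row y = b" "dim_col y = 1" "dim_row w = a" "dim_col w = 1" "F * w = ?S * y"
       "\<And>w. dim_row w = a \<Longrightarrow> dim_col w = 1 \<Longrightarrow> B * (F * w) \<noteq> ?S * y"
  | (c) "\<And>y. dim_row y = b \<Longrightarrow> dim_col y = 1 \<Longrightarrow> \<exists>w. dim_row w = a \<and> dim_col w = 1 \<and> B * (F * w) = ?S * y"
    by metis
  then show thesis
  proof cases
    case a
    have ns: "F * w \<noteq> ?S * y" if "dim_row w = dim_col F" "dim_col w = 1" for w using a(3)[of w] that dX by simp
    obtain \<phi> where phi: "dim_row \<phi> = 1" "dim_col \<phi> = b" "\<phi> * F = 0\<^sub>m 1 a" "\<phi> * (?S * y) = 1\<^sub>m 1"
      by (rule separation[of "?S * y" F, OF _ _ ns]) (use a dX in simp_all)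
    show thesis
      by (rule top[of 0 "0\<^sub>m a 1" y \<phi>]) (use m1 a(1,2) phi dX in \<open>simp_all add: mat_simps m(1)\<close>)
  next
    case b
    have ns: "B * F * v \<noteq> ?S * y" if "dim_row v = dim_col (B * F)" "dim_col v = 1" for v
      using b(6)[of v] that dX by (simp add: mult_assoc)
    obtain \<phi> where phi: "dim_row \<phi> = 1" "dim_col \<phi> = b" "\<phi> * (B * F) = 0\<^sub>m 1 a" "\<phi> * (?S * y) = 1\<^sub>m 1"
      by (rule separation[of "?S * y" "B * F", OF _ _ ns]) (use b dX in simp_all)
    have "F * (A * w) = (F * A) * w" using dX b(3) by (simp add: mult_assoc)
    also have "\<dots> = B * ?S * y" unfolding FA1 using dX b by (simp add: mult_assoc)
    also have "\<dots> = 0\<^sub>m b 1" unfolding BS using b by (simp add: mat_simps)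
    finally have "A * w = 0\<^sub>m a 1" using inj_matD[OF injF, of "A * w" b 1] dX b by simp
    then show thesis
      by (intro top[of 1 w y \<phi>]) (use m1 b(1-5) phi dX in \<open>simp_all add: mult_one_left\<close>)
  next
    case c
    have "?S \<noteq> 0\<^sub>m b b" using m(2)[of "m - 1"] m1 by auto
    then obtain i j where ij: "i < b" "j < b" "?S $$ (i, j) \<noteq> 0"
      using dS by (metis eq_matI index_zero_mat)
    define y where "y = mat b 1 (\<lambda>(i, _). if i = j then (1 :: 'k) else 0)"
    define s where "s = ?S * y"
    have dy: "dim_row y = b" "dim_col y = 1" "dim_row s = b" "dim_col s = 1" using dX by (simp_all add: y_def s_def)
    have "s $$ (i, 0) = ?S $$ (i, j)"
      using dS ij by (simp add: s_def y_def scalar_prod_def if_mult_zero)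
    with ij have s_nz: "s \<noteq> 0\<^sub>m b 1" by auto
    \<comment> \<open>\<open>F w\<close> is a preimage of \<open>s\<close> in the submodule, of height at least \<open>k\<close>\<close>
    define Q where "Q k w x \<longleftrightarrow> dim_row w = a \<and> dim_col w = 1 \<and> dim_row x = b \<and> dim_col x = 1 \<and>
       F * w = B ^\<^sub>m k * x \<and> B * (F * w) = s" for k w x
    have Qm: "Suc k < m" if "Q k w x" for k w x
    proof (rule ccontr)
      assume "\<not> Suc k < m"
      then have "B ^\<^sub>m Suc k = B ^\<^sub>m m * B ^\<^sub>m (Suc k - m)"
        using dX by (metis pow_mat_add le_add_diff_inverse not_less)
      then have 0: "B ^\<^sub>m Suc k = 0\<^sub>m b b" unfolding m(1) using dX by (simp add: mat_simps)
      have "B ^\<^sub>m Suc k * x = B * (B ^\<^sub>m k * x)" using that dX unfolding Q_def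
        by (simp add: mult_assoc del: pow_mat.simps flip: pow_Suc_left)
      also have "\<dots> = s" using that unfolding Q_def by metis
      finally show False using that s_nz unfolding 0 Q_def by (simp add: mat_simps)
    qed
    obtain w where "dim_row w = a" "dim_col w = 1" "B * (F * w) = s" using c[of y] dy unfolding s_def by blast
    then have "Q 0 w (F * w)" using dX by (simp add: Q_def mult_one_left)
    then have "\<exists>w x. Q 0 w x" by blast
    then obtain k where k: "\<exists>w x. Q k w x" and max: "\<And>k'. \<exists>w x. Q k' w x \<Longrightarrow> k' \<le> k"
      using Nat.ex_has_greatest_nat[of "\<lambda>k. \<exists>w x. Q k w x" 0 m] Qm by (metis Suc_lessD less_imp_le)
    from k obtain w x where Q: "Q k w x" by blast
    have km: "k + 2 \<le> m" using Qm[OF Q] by simp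
    note Q' = Q[unfolded Q_def]
    have dw: "dim_row w = a" "dim_col w = 1" "dim_row x = b" "dim_col x = 1" using Q' by auto
    have Fw: "F * w = B ^\<^sub>m k * x" and BFw: "B * (F * w) = s" using Q' by auto
    show thesis
    proof (cases "k = m - 2")
      case True
      have ns: "0\<^sub>m b 1 * v \<noteq> s" if "dim_row v = dim_col (0\<^sub>m b 1 :: 'k mat)" "dim_col v = 1" for v
        using that s_nz by (simp add: mat_simps)
      obtain \<phi> where phi: "dim_row \<phi> = 1" "dim_col \<phi> = b" "\<phi> * s = 1\<^sub>m 1"
        by (rule separation[of s "0\<^sub>m b 1", OF _ _ ns]) (use dy in simp_all)
      have "B ^\<^sub>m 2 * F = 0\<^sub>m b a" using dX unfolding triple_power_commute[OF X', symmetric] A2 by (simp add: mat_simps)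
      moreover have "?S * x = s"
      proof -
        have "m - 1 = Suc k" using True km by simp
        then have "?S * x = B * (B ^\<^sub>m k * x)" using dX dw by (simp add: mult_assoc del: pow_mat.simps flip: pow_Suc_left)
        then show ?thesis using Fw BFw by simp
      qed
      ultimately show thesis
        by (intro top[of 2 w x \<phi>]) (use km dw Fw True phi A2 in \<open>simp_all add: mat_simps\<close>)
    next
      case False
      define r where "r = Suc k"
      have r: "1 \<le> r" "r + 2 \<le> m" "k = r - 1" using False km by (auto simp: r_def)
      \<comment> \<open>the system \<open>\<phi> B F + \<psi>' F = 0\<close>, \<open>\<psi>' B\<^sup>r = 0\<close>, \<open>\<phi> s = 1\<close>; an obstruction to solving it would be a
        preimage \<open>F u\<close> of \<open>s\<close> of height at least \<open>r = k + 1\<close>, against the choice of \<open>k\<close>\<close>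
      define N where "N = vcat (hcat (B * F) (0\<^sub>m b b)) (hcat F (B ^\<^sub>m r))"
      have dN: "dim_row N = b + b" "dim_col N = a + b" using dX by (simp_all add: N_def)
      have ns: "N * V \<noteq> vcat s (0\<^sub>m b 1)" if V: "dim_row V = dim_col N" "dim_col V = 1" for V
      proof
        assume eqN: "N * V = vcat s (0\<^sub>m b 1)"
        obtain u v where uv: "V = vcat u v" "dim_row u = a" "dim_row v = b" "dim_col u = dim_col V" "dim_col v = dim_col V"
          by (rule vcat_split[OF V(1)[unfolded dN]])
        have duv: "dim_row u = a" "dim_col u = 1" "dim_row v = b" "dim_col v = 1" using uv(2-5) V(2) by simp_all
        have "N * vcat u v = vcat (B * F * u + 0\<^sub>m b b * v) (F * u + B ^\<^sub>m r * v)"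
          using dX duv by (simp add: N_def vcat_mult hcat_mult_vcat)
        also have "B * F * u + 0\<^sub>m b b * v = B * (F * u)" using dX duv by (simp add: mat_simps)
        finally have "vcat (B * (F * u)) (F * u + B ^\<^sub>m r * v) = vcat s (0\<^sub>m b 1)"
          using eqN unfolding uv(1) by simp
        then have *: "B * (F * u) = s" "F * u + B ^\<^sub>m r * v = 0\<^sub>m b 1"
          using duv dX dy by (auto dest!: vcat_inject)
        have "F * u = 0\<^sub>m b 1 - B ^\<^sub>m r * v"
        proof (rule add_eq_mat_diff)
          show "B ^\<^sub>m r * v + F * u = 0\<^sub>m b 1" using *(2) dX duv
            by (subst comm_add_mat[of _ b 1]) (auto intro!: carrier_matI)
        qed (use dX duv in auto)
        also have "\<dots> = B ^\<^sub>m r * (0\<^sub>m b 1 - v)" using dX duv by (simp add: mat_simps)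
        finally have "Q r u (0\<^sub>m b 1 - v)" using *(1) duv dX by (simp add: Q_def)
        then show False using max[of r] by (auto simp: r_def)
      qed
      obtain \<theta> where theta: "dim_row \<theta> = 1" "dim_col \<theta> = b + b" "\<theta> * N = 0\<^sub>m 1 (a + b)" "\<theta> * vcat s (0\<^sub>m b 1) = 1\<^sub>m 1"
        by (rule separation[of "vcat s (0\<^sub>m b 1)" N, OF _ _ ns]) (use dN dy in simp_all)
      obtain \<phi> \<psi>' where pp: "\<theta> = hcat \<phi> \<psi>'" "dim_col \<phi> = b" "dim_col \<psi>' = b" "dim_row \<phi> = dim_row \<theta>" "dim_row \<psi>' = dim_row \<theta>"
        by (rule hcat_split[OF theta(2)])
      define \<psi> where "\<psi> = 0\<^sub>m 1 b - \<psi>'"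
      have dp: "dim_row \<phi> = 1" "dim_col \<phi> = b" "dim_row \<psi>' = 1" "dim_col \<psi>' = b" "dim_row \<psi> = 1" "dim_col \<psi> = b"
        using pp theta(1) by (simp_all add: \<psi>_def)
      have "hcat (\<phi> * (B * F) + \<psi>' * F) (\<psi>' * B ^\<^sub>m r) = hcat (0\<^sub>m 1 a) (0\<^sub>m 1 b)"
        using theta(3) dp dX unfolding pp(1) N_def by (simp add: hcat_mult_vcat mult_hcat hcat_add mat_simps hcat_zero)
      then have **: "\<phi> * (B * F) + \<psi>' * F = 0\<^sub>m 1 a" "\<psi>' * B ^\<^sub>m r = 0\<^sub>m 1 b"
        using dp dX by (auto dest!: hcat_inject)
      have phis: "\<phi> * s = 1\<^sub>m 1" using theta(4) dp dy unfolding pp(1) by (simp add: hcat_mult_vcat mat_simps)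
      have psiF: "\<psi> * F = \<phi> * (B * F)"
      proof -
        have "\<phi> * (B * F) = 0\<^sub>m 1 a - \<psi>' * F"
        proof (rule add_eq_mat_diff)
          show "\<psi>' * F + \<phi> * (B * F) = 0\<^sub>m 1 a" using **(1) dX dp
            by (subst comm_add_mat[of _ 1 a]) (auto intro!: carrier_matI)
        qed (use dX dp in auto)
        also have "\<dots> = \<psi> * F" using dX dp by (simp add: \<psi>_def mat_simps)
        finally show ?thesis ..
      qed
      have psiB: "\<psi> * B ^\<^sub>m r = 0\<^sub>m 1 b" using **(2) dp dX by (simp add: \<psi>_def mat_simps)
      have psiBy: "\<psi> * (B ^\<^sub>m (m - 2) * y) = 0\<^sub>m 1 1"
      proof -
        have "B ^\<^sub>m (m - 2) = B ^\<^sub>m r * B ^\<^sub>m (m - 2 - r)" using pow_mat_add[of B r "m - 2 - r"] dX r by simp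
        then have "\<psi> * (B ^\<^sub>m (m - 2) * y) = (\<psi> * B ^\<^sub>m r) * (B ^\<^sub>m (m - 2 - r) * y)"
          using dX dp dy by (simp add: mult_assoc)
        then show ?thesis using dX dp dy by (simp add: psiB mat_simps)
      qed
      \<comment> \<open>the generator of the smaller block: \<open>F w\<close> and \<open>B\<^bsup>m-2\<^esup> y\<close> have the same image \<open>s\<close> under \<open>B\<close>\<close>
      define z where "z = x - B ^\<^sub>m (m - 2 - k) * y"
      have dz: "dim_row z = b" "dim_col z = 1" using dX dy by (simp_all add: z_def)
      have Bkz: "B ^\<^sub>m (r - 1) * z = F * w - B ^\<^sub>m (m - 2) * y"
      proof -
        have "k + (m - 2 - k) = m - 2" using km by simp
        then have "B ^\<^sub>m k * (B ^\<^sub>m (m - 2 - k) * y) = B ^\<^sub>m (m - 2) * y"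
          using pow_mat_add[of B k "m - 2 - k"] dX dy by (simp flip: mult_assoc)
        then show ?thesis using dX dw dy unfolding Fw r(3)[symmetric] z_def by (subst mult_diff_right) simp_all
      qed
      have "B ^\<^sub>m r * z = B * (B ^\<^sub>m (r - 1) * z)"
        using dX dz by (simp add: r_def mult_assoc del: pow_mat.simps flip: pow_Suc_left)
      also have "\<dots> = s - B * (B ^\<^sub>m (m - 2) * y)" unfolding Bkz using dX dw dy BFw by (simp add: mult_diff_right)
      also have "B * (B ^\<^sub>m (m - 2) * y) = s"
      proof -
        have "m - 1 = Suc (m - 2)" using r by simp
        then show ?thesis using dX dy by (simp add: s_def mult_assoc del: pow_mat.simps flip: pow_Suc_left)
      qed
      also have "s - s = 0\<^sub>m b 1" using dy by (simp add: diff_self_mat)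
      finally have Brz: "B ^\<^sub>m r * z = 0\<^sub>m b 1" .
      have sum: "F * w = B ^\<^sub>m (m - 2) * y + B ^\<^sub>m (r - 1) * z" unfolding Bkz using dX dw dy
        by (intro eq_matI) auto
      have "\<psi> * (B ^\<^sub>m (r - 1) * z) = \<psi> * (F * w) - 0\<^sub>m 1 1"
        unfolding Bkz using dX dw dy dp psiBy by (simp add: mult_diff_right)
      also have "\<psi> * (F * w) = (\<psi> * F) * w" using dX dw dp by (simp add: mult_assoc)
      also have "\<dots> = \<phi> * (B * (F * w))" unfolding psiF using dX dw dp by (simp add: mult_assoc)
      also have "\<dots> - 0\<^sub>m 1 1 = 1\<^sub>m 1" unfolding BFw phis by (simp add: diff_zero_mat)
      finally have psiz: "\<psi> * (B ^\<^sub>m (r - 1) * z) = 1\<^sub>m 1" .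
      have mr: "valid_indec (Bipicket m r)" using r by simp
      obtain a' b' X1 where "s2_triple a' b' X1" "a = 2 + a'" "b = m + r + b'"
        "isomorphic (A, F, B) (tsum (indec_triple (Bipicket m r)) X1)"
        by (rule split_bipicket[OF X' mr dw(1,2) dy(1,2) dz dp(1,2,5,6) sum Brz m(1) psiF psiB phis[unfolded s_def] psiz])
      then show thesis using result[of "Bipicket m r" a' b' X1] mr by (simp add: eq del: indec_triple.simps)
    qed
  qed
qed

lemma s2_triple_decomposes:
  fixes X :: "'k :: field triple"
  assumes "s2_triple a b X"
  shows "\<exists>xs. decomposes_as X xs"
  using assms
proof (induction b arbitrary: a X rule: less_induct)
  case (less b)
  show ?case
  proof (cases "b = 0")
    case True
    obtain A F B where eq: "X = (A, F, B)" by (cases X)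
    have d: "dim_row A = a" "dim_col A = a" "dim_row F = 0" "dim_col F = a" "dim_row B = 0" "dim_col B = 0"
      and injF: "inj_mat F"
      using less.prems True by (simp_all add: s2_triple_def triple_space_iff eq)
    have "F * 1\<^sub>m a = 0\<^sub>m 0 a" using d by (intro eq_matI) auto
    then have "1\<^sub>m a = (0\<^sub>m a a :: 'k mat)" using inj_matD[OF injF, of "1\<^sub>m a" 0 a] d by simp
    then have "a = 0" by (metis gr0I index_one_mat(1) index_zero_mat(1) zero_neq_one)
    then have "X = direct_sum []" unfolding eq direct_sum_Nil using d by (auto intro!: eq_matI)
    moreover have "X \<in> triple_space a b" using less.prems by (simp add: s2_triple_def)
    ultimately have "decomposes_as X []" unfolding decomposes_as_def using isomorphic_refl[of X a b] by simp
    then show ?thesis ..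
  next
    case False
    then obtain x a' b' X' where x: "valid_indec x" "s2_triple a' b' X'" "a = sub_dim x + a'"
      "b = sum_list (jordan_sizes x) + b'" "isomorphic X (tsum (indec_triple x) X')"
      using indec_step[OF less.prems] by blast
    have "b' < b" using x(1,4) by (cases x) auto
    from less.IH[OF this x(2)] obtain xs where xs: "\<forall>x\<in>set xs. valid_indec x" "isomorphic X' (direct_sum (map indec_triple xs))"
      unfolding decomposes_as_def by blast
    have sp: "X \<in> triple_space a b" "X' \<in> triple_space a' b'" "indec_triple x \<in> triple_space (sub_dim x) (sum_list (jordan_sizes x))"
      using less.prems x(2) s2_triple_indec[OF x(1)] by (auto simp: s2_triple_def)
    have sum: "direct_sum (map indec_triple xs) \<in> triple_space (sum_list (map sub_dim xs)) (sum_list (map (sum_list \<circ> jordan_sizes) xs))"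
      by (rule direct_sum_triple_space[OF xs(1)])
    have ab: "sum_list (map sub_dim xs) = a'" "sum_list (map (sum_list \<circ> jordan_sizes) xs) = b'"
      using isomorphic_dims[OF xs(2) sp(2) sum] by auto
    have "isomorphic (tsum (indec_triple x) X') (tsum (indec_triple x) (direct_sum (map indec_triple xs)))"
      by (rule tsum_cong[OF isomorphic_refl[OF sp(3)] xs(2) sp(3,3,2) sum[unfolded ab]])
    then have "isomorphic X (direct_sum (map indec_triple (x # xs)))"
      unfolding list.map direct_sum_Cons
      by (rule isomorphic_trans[OF x(5) _ sp(1) tsum_triple_space[OF sp(3,2)] tsum_triple_space[OF sp(3) sum]])
    then have "decomposes_as X (x # xs)" using x(1) xs(1) by (simp add: decomposes_as_def)
    then show ?thesis ..
  qed
qed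

section \<open>Dimensions of subspaces\<close>

text \<open>
  The vectors satisfying \<open>S\<close> form a subspace of dimension \<open>d\<close>: it is the range of \<open>L\<close>, and \<open>L'\<close> is a left
  inverse, so that membership is a fixed-point equation. As for \<open>inj_mat\<close>, the variable \<open>u\<close> may have any
  number of columns.
\<close>

definition has_dim :: "nat \<Rightarrow> ('k :: field mat \<Rightarrow> bool) \<Rightarrow> nat \<Rightarrow> bool" where
  "has_dim a S d \<longleftrightarrow> (\<exists>L L'. dim_row L = a \<and> dim_col L = d \<and> dim_row L' = d \<and> dim_col L' = a \<and>
     L' * L = 1\<^sub>m d \<and> (\<forall>u. dim_row u = a \<longrightarrow> (S u \<longleftrightarrow> L * (L' * u) = u)))"

lemma has_dim_unique_le:
  assumes "has_dim a S d" "has_dim a S d'"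
  shows "d \<le> d'"
proof -
  obtain L L' where 1: "dim_row L = a" "dim_col L = d" "dim_row L' = d" "dim_col L' = a"
     "L' * L = 1\<^sub>m d" "\<And>u. dim_row u = a \<Longrightarrow> (S u \<longleftrightarrow> L * (L' * u) = u)"
    using assms(1) unfolding has_dim_def by blast
  obtain K K' where 2: "dim_row K = a" "dim_col K = d'" "dim_row K' = d'" "dim_col K' = a"
     "\<And>u. dim_row u = a \<Longrightarrow> (S u \<longleftrightarrow> K * (K' * u) = u)"
    using assms(2) unfolding has_dim_def by blast
  have "S L" using 1 by (simp add: mult_one_right)
  then have "K * (K' * L) = L" using 1 2 by simp
  then have "L' * K * (K' * L) = 1\<^sub>m d" using 1(1-5) 2(1-4) by (simp add: mult_assoc)
  then show ?thesis using 1 2 by (intro inverse_pair_le[of "L' * K" d d' "K' * L"]) (auto intro!: carrier_matI)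
qed

lemma has_dim_unique: "has_dim a S d \<Longrightarrow> has_dim a S d' \<Longrightarrow> d = d'"
  using has_dim_unique_le by (metis le_antisym)

lemma has_dim_le:
  fixes S :: "'k :: field mat \<Rightarrow> bool"
  assumes "has_dim a S d"
  shows "d \<le> a"
proof -
  obtain L L' :: "'k mat" where 1: "dim_row L = a" "dim_col L = d" "dim_row L' = d" "dim_col L' = a" "L' * L = 1\<^sub>m d"
    using assms unfolding has_dim_def by (elim exE conjE)
  then show ?thesis by (intro inverse_pair_le[of L' d a L]) (auto intro!: carrier_matI)
qed

lemma has_dim_cong: "(\<And>u. dim_row u = a \<Longrightarrow> S u \<longleftrightarrow> S' u) \<Longrightarrow> has_dim a S d \<longleftrightarrow> has_dim a S' d"
  unfolding has_dim_def by metis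

lemma has_dim_transport:
  assumes S: "has_dim a S d" and g: "inverse_pair a g g'"
    and S': "\<And>u. dim_row u = a \<Longrightarrow> S' u \<longleftrightarrow> S (g' * u)"
  shows "has_dim a S' d"
proof -
  obtain L L' where 1: "dim_row L = a" "dim_col L = d" "dim_row L' = d" "dim_col L' = a"
     "L' * L = 1\<^sub>m d" "\<And>u. dim_row u = a \<Longrightarrow> (S u \<longleftrightarrow> L * (L' * u) = u)"
    using S unfolding has_dim_def by blast
  note d = 1(1-4) inverse_pairD[OF g]
  have "(L' * g') * (g * L) = 1\<^sub>m d" using 1(5) by (simp add: d mult_assoc)
  moreover have "S' u \<longleftrightarrow> (g * L) * ((L' * g') * u) = u" if u: "dim_row u = a" for u
  proof -
    have "S' u \<longleftrightarrow> L * (L' * (g' * u)) = g' * u" using S' 1(6) u by (simp add: d)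
    also have "\<dots> \<longleftrightarrow> g * (L * (L' * (g' * u))) = u"
    proof
      assume "L * (L' * (g' * u)) = g' * u"
      then show "g * (L * (L' * (g' * u))) = u" using u by (simp add: d)
    next
      assume "g * (L * (L' * (g' * u))) = u"
      then have "g' * (g * (L * (L' * (g' * u)))) = g' * u" by simp
      then show "L * (L' * (g' * u)) = g' * u" by (simp add: d)
    qed
    finally show ?thesis using u by (simp add: d mult_assoc)
  qed
  ultimately show ?thesis unfolding has_dim_def
    by (intro exI[of _ "g * L"] exI[of _ "L' * g'"]) (simp add: d)
qed

lemma has_dim_vcat:
  assumes "has_dim a S d" "has_dim a' S' d'"
    "\<And>u v. dim_row u = a \<Longrightarrow> dim_row v = a' \<Longrightarrow> dim_col u = dim_col v \<Longrightarrow> S'' (vcat u v) \<longleftrightarrow> S u \<and> S' v"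
  shows "has_dim (a + a') S'' (d + d')"
proof -
  obtain L L' where 1: "dim_row L = a" "dim_col L = d" "dim_row L' = d" "dim_col L' = a"
     "L' * L = 1\<^sub>m d" "\<And>u. dim_row u = a \<Longrightarrow> (S u \<longleftrightarrow> L * (L' * u) = u)"
    using assms(1) unfolding has_dim_def by blast
  obtain K K' where 2: "dim_row K = a'" "dim_col K = d'" "dim_row K' = d'" "dim_col K' = a'"
     "K' * K = 1\<^sub>m d'" "\<And>u. dim_row u = a' \<Longrightarrow> (S' u \<longleftrightarrow> K * (K' * u) = u)"
    using assms(2) unfolding has_dim_def by blast
  have "S'' u \<longleftrightarrow> dsum L K * (dsum L' K' * u) = u" if u: "dim_row u = a + a'" for u
  proof -
    obtain v w where vw: "u = vcat v w" "dim_row v = a" "dim_row w = a'" "dim_col v = dim_col u" "dim_col w = dim_col u"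
      by (rule vcat_split[OF u])
    have c: "dim_col v = dim_col w" using vw by simp
    have "dsum L K * (dsum L' K' * vcat v w) = vcat (L * (L' * v)) (K * (K' * w))"
      using vw(2,3) c 1(1-4) 2(1-4) by (simp add: dsum_mult_vcat)
    moreover have "vcat (L * (L' * v)) (K * (K' * w)) = vcat v w \<longleftrightarrow> L * (L' * v) = v \<and> K * (K' * w) = w"
      using vw(2,3) c 1(1-4) 2(1-4) vcat_inject[of "L * (L' * v)" "K * (K' * w)" v w] by auto
    ultimately show ?thesis unfolding vw(1) using assms(3)[OF vw(2,3) c] 1(6)[OF vw(2)] 2(6)[OF vw(3)] by simp
  qed
  then show ?thesis unfolding has_dim_def using 1(1-5) 2(1-5)
    by (intro exI[of _ "dsum L K"] exI[of _ "dsum L' K'"]) (simp add: dsum_mult_dsum dsum_one)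
qed

lemma has_dim_coordinate:
  fixes S :: "'k :: field mat \<Rightarrow> bool"
  assumes "\<And>u. dim_row u = a \<Longrightarrow> S u \<longleftrightarrow> (\<forall>i < a. \<forall>c < dim_col u. p i \<or> u $$ (i, c) = 0)"
  shows "has_dim a S (length (filter p [0..<a]))"
proof -
  let ?xs = "filter p [0..<a]"
  let ?d = "length ?xs"
  define L :: "'k mat" where "L = mat a ?d (\<lambda>(i, k). if i = ?xs ! k then 1 else 0)"
  define L' :: "'k mat" where "L' = mat ?d a (\<lambda>(k, i). if i = ?xs ! k then 1 else 0)"
  have xs: "?xs ! k < a" "p (?xs ! k)" if "k < ?d" for k
    using nth_mem[OF that] by auto
  have L'u: "(L' * u) $$ (k, c) = u $$ (?xs ! k, c)" if "dim_row u = a" "k < ?d" "c < dim_col u" for u k c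
    using that xs(1)[of k] by (simp add: L'_def scalar_prod_def if_mult_zero)
  have "L' * L = 1\<^sub>m ?d"
  proof (rule eq_matI)
    fix k k' assume k: "k < dim_row (1\<^sub>m ?d :: 'k mat)" "k' < dim_col (1\<^sub>m ?d :: 'k mat)"
    then have "(L' * L) $$ (k, k') = L $$ (?xs ! k, k')" by (intro L'u) (auto simp: L_def)
    also have "\<dots> = (1\<^sub>m ?d) $$ (k, k')" using k xs(1)[of k] by (auto simp: L_def nth_eq_iff_index_eq)
    finally show "(L' * L) $$ (k, k') = (1\<^sub>m ?d :: 'k mat) $$ (k, k')" .
  qed (auto simp: L_def L'_def)
  moreover have "S u \<longleftrightarrow> L * (L' * u) = u" if u: "dim_row u = a" for u
  proof -
    have LL: "(L * (L' * u)) $$ (i, c) = (if p i then u $$ (i, c) else 0)" if ic: "i < a" "c < dim_col u" for i c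
    proof -
      have "(L * (L' * u)) $$ (i, c) = (\<Sum>k = 0..<?d. L $$ (i, k) * (L' * u) $$ (k, c))"
        using ic u by (simp add: L_def L'_def scalar_prod_def)
      also have "\<dots> = (\<Sum>k = 0..<?d. (if i = ?xs ! k then u $$ (?xs ! k, c) else 0))"
        using ic u by (intro sum.cong refl) (simp add: L'u del: index_mult_mat(1), simp add: L_def)
      also have "\<dots> = (if p i then u $$ (i, c) else 0)"
      proof (cases "p i")
        case True
        then have "i \<in> set ?xs" using ic by simp
        then obtain k0 where k0: "k0 < ?d" "?xs ! k0 = i" by (metis in_set_conv_nth)
        then have "(if i = ?xs ! k then u $$ (?xs ! k, c) else 0) = (if k = k0 then u $$ (i, c) else 0)" if "k \<in> {0..<?d}" for k
          using that by (auto simp: nth_eq_iff_index_eq)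
        then have "(\<Sum>k = 0..<?d. (if i = ?xs ! k then u $$ (?xs ! k, c) else 0)) = (\<Sum>k = 0..<?d. if k = k0 then u $$ (i, c) else 0)"
          by (rule sum.cong[OF refl])
        then show ?thesis using True k0 by simp
      next
        case False
        then have "(if i = ?xs ! k then u $$ (?xs ! k, c) else 0) = 0" if "k \<in> {0..<?d}" for k
          using xs(2)[of k] that by auto
        then show ?thesis using False by (simp add: sum.neutral)
      qed
      finally show ?thesis .
    qed
    show ?thesis unfolding assms[OF u]
    proof
      assume *: "\<forall>i<a. \<forall>c<dim_col u. p i \<or> u $$ (i, c) = 0"
      show "L * (L' * u) = u"
      proof (rule eq_matI)
        fix i c assume "i < dim_row u" "c < dim_col u"
        then show "(L * (L' * u)) $$ (i, c) = u $$ (i, c)" using LL[of i c] * u by auto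
      qed (use u in \<open>auto simp: L_def\<close>)
    next
      assume eq: "L * (L' * u) = u"
      show "\<forall>i<a. \<forall>c<dim_col u. p i \<or> u $$ (i, c) = 0"
        using LL unfolding eq by metis
    qed
  qed
  ultimately show ?thesis unfolding has_dim_def
    by (intro exI[of _ L] exI[of _ L']) (simp add: L_def L'_def)
qed

text \<open>
  The columns of \<open>C\<close> contribute to the rank of \<open>(C | D)\<close> exactly modulo the range of \<open>D\<close>, so the
  contribution is the codimension of the space of all \<open>u\<close> with \<open>C u\<close> in that range.
\<close>

lemma rank_hcat:
  fixes C D :: "'k :: field mat"
  assumes d: "dim_row C = dim_row D" "dim_col C = a" and D: "is_rank D s"
    and S: "has_dim a (\<lambda>u. \<exists>x. dim_row x = dim_col D \<and> C * u = D * x) e"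
  shows "is_rank (hcat C D) (a - e + s)"
proof -
  obtain P Q where 1: "dim_row P = s" "dim_col P = dim_row D" "dim_row Q = dim_col D" "dim_col Q = s"
    "P * (D * Q) = 1\<^sub>m s" "D * (Q * (P * D)) = D" using D by (elim is_rankE)
  obtain L L' where 2: "dim_row L = a" "dim_col L = e" "dim_row L' = e" "dim_col L' = a"
     "L' * L = 1\<^sub>m e" "\<And>u. dim_row u = a \<Longrightarrow> ((\<exists>x. dim_row x = dim_col D \<and> C * u = D * x) \<longleftrightarrow> L * (L' * u) = u)"
    using S unfolding has_dim_def by blast
  obtain r K' K where 3: "dim_row K' = r" "dim_col K' = a" "dim_row K = a" "dim_col K = r" "a = e + r"
    "K' * K = 1\<^sub>m r" "L' * K = 0\<^sub>m e r" "K' * L = 0\<^sub>m r e" "L * L' + K * K' = 1\<^sub>m a"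
    by (rule complement[OF 2(3,4,1,2,5)])
  note dd = d 1(1-4) 2(1-4) 3(1-4)
  let ?n = "dim_row D"
  have PDQ: "P * (D * (Q * Z)) = Z" if "dim_row Z = s" for Z
  proof -
    have "P * (D * (Q * Z)) = (P * (D * Q)) * Z" using that dd by (simp add: mult_assoc)
    then show ?thesis using that by (simp add: 1(5) mult_one_left)
  qed
  have DQPD: "D * (Q * (P * (D * Z))) = D * Z" if "dim_row Z = dim_col D" for Z
  proof -
    have "D * (Q * (P * (D * Z))) = (D * (Q * (P * D))) * Z" using that dd by (simp add: mult_assoc)
    then show ?thesis by (simp add: 1(6))
  qed
  \<comment> \<open>a projection with kernel the range of \<open>D\<close>, so that \<open>E = R C\<close> vanishes exactly on the given subspace\<close>
  define R where "R = 1\<^sub>m ?n - D * (Q * P)"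
  have dR: "dim_row R = ?n" "dim_col R = ?n" using dd by (simp_all add: R_def)
  have RD: "R * D = 0\<^sub>m ?n (dim_col D)" using dd by (simp add: R_def mat_simps 1(6))
  have RD': "R * (D * Z) = 0\<^sub>m ?n (dim_col Z)" if "dim_row Z = dim_col D" for Z
  proof -
    have "R * (D * Z) = (R * D) * Z" using that dR by (simp add: mult_assoc)
    then show ?thesis using that by (simp add: RD mat_simps)
  qed
  have PR: "P * R = 0\<^sub>m s ?n" using dd by (simp add: R_def mat_simps PDQ)
  define E where "E = R * C"
  have dE: "dim_row E = ?n" "dim_col E = a" using dd dR by (simp_all add: E_def)
  have LS: "E * L = 0\<^sub>m ?n e"
  proof -
    obtain x where "dim_row x = dim_col D" "C * L = D * x" using 2(6)[of L] 2(1-5) by (auto simp: mult_one_right)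
    then have "E * L = R * (D * x)" "dim_col x = e" using dd dR
      by (simp_all add: E_def mult_assoc) (metis index_mult_mat(3))
    then show ?thesis using RD'[of x] \<open>dim_row x = dim_col D\<close> by simp
  qed
  have EKK: "E * (K * K') = E"
  proof -
    have "E = E * (L * L' + K * K')" using dE 3(9) by (simp add: mult_one_right)
    also have "\<dots> = (E * L) * L' + E * (K * K')" using dd dE by (simp add: mult_add_right mult_assoc)
    also have "\<dots> = E * (K * K')" unfolding LS using dd dE by (simp add: mat_simps)
    finally show ?thesis ..
  qed
  have "inj_mat (E * K)"
  proof (rule inj_matI)
    fix V assume V: "dim_row V = dim_col (E * K)" "E * K * V = 0\<^sub>m (dim_row (E * K)) (dim_col V)"
    then have V': "dim_row V = r" using dd by simp
    have "C * (K * V) - D * (Q * (P * (C * (K * V)))) = 0\<^sub>m ?n (dim_col V)"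
      using V(2) V' dd dR dE by (simp add: E_def R_def mat_simps)
    then have "C * (K * V) = D * (Q * (P * (C * (K * V))))"
      by (rule diff_eq_zero_matD) (use dd V' in simp_all)
    then have "\<exists>x. dim_row x = dim_col D \<and> C * (K * V) = D * x" using dd
      by (intro exI[of _ "Q * (P * (C * (K * V)))"]) simp
    then have "L * (L' * (K * V)) = K * V" using 2(6)[of "K * V"] dd by simp
    moreover have "L' * (K * V) = 0\<^sub>m e (dim_col V)" using 3(7) dd V' by (simp add: mat_simps flip: mult_assoc)
    ultimately have KV: "K * V = 0\<^sub>m a (dim_col V)" using dd by (simp add: mat_simps)
    have "V = K' * (K * V)" using cancel_left[OF 3(6)] dd V' by simp
    then show "V = 0\<^sub>m (dim_col (E * K)) (dim_col V)" unfolding KV using dd V' by (simp add: mat_simps)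
  qed
  then obtain Z where Z: "dim_row Z = r" "dim_col Z = ?n" "Z * (E * K) = 1\<^sub>m r"
    using inj_mat_left_inverse[of "E * K"] dd dE by auto
  let ?M = "hcat C D"
  \<comment> \<open>here \<open>?M ?Q = (E K | D Q)\<close>, as the lower left block of \<open>?Q\<close> subtracts the part of \<open>C K\<close> in the range of \<open>D\<close>\<close>
  let ?P = "vcat (Z * R) P" and ?Q = "hcat (vcat K (0\<^sub>m (dim_col D) r - Q * (P * (C * K)))) (vcat (0\<^sub>m a s) Q)"
  have MQ: "?M * ?Q = hcat (E * K) (D * Q)"
  proof -
    have "?M * vcat K (0\<^sub>m (dim_col D) r - Q * (P * (C * K))) = C * K + D * (0\<^sub>m (dim_col D) r - Q * (P * (C * K)))"
      using dd by (subst hcat_mult_vcat) simp_all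
    also have "\<dots> = C * K + (0\<^sub>m ?n r - D * (Q * (P * (C * K))))" using dd by (simp add: mat_simps)
    also have "\<dots> = C * K - D * (Q * (P * (C * K)))" using dd by (intro eq_matI) simp_all
    also have "\<dots> = E * K" using dd by (simp add: E_def R_def mat_simps)
    finally have 1: "?M * vcat K (0\<^sub>m (dim_col D) r - Q * (P * (C * K))) = E * K" .
    have 2: "?M * vcat (0\<^sub>m a s) Q = D * Q" using dd by (subst hcat_mult_vcat) (simp_all add: mat_simps)
    show ?thesis using dd by (subst mult_hcat) (simp_all add: 1 2)
  qed
  have RE: "R * E = E"
  proof -
    have "R * E = R * C - R * (D * (Q * (P * C)))" using dd by (subst E_def, subst R_def) (simp add: R_def mat_simps DQPD)
    then show ?thesis using dd dE by (simp add: RD' E_def diff_zero_mat)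
  qed
  have PMQ: "?P * (?M * ?Q) = 1\<^sub>m (r + s)"
  proof -
    have a: "(Z * R) * (E * K) = 1\<^sub>m r"
    proof -
      have "(Z * R) * (E * K) = Z * ((R * E) * K)" using dd dE dR Z(1,2) by (simp add: mult_assoc)
      then show ?thesis using Z dd by (simp add: RE)
    qed
    have b: "(Z * R) * (D * Q) = 0\<^sub>m r s" using dd dR Z(1,2) by (simp add: mat_simps RD')
    have "P * (E * K) = (P * R) * (C * K)" using dd dR by (simp add: E_def mult_assoc)
    then have c: "P * (E * K) = 0\<^sub>m s r" using dd by (simp add: PR mat_simps)
    show ?thesis unfolding MQ using dd dE dR Z(1,2)
      by (subst vcat_mult_hcat) (simp_all add: a b c 1(5))
  qed
  have PM: "?P * ?M = vcat (hcat (Z * E) (0\<^sub>m r (dim_col D))) (hcat (P * C) (P * D))"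
  proof -
    have "(Z * R) * C = Z * E" "(Z * R) * D = 0\<^sub>m r (dim_col D)"
      using dd dR Z(1,2) by (simp_all add: E_def mult_assoc RD mat_simps)
    then show ?thesis using dd dR Z(1,2) by (subst vcat_mult) (simp_all add: mult_hcat)
  qed
  have "?M * ?Q * (?P * ?M) = hcat (E * K * (Z * E) + D * Q * (P * C)) (E * K * 0\<^sub>m r (dim_col D) + D * Q * (P * D))"
    unfolding MQ PM using dd dE Z(1,2)
    by (subst hcat_mult_vcat) (simp_all add: mult_hcat hcat_add)
  also have "E * K * (Z * E) = E"
  proof -
    have "E * K * (Z * E) = E * K * (Z * (E * (K * K')))" unfolding EKK ..
    also have "\<dots> = E * (K * ((Z * (E * K)) * K'))" using dd dE Z(1,2) by (simp add: mult_assoc)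
    also have "\<dots> = E" unfolding Z(3) using dd EKK by (simp add: mult_one_left)
    finally show ?thesis .
  qed
  also have "E + D * Q * (P * C) = C"
  proof -
    have "E = C - D * (Q * (P * C))" using dd by (simp add: E_def R_def mat_simps)
    then show ?thesis using dd by (intro eq_matI) (simp_all add: mult_assoc del: index_mult_mat(1))
  qed
  also have "E * K * 0\<^sub>m r (dim_col D) + D * Q * (P * D) = D"
    using dd dE 1(6) by (simp add: mat_simps)
  finally have "?M * ?Q * (?P * ?M) = ?M" .
  then have "?M * (?Q * (?P * ?M)) = ?M" using dd dR Z(1,2) by (simp add: mult_assoc)
  then have "is_rank ?M (r + s)"
    using dd dR Z(1,2) PMQ by (intro is_rankI[of ?P _ _ ?Q]) simp_all
  then show ?thesis using 3(5) by simp
qed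

section \<open>Heights in the submodule\<close>

text \<open>
  The vectors \<open>u\<close> of the submodule such that \<open>u\<close> has height at least \<open>j\<close> and \<open>T u\<close> has height at least
  \<open>i\<close>. Pairs of heights are needed: the separate dimensions for \<open>u\<close> and \<open>T u\<close> would give the numbers \<open>m\<close>
  and \<open>r\<close> of the bipickets \<open>B\<^sub>2\<^bsup>m,r\<^esup>\<close>, but not how they are paired.
\<close>

fun height_space :: "nat \<Rightarrow> nat \<Rightarrow> 'k :: field triple \<Rightarrow> 'k mat \<Rightarrow> bool" where
  "height_space j i (A, F, B) u \<longleftrightarrow>
     (\<exists>x. dim_row x = dim_row B \<and> F * u = B ^\<^sub>m j * x) \<and> (\<exists>x. dim_row x = dim_row B \<and> B * (F * u) = B ^\<^sub>m i * x)"

lemma height_space_isomorphic: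
  assumes "isomorphic X Y" "X \<in> triple_space a b" "Y \<in> triple_space a b" "has_dim a (height_space j i X) d"
  shows "has_dim a (height_space j i Y) d"
proof -
  obtain A F B A' F' B' where eq: "X = (A, F, B)" "Y = (A', F', B')" by (cases X, cases Y)
  note a = assms[unfolded eq]
  obtain g g' h h' where g: "inverse_pair a g g'" and h: "inverse_pair b h h'"
    and hB: "h * B = B' * h" and Fg: "F' * g = h * F" by (rule isomorphicE[OF a(1-3)])
  note d = a(2,3)[unfolded triple_space_iff] inverse_pairD[OF g] inverse_pairD[OF h]
  have hB': "h' * B' = B * h'" by (rule intertwiner_inverse[OF hB h h]) (simp_all add: d)
  have hF': "h' * F' = F * g'" by (rule intertwiner_inverse[OF Fg[symmetric] h g]) (simp_all add: d)
  have pow: "h * B ^\<^sub>m k = B' ^\<^sub>m k * h" "h' * B' ^\<^sub>m k = B ^\<^sub>m k * h'" for k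
    by (rule pow_mat_commute_intertwiner[OF hB] pow_mat_commute_intertwiner[OF hB']; simp add: d)+
  have range: "(\<exists>x. dim_row x = b \<and> v = B' ^\<^sub>m k * x) \<longleftrightarrow> (\<exists>x. dim_row x = b \<and> h' * v = B ^\<^sub>m k * x)"
    if v: "dim_row v = b" for k v
  proof
    assume "\<exists>x. dim_row x = b \<and> v = B' ^\<^sub>m k * x"
    then obtain x where x: "dim_row x = b" "v = B' ^\<^sub>m k * x" by blast
    have "h' * v = (h' * B' ^\<^sub>m k) * x" using x by (simp add: d mult_assoc)
    also have "\<dots> = B ^\<^sub>m k * (h' * x)" unfolding pow using x(1) by (simp add: d mult_assoc)
    finally show "\<exists>x. dim_row x = b \<and> h' * v = B ^\<^sub>m k * x" by (intro exI[of _ "h' * x"]) (simp add: d)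
  next
    assume "\<exists>x. dim_row x = b \<and> h' * v = B ^\<^sub>m k * x"
    then obtain x where x: "dim_row x = b" "h' * v = B ^\<^sub>m k * x" by blast
    have "v = h * (h' * v)" using v by (simp add: d)
    also have "\<dots> = (h * B ^\<^sub>m k) * x" unfolding x(2) using x(1) by (simp add: d mult_assoc)
    also have "\<dots> = B' ^\<^sub>m k * (h * x)" unfolding pow using x(1) by (simp add: d mult_assoc)
    finally show "\<exists>x. dim_row x = b \<and> v = B' ^\<^sub>m k * x" by (intro exI[of _ "h * x"]) (simp add: d)
  qed
  show ?thesis
  proof (rule has_dim_transport[OF assms(4) g])
    fix u :: "'a mat" assume u: "dim_row u = a"
    have 1: "h' * (F' * u) = F * (g' * u)" using u by (simp add: d hF' flip: mult_assoc)
    have "h' * (B' * (F' * u)) = B * (h' * (F' * u))" using u by (simp add: d hB' flip: mult_assoc)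
    then have 2: "h' * (B' * (F' * u)) = B * (F * (g' * u))" unfolding 1 .
    show "height_space j i Y u \<longleftrightarrow> height_space j i X (g' * u)"
      using range[of "F' * u" j] range[of "B' * (F' * u)" i] unfolding eq height_space.simps 1 2 by (simp add: d)
  qed
qed

lemma range_dsum:
  assumes "dim_row v = dim_row P" "dim_row w = dim_row Q" "dim_col v = dim_col w" and pq: "dim_col P = p" "dim_col Q = q"
  shows "(\<exists>x. dim_row x = p + q \<and> vcat v w = dsum P Q * x) \<longleftrightarrow>
    (\<exists>x. dim_row x = p \<and> v = P * x) \<and> (\<exists>x. dim_row x = q \<and> w = Q * (x :: 'k :: field mat))"
  unfolding pq[symmetric]
proof (intro iffI conjI)
  assume "\<exists>x. dim_row x = dim_col P + dim_col Q \<and> vcat v w = dsum P Q * x"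
  then obtain x where x: "dim_row x = dim_col P + dim_col Q" "vcat v w = dsum P Q * x" by blast
  obtain y z where yz: "x = vcat y z" "dim_row y = dim_col P" "dim_row z = dim_col Q" "dim_col y = dim_col x" "dim_col z = dim_col x"
    by (rule vcat_split[OF x(1)])
  have "vcat v w = vcat (P * y) (Q * z)" using x(2) yz(2-5) by (subst (asm) yz(1)) (simp add: dsum_mult_vcat)
  then have "v = P * y \<and> w = Q * z" by (rule vcat_inject) (use assms yz(2-5) in simp_all)
  then show "\<exists>x. dim_row x = dim_col P \<and> v = P * x" "\<exists>x. dim_row x = dim_col Q \<and> w = Q * x"
    using yz(2,3) by auto
next
  assume "(\<exists>x. dim_row x = dim_col P \<and> v = P * x) \<and> (\<exists>x. dim_row x = dim_col Q \<and> w = Q * x)"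
  then obtain y z where yz: "dim_row y = dim_col P" "v = P * y" "dim_row z = dim_col Q" "w = Q * z" by blast
  then show "\<exists>x. dim_row x = dim_col P + dim_col Q \<and> vcat v w = dsum P Q * x"
    using assms(3) by (intro exI[of _ "vcat y z"]) (simp add: dsum_mult_vcat)
qed

lemma height_space_tsum:
  assumes "X \<in> triple_space a b" "Y \<in> triple_space a' b'" "has_dim a (height_space j i X) d" "has_dim a' (height_space j i Y) d'"
  shows "has_dim (a + a') (height_space j i (tsum X Y)) (d + d')"
proof (rule has_dim_vcat[OF assms(3,4)])
  fix u v :: "'a mat" assume uv: "dim_row u = a" "dim_row v = a'" "dim_col u = dim_col v"
  obtain A F B A' F' B' where eq: "X = (A, F, B)" "Y = (A', F', B')" by (cases X, cases Y)
  note dX = assms(1,2)[unfolded eq triple_space_iff]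
  have 1: "dsum F F' * vcat u v = vcat (F * u) (F' * v)" using dX uv by (simp add: dsum_mult_vcat)
  have 2: "dsum B B' * vcat (F * u) (F' * v) = vcat (B * (F * u)) (B' * (F' * v))" using dX uv by (simp add: dsum_mult_vcat)
  have 3: "dsum B B' ^\<^sub>m k = dsum (B ^\<^sub>m k) (B' ^\<^sub>m k)" for k using dX by (simp add: dsum_pow)
  have *: "(\<exists>x. dim_row x = b + b' \<and> vcat (F * u) (F' * v) = dsum (B ^\<^sub>m j) (B' ^\<^sub>m j) * x) \<longleftrightarrow>
     (\<exists>x. dim_row x = b \<and> F * u = B ^\<^sub>m j * x) \<and> (\<exists>x. dim_row x = b' \<and> F' * v = B' ^\<^sub>m j * x)"
    using dX uv by (intro range_dsum) simp_all
  have **: "(\<exists>x. dim_row x = b + b' \<and> vcat (B * (F * u)) (B' * (F' * v)) = dsum (B ^\<^sub>m i) (B' ^\<^sub>m i) * x) \<longleftrightarrow>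
     (\<exists>x. dim_row x = b \<and> B * (F * u) = B ^\<^sub>m i * x) \<and> (\<exists>x. dim_row x = b' \<and> B' * (F' * v) = B' ^\<^sub>m i * x)"
    using dX uv by (intro range_dsum) simp_all
  show "height_space j i (tsum X Y) (vcat u v) \<longleftrightarrow> height_space j i X u \<and> height_space j i Y v"
    unfolding eq tsum.simps height_space.simps 1 2 3 using * ** dX by auto
qed

lemma range_J_pow:
  fixes v :: "'k :: field mat"
  assumes "dim_row v = m"
  shows "(\<exists>x. dim_row x = m \<and> v = J m ^\<^sub>m j * x) \<longleftrightarrow> (\<forall>k < m. \<forall>c < dim_col v. k + j < m \<or> v $$ (k, c) = 0)"
proof -
  have J: "(J m ^\<^sub>m j * x) $$ (k, c) = (if k + j < m then x $$ (k + j, c) else 0)"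
    if "dim_row x = m" "k < m" "c < dim_col x" for x :: "'k mat" and k c
  proof -
    have "(J m ^\<^sub>m j * x) $$ (k, c) = (\<Sum>l = 0..<m. (J m ^\<^sub>m j) $$ (k, l) * x $$ (l, c))"
      using that by (simp add: scalar_prod_def)
    also have "\<dots> = (\<Sum>l = 0..<m. if l = k + j then x $$ (l, c) else 0)"
      using that by (intro sum.cong refl) (auto simp: index_J_pow)
    finally show ?thesis by simp
  qed
  show ?thesis
  proof
    assume "\<exists>x. dim_row x = m \<and> v = J m ^\<^sub>m j * x"
    then obtain x where x: "dim_row x = m" "v = J m ^\<^sub>m j * x" by blast
    show "\<forall>k < m. \<forall>c < dim_col v. k + j < m \<or> v $$ (k, c) = 0"
    proof (intro allI impI)
      fix k c assume "k < m" "c < dim_col v"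
      then show "k + j < m \<or> v $$ (k, c) = 0" using x J[OF x(1), of k c] by (simp del: index_mult_mat(1))
    qed
  next
    assume *: "\<forall>k < m. \<forall>c < dim_col v. k + j < m \<or> v $$ (k, c) = 0"
    let ?x = "mat m (dim_col v) (\<lambda>(k, c). if j \<le> k then v $$ (k - j, c) else 0)"
    have "v = J m ^\<^sub>m j * ?x"
    proof (rule eq_matI)
      fix k c assume "k < dim_row (J m ^\<^sub>m j * ?x)" "c < dim_col (J m ^\<^sub>m j * ?x)"
      then show "v $$ (k, c) = (J m ^\<^sub>m j * ?x) $$ (k, c)" using * by (subst J) auto
    qed (use assms in auto)
    then show "\<exists>x. dim_row x = m \<and> v = J m ^\<^sub>m j * x" by (intro exI[of _ ?x]) simp
  qed
qed

text \<open>
  In both cases the first summand counts \<open>T u\<close> (or the generator of \<open>P\<^sub>1\<^sup>m\<close>), and the second the generator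
  \<open>u\<close>. So \<open>P\<^sub>2\<^sup>m\<close> behaves like a bipicket with \<open>r = m - 1\<close>, in accordance with its contributing the arc
  \<open>(m, m - 1)\<close> when it is paired.
\<close>

fun height_dim :: "nat \<Rightarrow> nat \<Rightarrow> indec \<Rightarrow> nat" where
  "height_dim j i (Picket l m) = of_bool (1 \<le> l \<and> j < m) + of_bool (l = 2 \<and> j + 1 < m \<and> i < m)"
| "height_dim j i (Bipicket m r) = of_bool (j < m) + of_bool (j < r \<and> i < m)"

text \<open>
  In the standard bases, membership of \<open>F u\<close> and \<open>B F u\<close> in the images of powers of a Jordan block means
  that certain coordinates vanish, so the subspace is a coordinate subspace.
\<close>

lemma height_dim_indec:
  assumes "valid_indec x"
  shows "has_dim (sub_dim x) (height_space j i (indec_triple x :: 'k :: field triple)) (height_dim j i x)"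
proof (cases x)
  case (Picket l m)
  have lm: "l \<le> m" "1 \<le> m" "l \<le> 2" using assms Picket by auto
  let ?p = "\<lambda>t. t + j < m \<and> (t = 0 \<or> i < m)"
  have "has_dim l (height_space j i (indec_triple x :: 'k triple)) (length (filter ?p [0..<l]))"
  proof (rule has_dim_coordinate)
    fix u :: "'k mat" assume u: "dim_row u = l"
    have c: "(unit_mat m l * u) $$ (k, c) = (if k < l then u $$ (k, c) else 0)" if "k < m" "c < dim_col u" for k c
      using that u by (rule_tac index_unit_mat_mult)
    have e: "(J m * (unit_mat m l * u)) $$ (k, c) = (if Suc k < l then u $$ (Suc k, c) else 0)" if "k < m" "c < dim_col u" for k c
      using that u lm c[of "Suc k" c] by (subst index_J_mult) (auto simp del: index_mult_mat(1))
    have "height_space j i (indec_triple x) u \<longleftrightarrow>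
       (\<forall>k < m. \<forall>c < dim_col u. k + j < m \<or> (unit_mat m l * u) $$ (k, c) = 0) \<and>
       (\<forall>k < m. \<forall>c < dim_col u. k + i < m \<or> (J m * (unit_mat m l * u)) $$ (k, c) = 0)"
      using lm unfolding Picket indec_triple_Picket[OF lm(1)] height_space.simps
      using range_J_pow[of "unit_mat m l * u" m j] range_J_pow[of "J m * (unit_mat m l * u)" m i] by simp
    also have "\<dots> \<longleftrightarrow> (\<forall>k < l. \<forall>c < dim_col u. k + j < m \<or> u $$ (k, c) = 0) \<and>
       (\<forall>k < m. \<forall>c < dim_col u. k + i < m \<or> \<not> Suc k < l \<or> u $$ (Suc k, c) = 0)"
      using lm c e by (smt (verit, best) less_le_trans)
    also have "\<dots> \<longleftrightarrow> (\<forall>t<l. \<forall>c<dim_col u. ?p t \<or> u $$ (t, c) = 0)"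
    proof -
      have "(\<forall>k < m. \<forall>c < dim_col u. k + i < m \<or> \<not> Suc k < l \<or> u $$ (Suc k, c) = 0) \<longleftrightarrow>
         (\<forall>t<l. \<forall>c<dim_col u. t = 0 \<or> i < m \<or> u $$ (t, c) = 0)"
      proof
        assume *: "\<forall>k < m. \<forall>c < dim_col u. k + i < m \<or> \<not> Suc k < l \<or> u $$ (Suc k, c) = 0"
        show "\<forall>t<l. \<forall>c<dim_col u. t = 0 \<or> i < m \<or> u $$ (t, c) = 0"
        proof (intro allI impI)
          fix t c assume "t < l" "c < dim_col u"
          then show "t = 0 \<or> i < m \<or> u $$ (t, c) = 0" using *[rule_format, of "t - 1" c] lm by (cases t) auto
        qed
      next
        assume *: "\<forall>t<l. \<forall>c<dim_col u. t = 0 \<or> i < m \<or> u $$ (t, c) = 0"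
        show "\<forall>k < m. \<forall>c < dim_col u. k + i < m \<or> \<not> Suc k < l \<or> u $$ (Suc k, c) = 0"
        proof (intro allI impI)
          fix k c assume "k < m" "c < dim_col u"
          then show "k + i < m \<or> \<not> Suc k < l \<or> u $$ (Suc k, c) = 0" using *[rule_format, of "Suc k" c] lm by (cases k) auto
        qed
      qed
      then show ?thesis by blast
    qed
    finally show "height_space j i (indec_triple x) u \<longleftrightarrow> (\<forall>t<l. \<forall>c<dim_col u. ?p t \<or> u $$ (t, c) = 0)" .
  qed
  moreover have "length (filter ?p [0..<l]) = height_dim j i x"
    using lm Picket by (cases "l = 0"; cases "l = 1"; cases "l = 2") (auto simp: numeral_2_eq_2)
  ultimately show ?thesis using Picket by simp
next
  case (Bipicket m r)
  have mr: "1 \<le> r" "r + 2 \<le> m" using assms Bipicket by auto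
  let ?p = "\<lambda>t. if t = 0 then j < m else j < r \<and> i < m"
  have "has_dim 2 (height_space j i (indec_triple x :: 'k triple)) (length (filter ?p [0..<2]))"
  proof (rule has_dim_coordinate)
    fix u :: "'k mat" assume u: "dim_row u = 2"
    let ?v = "unit_mat m 2 * u" and ?w = "socle_mat r * u"
    have c: "?v $$ (k, c) = (if k < 2 then u $$ (k, c) else 0)" if "k < m" "c < dim_col u" for k c
      using that u by (rule_tac index_unit_mat_mult)
    have c': "?w $$ (k, c) = (if k = 0 then u $$ (1, c) else 0)" if "k < r" "c < dim_col u" for k c
      using that u by (rule_tac index_socle_mat_mult)
    have e: "(J m * ?v) $$ (k, c) = (if k = 0 then u $$ (1, c) else 0)" if "k < m" "c < dim_col u" for k c
      using that u mr c[of "Suc k" c] by (subst index_J_mult) (auto simp del: index_mult_mat(1))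
    have e': "(J r * ?w) $$ (k, c) = 0" if "k < r" "c < dim_col u" for k c
      using that u mr c'[of "Suc k" c] by (subst index_J_mult) (auto simp del: index_mult_mat(1))
    have F: "vcat (unit_mat m 2) (socle_mat r) * u = vcat ?v ?w" using u by (simp add: vcat_mult)
    have BF: "dsum (J m) (J r) * vcat ?v ?w = vcat (J m * ?v) (J r * ?w)" by (simp add: dsum_mult_vcat)
    have pow: "dsum (J m) (J r :: 'k mat) ^\<^sub>m k = dsum (J m ^\<^sub>m k) (J r ^\<^sub>m k)" for k by (simp add: dsum_pow)
    have "height_space j i (indec_triple x) u \<longleftrightarrow>
       (\<exists>x. dim_row x = m \<and> ?v = J m ^\<^sub>m j * x) \<and> (\<exists>x. dim_row x = r \<and> ?w = J r ^\<^sub>m j * x) \<and>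
       (\<exists>x. dim_row x = m \<and> J m * ?v = J m ^\<^sub>m i * x) \<and> (\<exists>x. dim_row x = r \<and> J r * ?w = J r ^\<^sub>m i * x)"
      unfolding Bipicket indec_triple_Bipicket[OF mr] height_space.simps F BF pow
      using range_dsum[of ?v "J m ^\<^sub>m j" ?w "J r ^\<^sub>m j" m r] range_dsum[of "J m * ?v" "J m ^\<^sub>m i" "J r * ?w" "J r ^\<^sub>m i" m r] by simp
    also have "\<dots> \<longleftrightarrow> (\<forall>k < m. \<forall>c < dim_col u. k + j < m \<or> ?v $$ (k, c) = 0) \<and>
       (\<forall>k < r. \<forall>c < dim_col u. k + j < r \<or> ?w $$ (k, c) = 0) \<and>
       (\<forall>k < m. \<forall>c < dim_col u. k + i < m \<or> (J m * ?v) $$ (k, c) = 0) \<and>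
       (\<forall>k < r. \<forall>c < dim_col u. k + i < r \<or> (J r * ?w) $$ (k, c) = 0)"
      by (subst (1 2 3 4) range_J_pow) simp_all
    also have "\<dots> \<longleftrightarrow> (\<forall>k < m. \<forall>c < dim_col u. k + j < m \<or> \<not> k < 2 \<or> u $$ (k, c) = 0) \<and>
       (\<forall>k < r. \<forall>c < dim_col u. k + j < r \<or> k \<noteq> 0 \<or> u $$ (1, c) = 0) \<and>
       (\<forall>k < m. \<forall>c < dim_col u. k + i < m \<or> k \<noteq> 0 \<or> u $$ (1, c) = 0)"
    proof -
      have 1: "(\<forall>k < m. \<forall>c < dim_col u. k + j < m \<or> ?v $$ (k, c) = 0) \<longleftrightarrow>
          (\<forall>k < m. \<forall>c < dim_col u. k + j < m \<or> \<not> k < 2 \<or> u $$ (k, c) = 0)"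
        by (intro all_cong) (auto simp: c simp del: index_mult_mat(1))
      have 2: "(\<forall>k < r. \<forall>c < dim_col u. k + j < r \<or> ?w $$ (k, c) = 0) \<longleftrightarrow>
          (\<forall>k < r. \<forall>c < dim_col u. k + j < r \<or> k \<noteq> 0 \<or> u $$ (1, c) = 0)"
        by (intro all_cong) (auto simp: c' simp del: index_mult_mat(1))
      have 3: "(\<forall>k < m. \<forall>c < dim_col u. k + i < m \<or> (J m * ?v) $$ (k, c) = 0) \<longleftrightarrow>
          (\<forall>k < m. \<forall>c < dim_col u. k + i < m \<or> k \<noteq> 0 \<or> u $$ (1, c) = 0)"
        by (intro all_cong) (auto simp: e simp del: index_mult_mat(1))
      have 4: "\<forall>k < r. \<forall>c < dim_col u. k + i < r \<or> (J r * ?w) $$ (k, c) = 0"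
        using e' by blast
      show ?thesis unfolding 1 2 3 eqTrueI[OF 4] by (simp only: simp_thms)
    qed
    also have "\<dots> \<longleftrightarrow> (\<forall>c < dim_col u. (j < m \<or> u $$ (0, c) = 0) \<and> (1 + j < m \<or> u $$ (1, c) = 0)) \<and>
       (\<forall>c < dim_col u. j < r \<or> u $$ (1, c) = 0) \<and> (\<forall>c < dim_col u. i < m \<or> u $$ (1, c) = 0)"
    proof -
      have "(\<forall>k < m. \<forall>c < dim_col u. k + j < m \<or> \<not> k < 2 \<or> u $$ (k, c) = 0) \<longleftrightarrow>
        (\<forall>c < dim_col u. (j < m \<or> u $$ (0, c) = 0) \<and> (1 + j < m \<or> u $$ (1, c) = 0))"
      proof
        assume *: "\<forall>k < m. \<forall>c < dim_col u. k + j < m \<or> \<not> k < 2 \<or> u $$ (k, c) = 0"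
        from *[rule_format, of 0] *[rule_format, of 1] mr
        show "\<forall>c < dim_col u. (j < m \<or> u $$ (0, c) = 0) \<and> (1 + j < m \<or> u $$ (1, c) = 0)" by simp
      next
        assume *: "\<forall>c < dim_col u. (j < m \<or> u $$ (0, c) = 0) \<and> (1 + j < m \<or> u $$ (1, c) = 0)"
        show "\<forall>k < m. \<forall>c < dim_col u. k + j < m \<or> \<not> k < 2 \<or> u $$ (k, c) = 0"
        proof (intro allI impI)
          fix k c assume "k < m" "c < dim_col u"
          with *[rule_format, of c] show "k + j < m \<or> \<not> k < 2 \<or> u $$ (k, c) = 0"
            by (cases "k < 2") (auto simp: less_2_cases_iff)
        qed
      qed
      moreover have "(\<forall>k < n. \<forall>c < dim_col u. k + q < n \<or> k \<noteq> 0 \<or> u $$ (1, c) = 0) \<longleftrightarrow>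
        (\<forall>c < dim_col u. q < n \<or> u $$ (1, c) = 0)" if "0 < n" for n q :: nat
      proof
        assume *: "\<forall>k < n. \<forall>c < dim_col u. k + q < n \<or> k \<noteq> 0 \<or> u $$ (1, c) = 0"
        from *[THEN spec[of _ 0]] that show "\<forall>c < dim_col u. q < n \<or> u $$ (1, c) = 0" by simp
      qed auto
      ultimately show ?thesis using mr by simp
    qed
    also have "\<dots> \<longleftrightarrow> (\<forall>t<2. \<forall>c<dim_col u. ?p t \<or> u $$ (t, c) = 0)"
    proof -
      have "(\<forall>t<2. \<forall>c<dim_col u. ?p t \<or> u $$ (t, c) = 0) \<longleftrightarrow>
         (\<forall>c<dim_col u. j < m \<or> u $$ (0, c) = 0) \<and> (\<forall>c<dim_col u. (j < r \<and> i < m) \<or> u $$ (1, c) = 0)"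
        by (simp add: numeral_2_eq_2 All_less_Suc conj_commute)
      then show ?thesis using mr by auto
    qed
    finally show "height_space j i (indec_triple x) u \<longleftrightarrow> (\<forall>t<2. \<forall>c<dim_col u. ?p t \<or> u $$ (t, c) = 0)" .
  qed
  moreover have "length (filter ?p [0..<2]) = height_dim j i x"
    using Bipicket by (auto simp: numeral_2_eq_2)
  ultimately show ?thesis using Bipicket by simp
qed

lemma height_dim_direct_sum:
  assumes "\<forall>x\<in>set xs. valid_indec x"
  shows "has_dim (sum_list (map sub_dim xs)) (height_space j i (direct_sum (map indec_triple xs) :: 'k :: field triple))
     (sum_list (map (height_dim j i) xs))"
  using assms
proof (induction xs)
  case Nil
  have "height_space j i (direct_sum [] :: 'k triple) u" if "dim_row u = 0" for u :: "'k mat"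
    unfolding direct_sum_Nil height_space.simps using that
    by (intro conjI exI[of _ "0\<^sub>m 0 (dim_col u)"]) (auto intro!: eq_matI)
  then have "has_dim 0 (height_space j i (direct_sum [] :: 'k triple)) 0"
    using has_dim_coordinate[of 0 "height_space j i (direct_sum [] :: 'k triple)" "\<lambda>_. True"] by simp
  then show ?case by simp
next
  case (Cons x xs)
  have "(indec_triple x :: 'k triple) \<in> triple_space (sub_dim x) (sum_list (jordan_sizes x))"
    using s2_triple_indec[of x, where 'k = 'k] Cons.prems by (simp add: s2_triple_def)
  from height_space_tsum[OF this direct_sum_triple_space[of xs] height_dim_indec Cons.IH] Cons.prems
  show ?case by (simp add: direct_sum_Cons)
qed

lemma decomposes_as_height_dim:
  fixes X :: "'k :: field triple"
  assumes "decomposes_as X xs" "X \<in> triple_space a b"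
  shows "has_dim a (height_space j i X) (sum_list (map (height_dim j i) xs))"
proof -
  have v: "\<forall>x\<in>set xs. valid_indec x" and iso: "isomorphic X (direct_sum (map indec_triple xs))"
    using assms(1) by (auto simp: decomposes_as_def)
  note sp = direct_sum_triple_space[OF v, where 'k = 'k]
  have "sum_list (map sub_dim xs) = a" "sum_list (map (sum_list \<circ> jordan_sizes) xs) = b"
    using isomorphic_dims[OF iso assms(2) sp] by auto
  with height_space_isomorphic[OF isomorphic_sym[OF iso] _ assms(2)] sp height_dim_direct_sum[OF v, where 'k = 'k]
  show ?thesis by simp
qed

text \<open>
  The matrix of the linear system \<open>F u = B\<^sup>j x\<close>, \<open>B F u = B\<^sup>i y\<close> in the unknowns \<open>u, x, y\<close>, up to signs.
\<close>

definition height_mat :: "nat \<Rightarrow> nat \<Rightarrow> 'k :: field triple \<Rightarrow> 'k mat" where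
  "height_mat j i X = (case X of (A, F, B) \<Rightarrow> hcat (vcat F (B * F)) (dsum (B ^\<^sub>m j) (B ^\<^sub>m i)))"

lemma rank_height_mat:
  fixes A :: "'k :: field mat"
  assumes X: "(A, F, B) \<in> triple_space a b" and d: "has_dim a (height_space j i (A, F, B)) d"
    and s: "is_rank (dsum (B ^\<^sub>m j) (B ^\<^sub>m i)) s"
  shows "is_rank (height_mat j i (A, F, B)) (a - d + s)"
proof -
  note dX = X[unfolded triple_space_iff]
  have "has_dim a (\<lambda>u. \<exists>x. dim_row x = dim_col (dsum (B ^\<^sub>m j) (B ^\<^sub>m i)) \<and> vcat F (B * F) * u = dsum (B ^\<^sub>m j) (B ^\<^sub>m i) * x) d"
  proof (rule has_dim_cong[THEN iffD1, OF _ d])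
    fix u :: "'k mat" assume u: "dim_row u = a"
    have "vcat F (B * F) * u = vcat (F * u) (B * (F * u))" using dX u by (simp add: vcat_mult mult_assoc)
    moreover have "(\<exists>x. dim_row x = b + b \<and> vcat (F * u) (B * (F * u)) = dsum (B ^\<^sub>m j) (B ^\<^sub>m i) * x) \<longleftrightarrow>
      (\<exists>x. dim_row x = b \<and> F * u = B ^\<^sub>m j * x) \<and> (\<exists>x. dim_row x = b \<and> B * (F * u) = B ^\<^sub>m i * x)"
      using dX u by (intro range_dsum) simp_all
    moreover have "dim_col (dsum (B ^\<^sub>m j) (B ^\<^sub>m i)) = b + b" "dim_row B = b" using dX by simp_all
    ultimately show "height_space j i (A, F, B) u \<longleftrightarrow>
      (\<exists>x. dim_row x = dim_col (dsum (B ^\<^sub>m j) (B ^\<^sub>m i)) \<and> vcat F (B * F) * u = dsum (B ^\<^sub>m j) (B ^\<^sub>m i) * x)"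
      by (simp only: height_space.simps)
  qed
  then show ?thesis unfolding height_mat_def split using dX s by (intro rank_hcat) simp_all
qed

section \<open>The summands are determined by the invariants\<close>

definition size_mset :: "indec list \<Rightarrow> nat multiset" where
  "size_mset xs = mset (concat (map jordan_sizes xs))"

lemma mset_concat_map: "mset (concat (map f xs)) = (\<Sum>x\<in>#mset xs. mset (f x))"
  by (induction xs) auto

text \<open>
  The summands \<open>P\<^sub>0\<^sup>m\<close>, which no invariant of the submodule can see, are what remains of the Jordan type
  after the other summands have been removed.
\<close>

lemma mset_eq_if_proper_summands_eq:
  assumes v: "\<forall>x\<in>set xs. valid_indec x" "\<forall>x\<in>set ys. valid_indec x"
    and proper: "filter_mset (\<lambda>x. 0 < sub_dim x) (mset xs) = filter_mset (\<lambda>x. 0 < sub_dim x) (mset ys)"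
    and size: "size_mset xs = size_mset ys"
  shows "mset xs = mset ys"
proof -
  let ?S = "\<lambda>M. \<Sum>x\<in>#M. mset (jordan_sizes x)"
  have part: "M = filter_mset (\<lambda>x. 0 < sub_dim x) M + filter_mset (\<lambda>x. \<not> 0 < sub_dim x) M" for M
    by (rule multiset_partition)
  have zero: "filter_mset (\<lambda>x. \<not> 0 < sub_dim x) (mset zs) = image_mset (Picket 0) (?S (filter_mset (\<lambda>x. \<not> 0 < sub_dim x) (mset zs)))" for zs
  proof (induction zs)
    case (Cons z zs)
    then show ?case by (cases z) auto
  qed simp
  have "?S (mset xs) = ?S (mset ys)" using size by (simp add: size_mset_def mset_concat_map)
  then have "?S (filter_mset (\<lambda>x. \<not> 0 < sub_dim x) (mset xs)) = ?S (filter_mset (\<lambda>x. \<not> 0 < sub_dim x) (mset ys))"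
    by (subst (asm) (1 2) part) (simp only: image_mset_union sum_mset.union proper add_left_cancel)
  then have "filter_mset (\<lambda>x. \<not> 0 < sub_dim x) (mset xs) = filter_mset (\<lambda>x. \<not> 0 < sub_dim x) (mset ys)"
    by (subst (1 2) zero) simp
  with proper show ?thesis using part by metis
qed

lemma in_size_mset: "x \<in> set xs \<Longrightarrow> m \<in> set (jordan_sizes x) \<Longrightarrow> m \<in># size_mset xs"
  by (auto simp: size_mset_def)

fun top_size :: "indec \<Rightarrow> nat" where
  "top_size (Picket l m) = m"
| "top_size (Bipicket m r) = m"

lemma int_count_mset: "int (count (mset xs) x) = (\<Sum>y\<leftarrow>xs. of_bool (y = x))"
  by (induction xs) auto

text \<open>
  A multiset of pairs \<open>(m, r)\<close> is determined by the numbers of its members with \<open>m > i\<close> and \<open>r > j\<close>, and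
  these are differences of sums of \<open>height_dim\<close>; the summands \<open>P\<^sub>1\<^sup>m\<close> are found from the rest. As no block is larger than \<open>b\<close>, indices up to
  \<open>b\<close> suffice, which keeps the number of rank conditions finite.
\<close>

lemma mset_eq_if_height_dims_eq:
  assumes v: "\<forall>x\<in>set xs. valid_indec x" "\<forall>x\<in>set ys. valid_indec x"
    and size: "size_mset xs = size_mset ys" and b: "\<forall>m \<in># size_mset xs. m \<le> b"
    and h: "\<And>j i. j \<le> b \<Longrightarrow> i \<le> b \<Longrightarrow> sum_list (map (height_dim j i) xs) = sum_list (map (height_dim j i) ys)"
  shows "mset xs = mset ys"
proof (rule mset_eq_if_proper_summands_eq[OF v _ size], rule multiset_eqI)
  fix x
  have bd: "top_size y \<le> b" if "y \<in> set xs \<union> set ys" for y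
    using that b size in_size_mset[of y xs "top_size y"] in_size_mset[of y ys "top_size y"] by (cases y) auto
  define h' where "h' j i y = int (height_dim j i y)" for j i y
  have H: "(\<Sum>y\<leftarrow>xs. h' j i y) = (\<Sum>y\<leftarrow>ys. h' j i y)" if "j \<le> b" "i \<le> b" for j i
  proof -
    have "int (sum_list (map f zs)) = (\<Sum>y\<leftarrow>zs. int (f y))" for f and zs :: "indec list" by (induction zs) auto
    then show ?thesis unfolding h'_def using h[OF that] by metis
  qed
  \<comment> \<open>at \<open>i = b\<close> only the first summand of \<open>height_dim\<close> is left, so \<open>D j i y\<close> is the second one\<close>
  define D where "D j i y = h' j i y - h' j b y" for j i y
  have HD: "(\<Sum>y\<leftarrow>xs. D j i y) = (\<Sum>y\<leftarrow>ys. D j i y)" if "j \<le> b" "i \<le> b" for j i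
    unfolding D_def sum_list_subtractf using H that by simp
  have count: "count (mset xs) x = count (mset ys) x" if "\<And>y. y \<in> set xs \<union> set ys \<Longrightarrow> of_bool (y = x) = f y"
    "(\<Sum>y\<leftarrow>xs. f y) = (\<Sum>y\<leftarrow>ys. f y)" for f :: "indec \<Rightarrow> int"
  proof -
    have "(\<Sum>y\<leftarrow>xs. of_bool (y = x)) = (\<Sum>y\<leftarrow>xs. f y)" using that(1) by (intro arg_cong[of _ _ sum_list] map_cong) auto
    moreover have "(\<Sum>y\<leftarrow>ys. of_bool (y = x)) = (\<Sum>y\<leftarrow>ys. f y)" using that(1) by (intro arg_cong[of _ _ sum_list] map_cong) auto
    ultimately have "int (count (mset xs) x) = int (count (mset ys) x)" unfolding int_count_mset using that(2) by simp
    then show ?thesis by simp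
  qed
  \<comment> \<open>inclusion-exclusion at the corner \<open>(r, m)\<close>; a picket \<open>P\<^sub>2\<^sup>m\<close> counts as the pair \<open>(m, m - 1)\<close>\<close>
  have corner: "count (mset xs) x = count (mset ys) x" if x: "x \<in> set xs \<union> set ys" and mr: "1 \<le> m" "1 \<le> r" "m \<le> b" "r \<le> b"
     and f: "\<And>y. y \<in> set xs \<union> set ys \<Longrightarrow> y = x \<longleftrightarrow>
       (case y of Picket l m' \<Rightarrow> l = 2 \<and> m' = m \<and> m' = r + 1 | Bipicket m' r' \<Rightarrow> m' = m \<and> r' = r)" for m r
  proof (rule count)
    show "of_bool (y = x) = D (r - 1) (m - 1) y - D r (m - 1) y - D (r - 1) m y + D r m y" if y: "y \<in> set xs \<union> set ys" for y
      using bd[OF y] mr unfolding f[OF y] D_def h'_def by (cases y) (auto simp: of_bool_def)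
    show "(\<Sum>y\<leftarrow>xs. D (r - 1) (m - 1) y - D r (m - 1) y - D (r - 1) m y + D r m y) =
      (\<Sum>y\<leftarrow>ys. D (r - 1) (m - 1) y - D r (m - 1) y - D (r - 1) m y + D r m y)"
      unfolding sum_list_subtractf sum_list_addf using HD mr by simp
  qed
  show "count (filter_mset (\<lambda>x. 0 < sub_dim x) (mset xs)) x = count (filter_mset (\<lambda>x. 0 < sub_dim x) (mset ys)) x"
  proof (cases "x \<in> set xs \<union> set ys \<and> 0 < sub_dim x")
    case False
    then show ?thesis by (auto simp: count_eq_zero_iff[THEN iffD2] not_in_iff)
  next
    case True
    then have x: "x \<in> set xs \<union> set ys" "0 < sub_dim x" "valid_indec x" using v by auto
    have vy: "valid_indec y" if "y \<in> set xs \<union> set ys" for y using v that by auto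
    have "count (mset xs) x = count (mset ys) x"
    proof (cases x)
      case (Bipicket m r)
      then show ?thesis using x bd[OF x(1)] vy
        by (intro corner[of m r]) (auto split: indec.splits)
    next
      case (Picket l m)
      then consider "l = 2" | "l = 1" using x by force
      then show ?thesis
      proof cases
        case 1
        show ?thesis using 1 Picket x bd[OF x(1)]
          by (intro corner[of m "m - 1"]) (use vy in \<open>force split: indec.splits\<close>)+
      next
        case 2
        have m: "1 \<le> m" "m \<le> b" using Picket x bd[OF x(1)] by auto
        show ?thesis
        proof (rule count)
          \<comment> \<open>as \<open>r \<ge> 1\<close>, \<open>D 0 j\<close> counts all summands with \<open>T u \<noteq> 0\<close> and \<open>m > j\<close>, which leaves \<open>P\<^sub>1\<^sup>m\<close>\<close>
          show "of_bool (y = x) = (h' (m - 1) b y - D 0 (m - 1) y) - (h' m b y - D 0 m y)" if y: "y \<in> set xs \<union> set ys" for y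
            using bd[OF y] m vy[OF y] 2 Picket unfolding D_def h'_def by (cases y) (auto simp: of_bool_def)
          show "(\<Sum>y\<leftarrow>xs. (h' (m - 1) b y - D 0 (m - 1) y) - (h' m b y - D 0 m y)) =
            (\<Sum>y\<leftarrow>ys. (h' (m - 1) b y - D 0 (m - 1) y) - (h' m b y - D 0 m y))"
            unfolding sum_list_subtractf using HD H m by simp
        qed
      qed
    qed
    then show ?thesis by simp
  qed
qed

text \<open>
  An arc \<open>(m, r)\<close> comes from a bipicket if \<open>r \<le> m - 2\<close> and from a pair of pickets if \<open>r = m - 1\<close>. So the
  diagram gives the bipickets, and it gives the summands \<open>P\<^sub>2\<^sup>s\<close> as the loops together with the paired ones.
\<close>

lemma mset_eq_if_diagram_eq:
  assumes v: "\<forall>x\<in>set xs. valid_indec x" "\<forall>x\<in>set ys. valid_indec x"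
    and size: "size_mset xs = size_mset ys" and diagram: "diagram_of xs = diagram_of ys"
  shows "mset xs = mset ys"
proof (rule mset_eq_if_proper_summands_eq[OF v _ size])
  define P2 where "P2 zs = mset [m. Picket l m \<leftarrow> zs, l = 2]" for zs
  define P1 where "P1 zs = mset [m. Picket l m \<leftarrow> zs, l = 1]" for zs
  define P0 where "P0 zs = mset [m + 1. Picket l m \<leftarrow> zs, l = 0]" for zs
  define Bs where "Bs zs = mset [(m, r). Bipicket m r \<leftarrow> zs]" for zs
  have dg: "diagram_of zs = Arc_Diagram (Bs zs + image_mset (\<lambda>s. (s, s - 1)) (P2 zs \<inter># P0 zs)) (P1 zs) (P2 zs - P2 zs \<inter># P0 zs)" for zs
    unfolding diagram_of_def P2_def P1_def P0_def Bs_def Let_def by (rule refl)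
  have Bs: "filter_mset (\<lambda>(m, r). r + 2 \<le> m) (Bs zs) = Bs zs" if "\<forall>x\<in>set zs. valid_indec x" for zs
    using that by (induction zs) (auto simp: Bs_def split: indec.splits)
  have arcs: "filter_mset (\<lambda>(m, r). r + 2 \<le> m) (image_mset (\<lambda>s. (s, s - 1)) M) = {#}" for M :: "nat multiset"
    by (induction M) auto
  have bip: "Bs zs = filter_mset (\<lambda>(m, r). r + 2 \<le> m) (arcs (diagram_of zs))" if "\<forall>x\<in>set zs. valid_indec x" for zs
    unfolding dg arc_diagram.sel filter_union_mset Bs[OF that] arcs by simp
  have eqB: "Bs xs = Bs ys" using bip[OF v(1)] bip[OF v(2)] diagram by simp
  have fst_arc: "image_mset fst (image_mset (\<lambda>s. (s, s - 1)) M) = M" for M :: "nat multiset"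
    by (induction M) auto
  have paired: "P2 zs \<inter># P0 zs = image_mset fst (arcs (diagram_of zs) - Bs zs)" for zs
    unfolding dg arc_diagram.sel add_diff_cancel_left' fst_arc by (rule refl)
  have "P2 zs = loops (diagram_of zs) + image_mset fst (arcs (diagram_of zs) - Bs zs)" for zs
    unfolding paired[symmetric] unfolding dg arc_diagram.sel by (simp add: multiset_eq_iff min_def)
  then have eqP2: "P2 xs = P2 ys" using diagram eqB by metis
  have eqP1: "P1 xs = P1 ys" using diagram by (simp add: dg)
  have "filter_mset (\<lambda>x. 0 < sub_dim x) (mset zs) =
     image_mset (Picket 2) (P2 zs) + image_mset (Picket 1) (P1 zs) + image_mset (\<lambda>(m, r). Bipicket m r) (Bs zs)"
    if "\<forall>x\<in>set zs. valid_indec x" for zs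
    using that
  proof (induction zs)
    case (Cons z zs)
    show ?case
    proof (cases z)
      case (Picket l m)
      then consider "l = 0" | "l = 1" | "l = 2" using Cons.prems by force
      then show ?thesis using Cons Picket by cases (auto simp: P2_def P1_def Bs_def)
    qed (use Cons in \<open>auto simp: P2_def P1_def Bs_def\<close>)
  qed (auto simp: P2_def P1_def Bs_def)
  then show "filter_mset (\<lambda>x. 0 < sub_dim x) (mset xs) = filter_mset (\<lambda>x. 0 < sub_dim x) (mset ys)"
    using v eqP2 eqP1 eqB by simp
qed

lemma diagram_of_cong: "mset xs = mset ys \<Longrightarrow> diagram_of xs = diagram_of ys"
  unfolding diagram_of_def mset_concat_map by simp

section \<open>Points and objects\<close>

lemma indec_triple_space:
  "valid_indec x \<Longrightarrow> (indec_triple x :: 'k :: field triple) \<in> triple_space (sub_dim x) (sum_list (jordan_sizes x))"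
  using s2_triple_indec[of x, where 'k = 'k] by (simp add: s2_triple_def)

lemma direct_sum_move_to_front:
  assumes "\<forall>y\<in>set (us @ x # vs). valid_indec y"
  shows "isomorphic (direct_sum (map indec_triple (us @ x # vs)) :: 'k :: field triple) (direct_sum (map indec_triple (x # us @ vs)))"
  using assms
proof (induction us)
  case Nil
  show ?case using isomorphic_refl[OF direct_sum_triple_space[OF Nil]] by simp
next
  case (Cons u us)
  have v: "valid_indec u" "valid_indec x" "\<forall>y\<in>set (us @ vs). valid_indec y" "\<forall>y\<in>set (us @ x # vs). valid_indec y"
    using Cons.prems by auto
  let ?D = "\<lambda>xs. direct_sum (map indec_triple xs) :: 'k triple"
  note sp = direct_sum_triple_space[OF v(3), where 'k = 'k] direct_sum_triple_space[OF v(4), where 'k = 'k]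
    indec_triple_space[OF v(1), where 'k = 'k] indec_triple_space[OF v(2), where 'k = 'k]
  have IH: "isomorphic (?D (us @ x # vs)) (tsum (indec_triple x) (?D (us @ vs)))"
    using Cons.IH[OF v(4)] by (simp only: list.map direct_sum_Cons)
  note dims = isomorphic_dims[OF IH sp(2) tsum_triple_space[OF sp(4,1)]]
  have "isomorphic (tsum (indec_triple u) (?D (us @ x # vs))) (tsum (indec_triple u) (tsum (indec_triple x) (?D (us @ vs))))"
    by (rule tsum_cong[OF isomorphic_refl[OF sp(3)] IH sp(3,3,2)]) (use dims tsum_triple_space[OF sp(4,1)] in \<open>simp add: ac_simps\<close>)
  from isomorphic_trans[OF this tsum_left_commute[OF sp(3,4,1)] tsum_triple_space[OF sp(3,2)]
    tsum_triple_space[OF sp(3) tsum_triple_space[OF sp(4,1)]] tsum_triple_space[OF sp(4) tsum_triple_space[OF sp(3,1)]]]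
  show ?case by (simp only: append_Cons list.map direct_sum_Cons)
qed

lemma direct_sum_permute:
  assumes "\<forall>x\<in>set xs. valid_indec x" "mset xs = mset ys"
  shows "isomorphic (direct_sum (map indec_triple xs) :: 'k :: field triple) (direct_sum (map indec_triple ys))"
  using assms
proof (induction xs arbitrary: ys)
  case Nil
  then show ?case using isomorphic_refl[OF direct_sum_triple_space[of "[]"]] by simp
next
  case (Cons x xs)
  have "x \<in> set ys" using Cons.prems(2) by (metis list.set_intros(1) set_mset_mset)
  then obtain us vs where ys: "ys = us @ x # vs" by (meson split_list)
  have m: "mset xs = mset (us @ vs)" using Cons.prems(2) by (simp add: ys)
  have sy: "set ys = set (x # xs)" using Cons.prems(2) by (metis set_mset_mset)
  have v: "valid_indec x" "\<forall>y\<in>set xs. valid_indec y" "\<forall>y\<in>set ys. valid_indec y" "\<forall>y\<in>set (us @ vs). valid_indec y"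
    using Cons.prems(1) sy by (auto simp: ys)
  let ?D = "\<lambda>xs. direct_sum (map indec_triple xs) :: 'k triple"
  note sp = direct_sum_triple_space[OF v(2), where 'k = 'k] direct_sum_triple_space[OF v(4), where 'k = 'k]
    indec_triple_space[OF v(1), where 'k = 'k] direct_sum_triple_space[OF v(3), where 'k = 'k]
  have IH: "isomorphic (?D xs) (?D (us @ vs))" by (rule Cons.IH[OF v(2) m])
  note dims = isomorphic_dims[OF IH sp(1,2)]
  have 1: "isomorphic (tsum (indec_triple x) (?D xs)) (tsum (indec_triple x) (?D (us @ vs)))"
    by (rule tsum_cong[OF isomorphic_refl[OF sp(3)] IH sp(3,3,1)]) (use dims sp(2) in simp)
  have "isomorphic (?D ys) (tsum (indec_triple x) (?D (us @ vs)))"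
    using direct_sum_move_to_front[of us x vs, where 'k = 'k] v(3) unfolding ys by (simp only: list.map direct_sum_Cons)
  from isomorphic_trans[OF 1 isomorphic_sym[OF this] tsum_triple_space[OF sp(3,1)] tsum_triple_space[OF sp(3,2)] sp(4)]
  show ?case by (simp only: list.map direct_sum_Cons)
qed

lemma nil_op_append: "nil_op (\<mu> @ \<nu>) = dsum (nil_op \<mu>) (nil_op \<nu> :: 'k :: field mat)"
proof (induction \<mu>)
  case Nil
  show ?case by (intro eq_matI) (auto simp: nil_op_Nil dsum_def)
qed (simp add: nil_op_Cons dsum_assoc)

lemma operators_of_direct_sum:
  "fst (direct_sum (map indec_triple xs)) = (nil_op (map sub_dim xs) :: 'k :: field mat)"
  "snd (snd (direct_sum (map indec_triple xs))) = (nil_op (concat (map jordan_sizes xs)) :: 'k :: field mat)"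
proof -
  have 1: "fst (tsum X Y) = dsum (fst X) (fst Y)" "snd (snd (tsum X Y)) = dsum (snd (snd X)) (snd (snd Y))"
    for X Y :: "'k triple" by (cases X, cases Y, simp)+
  have 2: "fst (indec_triple x) = (nil_op [sub_dim x] :: 'k mat)" "snd (snd (indec_triple x)) = (nil_op (jordan_sizes x) :: 'k mat)"
    for x by (cases x, simp_all)+
  have 3: "nil_op (sub_dim x # \<mu>) = dsum (nil_op [sub_dim x]) (nil_op \<mu> :: 'k mat)" for x \<mu>
    using nil_op_append[of "[sub_dim x]" \<mu>] by simp
  show "fst (direct_sum (map indec_triple xs)) = (nil_op (map sub_dim xs) :: 'k mat)"
  proof (induction xs)
    case (Cons x xs)
    then show ?case unfolding list.map direct_sum_Cons 1 2 3[of x "map sub_dim xs"] by simp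
  qed (simp add: direct_sum_Nil nil_op_Nil)
  show "snd (snd (direct_sum (map indec_triple xs))) = (nil_op (concat (map jordan_sizes xs)) :: 'k mat)"
    by (induction xs) (simp_all add: direct_sum_Nil nil_op_Nil direct_sum_Cons 1 2 nil_op_append del: indec_triple.simps)
qed

lemma similar_mat_iff_inverse_pair:
  fixes A B :: "'k :: field mat"
  assumes d: "dim_row A = n" "dim_col A = n" "dim_row B = n" "dim_col B = n"
  shows "similar_mat A B \<longleftrightarrow> (\<exists>g g'. inverse_pair n g g' \<and> g * A = B * g)"
proof
  assume "similar_mat A B"
  then obtain P Q where PQ: "{A, B, P, Q} \<subseteq> carrier_mat n n" "P * Q = 1\<^sub>m n" "Q * P = 1\<^sub>m n" "A = P * B * Q"
    using d(1) unfolding similar_mat_def similar_mat_wit_def Let_def by blast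
  then have g: "inverse_pair n Q P" by (auto simp: inverse_pair_def)
  have "Q * A = B * Q" unfolding PQ(4) using d by (simp add: mult_assoc inverse_pairD[OF g])
  with g show "\<exists>g g'. inverse_pair n g g' \<and> g * A = B * g" by blast
next
  assume "\<exists>g g'. inverse_pair n g g' \<and> g * A = B * g"
  then obtain g g' where g: "inverse_pair n g g'" "g * A = B * g" by blast
  have "A = g' * (g * A)" using d by (simp add: inverse_pairD[OF g(1)])
  then have "A = g' * B * g" unfolding g(2) using d by (simp add: mult_assoc inverse_pairD[OF g(1)])
  then show "similar_mat A B"
    using d inverse_pairD(1-6)[OF g(1)] by (intro similar_matI[of A B g' g n]) (auto intro!: carrier_matI)
qed

lemma isomorphic_similar:
  assumes "isomorphic (A, F, B) (A', F', B')" "(A, F, B) \<in> triple_space a b" "(A', F', B') \<in> triple_space a' b'"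
  shows "similar_mat A A'" "similar_mat B B'"
proof -
  obtain g g' h h' where *: "a' = a" "b' = b" "inverse_pair a g g'" "inverse_pair b h h'"
    "g * A = A' * g" "h * B = B' * h" by (rule isomorphicE[OF assms])
  note d = assms(2,3)[unfolded triple_space_iff *(1,2)]
  show "similar_mat A A'" "similar_mat B B'"
    using similar_mat_iff_inverse_pair[of A a A'] similar_mat_iff_inverse_pair[of B b B'] d *(3-) by blast+
qed

lemma nilpotent_type_unique:
  assumes "nilpotent_of_type (B :: 'k :: field mat) \<mu>" "nilpotent_of_type B \<nu>"
  shows "mset \<mu> = mset \<nu>"
proof (rule multiset_eqI)
  fix k
  have z: "0 \<notin> set \<mu>" "0 \<notin> set \<nu>" using assms by (simp_all add: nilpotent_of_type_def jordan_nf_def image_image)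
  show "count (mset \<mu>) k = count (mset \<nu>) k"
  proof (cases "k = 0")
    case True
    then show ?thesis using z by (simp add: count_eq_zero_iff[THEN iffD2])
  next
    case False
    have *: "count (mset \<kappa>) k = length (filter ((=) (k, 0 :: 'k)) (map (\<lambda>m. (m, 0)) \<kappa>))" for \<kappa>
      by (induction \<kappa>) auto
    show ?thesis unfolding *
      using compute_nr_of_jordan_blocks[OF assms(1)[unfolded nilpotent_of_type_def] False]
        compute_nr_of_jordan_blocks[OF assms(2)[unfolded nilpotent_of_type_def] False] by simp
  qed
qed

text \<open>The Jordan type of a direct sum is the union of those of the summands, and Jordan types are unique.\<close>

lemma decomposes_as_size_mset:
  fixes A :: "'k :: field mat"
  assumes "decomposes_as (A, F, B) xs" "(A, F, B) \<in> triple_space a b" "nilpotent_of_type B \<beta>"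
  shows "size_mset xs = mset \<beta>"
proof -
  have v: "\<forall>x\<in>set xs. valid_indec x" and iso: "isomorphic (A, F, B) (direct_sum (map indec_triple xs))"
    using assms(1) by (auto simp: decomposes_as_def)
  obtain A' F' B' where eq: "direct_sum (map indec_triple xs) = (A', F', B' :: 'k mat)" by (cases "direct_sum (map indec_triple xs) :: 'k triple")
  have "similar_mat B B'"
    by (rule isomorphic_similar[OF iso[unfolded eq] assms(2) direct_sum_triple_space[OF v, where 'k = 'k, unfolded eq]])
  moreover have "B' = nil_op (concat (map jordan_sizes xs))" using operators_of_direct_sum(2)[of xs, where 'k = 'k] unfolding eq by simp
  moreover have "0 \<notin> set (jordan_sizes x)" if "x \<in> set xs" for x using v that by (cases x) auto
  ultimately have "nilpotent_of_type B (concat (map jordan_sizes xs))"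
    by (auto simp: nilpotent_of_type_def jordan_nf_def nil_op_def)
  from nilpotent_type_unique[OF this assms(3)] show ?thesis by (simp add: size_mset_def)
qed

lemma inj_mat_iff_vec:
  fixes M :: "'k :: field mat"
  assumes M: "M \<in> carrier_mat n k"
  shows "inj_mat M \<longleftrightarrow> (\<forall>v \<in> carrier_vec k. M *\<^sub>v v = 0\<^sub>v n \<longrightarrow> v = 0\<^sub>v k)"
proof
  assume inj: "inj_mat M"
  show "\<forall>v \<in> carrier_vec k. M *\<^sub>v v = 0\<^sub>v n \<longrightarrow> v = 0\<^sub>v k"
  proof (intro ballI impI)
    fix v assume v: "v \<in> carrier_vec k" "M *\<^sub>v v = 0\<^sub>v n"
    obtain Z where Z: "dim_row Z = dim_col M" "dim_col Z = dim_row M" "Z * M = 1\<^sub>m (dim_col M)" by (rule inj_mat_left_inverse[OF inj])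
    have "v = (Z * M) *\<^sub>v v" using Z v M by simp
    also have "\<dots> = Z *\<^sub>v (M *\<^sub>v v)" using Z M v by (intro assoc_mult_mat_vec[of _ k n _ k]) auto
    also have "\<dots> = 0\<^sub>v k" unfolding v(2) using Z M by (intro eq_vecI) auto
    finally show "v = 0\<^sub>v k" .
  qed
next
  assume *: "\<forall>v \<in> carrier_vec k. M *\<^sub>v v = 0\<^sub>v n \<longrightarrow> v = 0\<^sub>v k"
  show "inj_mat M"
  proof (rule inj_matI)
    fix V assume V: "dim_row V = dim_col M" "M * V = 0\<^sub>m (dim_row M) (dim_col V)"
    show "V = 0\<^sub>m (dim_col M) (dim_col V)"
    proof (rule eq_matI)
      fix i j assume ij: "i < dim_row (0\<^sub>m (dim_col M) (dim_col V) :: 'k mat)" "j < dim_col (0\<^sub>m (dim_col M) (dim_col V) :: 'k mat)"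
      have "M *\<^sub>v col V j = col (M * V) j" using V(1) M ij by (intro eq_vecI) auto
      also have "\<dots> = 0\<^sub>v n" unfolding V(2) using M ij by (intro eq_vecI) auto
      finally have "col V j = 0\<^sub>v k" using * V(1) M by (auto intro!: carrier_vecI)
      then have "col V j $ i = 0" using ij M by simp
      then show "V $$ (i, j) = (0\<^sub>m (dim_col M) (dim_col V) :: 'k mat) $$ (i, j)" using ij V(1) by simp
    qed (use V in auto)
  qed
qed

lemma full_rank_iff_inj_mat:
  fixes M :: "'k :: field mat"
  assumes M: "M \<in> carrier_mat n k"
  shows "vec_space.rank n M = k \<longleftrightarrow> inj_mat M"
proof -
  interpret vec_space "TYPE('k)" n .
  show ?thesis unfolding inj_mat_iff_vec[OF M]
  proof
    assume r: "rank M = k"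
    have "distinct (cols M)"
    proof (rule ccontr)
      assume nd: "\<not> distinct (cols M)"
      obtain S where S: "maximal S (\<lambda>T. T \<subseteq> set (cols M) \<and> lin_indpt T)"
        using maximal_exists[of "(\<lambda>T. T \<subseteq> set (cols M) \<and> lin_indpt T)" "card (set (cols M))" "{}"]
        by (meson List.finite_set card_mono empty_iff empty_subsetI finite_lin_indpt2 rev_finite_subset)
      then have "card S \<le> card (set (cols M))" by (simp add: card_mono maximal_def)
      also have "\<dots> < length (cols M)" using nd by (meson card_distinct card_length le_neq_implies_less)
      finally show False using rank_card_indpt[OF M S] r M by simp
    qed
    then show "\<forall>v \<in> carrier_vec k. M *\<^sub>v v = 0\<^sub>v n \<longrightarrow> v = 0\<^sub>v k"
      using full_rank_lin_indpt[OF M r] lin_depI[OF M] by blast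
  next
    assume *: "\<forall>v \<in> carrier_vec k. M *\<^sub>v v = 0\<^sub>v n \<longrightarrow> v = 0\<^sub>v k"
    have d: "distinct (cols M)"
    proof (rule ccontr)
      assume "\<not> distinct (cols M)"
      then obtain i j where ij: "i < k" "j < k" "i \<noteq> j" "col M i = col M j"
        using M unfolding distinct_conv_nth by auto
      let ?v = "unit_vec k i - unit_vec k j :: 'k vec"
      have "M *\<^sub>v ?v = M *\<^sub>v unit_vec k i - M *\<^sub>v unit_vec k j"
        using M by (intro mult_minus_distrib_mat_vec) auto
      also have "M *\<^sub>v unit_vec k i = col M i" using M ij(1) by (intro eq_vecI) auto
      also have "M *\<^sub>v unit_vec k j = col M j" using M ij(2) by (intro eq_vecI) auto
      also have "col M i - col M j = 0\<^sub>v n" using M ij by simp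
      finally have "?v = 0\<^sub>v k" using * by (auto intro!: carrier_vecI)
      then have "?v $ i = 0" using ij by simp
      then show False using ij by simp
    qed
    show "rank M = k"
    proof (rule lin_indpt_full_rank[OF M d], rule ccontr)
      assume "\<not> lin_indpt (set (cols M))"
      then obtain v where "v \<in> carrier_vec k" "v \<noteq> 0\<^sub>v k" "M *\<^sub>v v = 0\<^sub>v n" using lin_depE[OF M _ d] by blast
      then show False using * by blast
    qed
  qed
qed

text \<open>
  The base change \<open>h'\<close> maps cosets of the image of \<open>F'\<close> to cosets of the image of \<open>F\<close>; composing with
  it turns an isomorphism from the cokernel of \<open>F\<close> into one from the cokernel of \<open>F'\<close>.
\<close>

lemma coker_iso_transport:
  fixes F :: "'k :: field mat"
  assumes d: "dim_row F = b" "dim_col F = a" "dim_row B = b" "dim_col B = b" "dim_row F' = b" "dim_col F' = a" "dim_row B' = b" "dim_col B' = b"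
    and g: "inverse_pair a g g'" and h: "inverse_pair b h h'"
    and F: "F' * g = h * F" and B: "h * B = B' * h" and c: "coker_iso F B \<gamma>"
  shows "coker_iso F' B' \<gamma>"
proof -
  let ?V = "carrier_vec b :: 'k vec set"
  note inv = inverse_pairD(5,6)[OF g] inverse_pairD(5,6)[OF h]
  have F': "F * g' = h' * F'" by (rule intertwiner_inverse[OF F[symmetric] h g, symmetric]) (use d in simp_all)
  have B': "h' * B' = B * h'" by (rule intertwiner_inverse[OF B h h]) (use d in simp_all)
  have car: "F \<in> carrier_mat b a" "F' \<in> carrier_mat b a" "B \<in> carrier_mat b b" "B' \<in> carrier_mat b b"
    "g \<in> carrier_mat a a" "g' \<in> carrier_mat a a" "h \<in> carrier_mat b b" "h' \<in> carrier_mat b b"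
    using d inverse_pairD(1-4)[OF g] inverse_pairD(1-4)[OF h] by (auto intro!: carrier_matI)
  note av = assoc_mult_mat_vec
  have move: "(*\<^sub>v) k' ` im_coset N v = im_coset N' (k' *\<^sub>v v)"
    if "N \<in> carrier_mat b a" "N' \<in> carrier_mat b a" "k' \<in> carrier_mat b b" "l \<in> carrier_mat a a" "l' \<in> carrier_mat a a" "l * l' = 1\<^sub>m a"
       "N' * l = k' * N" "v \<in> ?V" for N N' k' l l' :: "'k mat" and v
  proof -
    have 1: "k' *\<^sub>v (v + N *\<^sub>v u) = k' *\<^sub>v v + N' *\<^sub>v (l *\<^sub>v u)" if u: "u \<in> carrier_vec a" for u
    proof -
      have "k' *\<^sub>v (v + N *\<^sub>v u) = k' *\<^sub>v v + k' *\<^sub>v (N *\<^sub>v u)"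
        using that \<open>N \<in> carrier_mat b a\<close> \<open>k' \<in> carrier_mat b b\<close> \<open>v \<in> ?V\<close> by (intro mult_add_distrib_mat_vec) auto
      also have "k' *\<^sub>v (N *\<^sub>v u) = (k' * N) *\<^sub>v u"
        using \<open>N \<in> carrier_mat b a\<close> \<open>k' \<in> carrier_mat b b\<close> u by (intro av[symmetric]) auto
      also have "\<dots> = N' *\<^sub>v (l *\<^sub>v u)" unfolding \<open>N' * l = k' * N\<close>[symmetric]
        using \<open>N' \<in> carrier_mat b a\<close> \<open>l \<in> carrier_mat a a\<close> u by (intro av) auto
      finally show ?thesis .
    qed
    have 2: "u = l *\<^sub>v (l' *\<^sub>v u)" if u: "u \<in> carrier_vec a" for u
      using av[of l a a l' a u] \<open>l \<in> carrier_mat a a\<close> \<open>l' \<in> carrier_mat a a\<close> \<open>l * l' = 1\<^sub>m a\<close> u by simp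
    show ?thesis
    proof (intro equalityI subsetI)
      fix w assume "w \<in> (*\<^sub>v) k' ` im_coset N v"
      then obtain u where u: "u \<in> carrier_vec a" "w = k' *\<^sub>v (v + N *\<^sub>v u)"
        using \<open>N \<in> carrier_mat b a\<close> by (auto simp: im_coset_def)
      then have "w = k' *\<^sub>v v + N' *\<^sub>v (l *\<^sub>v u)" using 1 by simp
      moreover have "l *\<^sub>v u \<in> carrier_vec (dim_col N')" using \<open>l \<in> carrier_mat a a\<close> \<open>N' \<in> carrier_mat b a\<close> u by auto
      ultimately show "w \<in> im_coset N' (k' *\<^sub>v v)" unfolding im_coset_def by blast
    next
      fix w assume "w \<in> im_coset N' (k' *\<^sub>v v)"
      then obtain u where u: "u \<in> carrier_vec a" "w = k' *\<^sub>v v + N' *\<^sub>v u"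
        using \<open>N' \<in> carrier_mat b a\<close> by (auto simp: im_coset_def)
      have l'u: "l' *\<^sub>v u \<in> carrier_vec a" using \<open>l' \<in> carrier_mat a a\<close> u by auto
      then have "w = k' *\<^sub>v (v + N *\<^sub>v (l' *\<^sub>v u))" using 1 2[OF u(1)] u(2) by simp
      moreover have "v + N *\<^sub>v (l' *\<^sub>v u) \<in> im_coset N v" using l'u \<open>N \<in> carrier_mat b a\<close> by (auto simp: im_coset_def)
      ultimately show "w \<in> (*\<^sub>v) k' ` im_coset N v" by blast
    qed
  qed
  have m1: "(*\<^sub>v) h' ` im_coset F' v = im_coset F (h' *\<^sub>v v)" if "v \<in> ?V" for v
    by (rule move[OF car(2,1,8,6,5) inv(2) F' that])
  have m2: "(*\<^sub>v) h ` im_coset F v = im_coset F' (h *\<^sub>v v)" if "v \<in> ?V" for v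
    by (rule move[OF car(1,2,7,5,6) inv(1) F that])
  have hh: "h *\<^sub>v (h' *\<^sub>v v) = v" "h' *\<^sub>v (h *\<^sub>v v) = v" if "v \<in> ?V" for v
    using av[of h b b h' b v] av[of h' b b h b v] car inv that by auto
  have hV: "h *\<^sub>v v \<in> ?V" "h' *\<^sub>v v \<in> ?V" if "v \<in> ?V" for v using car that by auto
  obtain \<phi> where phi: "bij_betw \<phi> (im_coset F ` ?V) (carrier_vec (sum_list \<gamma>))"
     "\<And>v w. v \<in> ?V \<Longrightarrow> w \<in> ?V \<Longrightarrow> \<phi> (im_coset F (v + w)) = \<phi> (im_coset F v) + \<phi> (im_coset F w)"
     "\<And>c v. v \<in> ?V \<Longrightarrow> \<phi> (im_coset F (c \<cdot>\<^sub>v v)) = c \<cdot>\<^sub>v \<phi> (im_coset F v)"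
     "\<And>v. v \<in> ?V \<Longrightarrow> \<phi> (im_coset F (B *\<^sub>v v)) = nil_op \<gamma> *\<^sub>v \<phi> (im_coset F v)"
    using c unfolding coker_iso_def d by blast
  have bij: "bij_betw ((`) ((*\<^sub>v) h')) (im_coset F' ` ?V) (im_coset F ` ?V)"
  proof (rule bij_betw_byWitness[where f' = "(`) ((*\<^sub>v) h)"])
    show "\<forall>C\<in>im_coset F' ` ?V. (*\<^sub>v) h ` (*\<^sub>v) h' ` C = C" using m1 m2 hh hV by auto
    show "\<forall>C\<in>im_coset F ` ?V. (*\<^sub>v) h' ` (*\<^sub>v) h ` C = C" using m1 m2 hh hV by auto
    show "(`) ((*\<^sub>v) h') ` im_coset F' ` ?V \<subseteq> im_coset F ` ?V" using m1 hV by auto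
    show "(`) ((*\<^sub>v) h) ` im_coset F ` ?V \<subseteq> im_coset F' ` ?V" using m2 hV by auto
  qed
  show ?thesis unfolding coker_iso_def d
  proof (intro exI[of _ "\<phi> \<circ> (`) ((*\<^sub>v) h')"] conjI ballI allI)
    show "bij_betw (\<phi> \<circ> (`) ((*\<^sub>v) h')) (im_coset F' ` ?V) (carrier_vec (sum_list \<gamma>))"
      by (rule bij_betw_trans[OF bij phi(1)])
  next
    fix v w assume v: "v \<in> ?V" and w: "w \<in> ?V"
    have "h' *\<^sub>v (v + w) = h' *\<^sub>v v + h' *\<^sub>v w" using v w car by (intro mult_add_distrib_mat_vec) auto
    then show "(\<phi> \<circ> (`) ((*\<^sub>v) h')) (im_coset F' (v + w)) = (\<phi> \<circ> (`) ((*\<^sub>v) h')) (im_coset F' v) + (\<phi> \<circ> (`) ((*\<^sub>v) h')) (im_coset F' w)"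
      using v w hV by (simp add: m1 phi)
  next
    fix c v assume v: "v \<in> ?V"
    have "h' *\<^sub>v (c \<cdot>\<^sub>v v) = c \<cdot>\<^sub>v (h' *\<^sub>v v)" using v car by (intro mult_mat_vec) auto
    then show "(\<phi> \<circ> (`) ((*\<^sub>v) h')) (im_coset F' (c \<cdot>\<^sub>v v)) = c \<cdot>\<^sub>v (\<phi> \<circ> (`) ((*\<^sub>v) h')) (im_coset F' v)"
      using v hV by (simp add: m1 phi)
  next
    fix v assume v: "v \<in> ?V"
    have "h' *\<^sub>v (B' *\<^sub>v v) = (h' * B') *\<^sub>v v" using v car by (intro av[symmetric]) auto
    also have "\<dots> = B *\<^sub>v (h' *\<^sub>v v)" unfolding B' using v car by (intro av) auto
    finally show "(\<phi> \<circ> (`) ((*\<^sub>v) h')) (im_coset F' (B' *\<^sub>v v)) = nil_op \<gamma> *\<^sub>v (\<phi> \<circ> (`) ((*\<^sub>v) h')) (im_coset F' v)"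
      using v hV car by (simp add: m1 phi)
  qed
qed

lemma nil_op_pow_zero: "\<forall>m \<in> set \<mu>. m \<le> k \<Longrightarrow> nil_op \<mu> ^\<^sub>m k = (0\<^sub>m (sum_list \<mu>) (sum_list \<mu>) :: 'k :: field mat)"
proof (induction \<mu>)
  case Nil
  show ?case by (intro eq_matI) (auto simp: nil_op_Nil)
next
  case (Cons m \<mu>)
  have "dsum (0\<^sub>m m m) (0\<^sub>m (sum_list \<mu>) (sum_list \<mu>)) = (0\<^sub>m (m + sum_list \<mu>) (m + sum_list \<mu>) :: 'k mat)"
    by (simp add: dsum_def)
  then show ?case using Cons by (simp add: nil_op_Cons dsum_pow J_pow_zero)
qed

lemma rep_space_s2_triple:
  fixes x :: "'k :: field triple"
  assumes "x \<in> rep_space \<beta> \<gamma>"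
  shows "s2_triple (sum_list \<beta> - sum_list \<gamma>) (sum_list \<beta>) x"
proof -
  obtain A F B where x: "x = (A, F, B)" by (cases x)
  let ?a = "sum_list \<beta> - sum_list \<gamma>" and ?b = "sum_list \<beta>"
  have *: "(A, F, B) \<in> triple_space ?a ?b" "A * A = 0\<^sub>m ?a ?a" "F * A = B * F" "nilpotent_of_type B \<beta>"
    "vec_space.rank ?b F = ?a" using assms unfolding x rep_space_def Let_def by auto
  have "F \<in> carrier_mat ?b ?a" using *(1) by (simp add: triple_space_def)
  then have inj: "inj_mat F" using full_rank_iff_inj_mat *(5) by blast
  have "similar_mat B (nil_op \<beta>)" using *(4) by (simp add: nilpotent_of_type_def jordan_nf_def nil_op_def)
  then obtain P Q where PQ: "similar_mat_wit B (nil_op \<beta>) P Q" by (auto simp: similar_mat_def)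
  have "\<forall>m\<in>set \<beta>. m \<le> ?b" by (auto intro: member_le_sum_list)
  then have "B ^\<^sub>m ?b = P * 0\<^sub>m ?b ?b * Q" using similar_mat_wit_pow_id[OF PQ, of ?b] by (simp add: nil_op_pow_zero)
  moreover have "P \<in> carrier_mat ?b ?b" "Q \<in> carrier_mat ?b ?b"
    using PQ *(1) unfolding similar_mat_wit_def triple_space_iff Let_def by auto
  ultimately have "B ^\<^sub>m ?b = 0\<^sub>m ?b ?b" by (simp add: mat_simps)
  then show ?thesis using *(1-3) inj unfolding s2_triple_def x by auto
qed

lemma nil_op_remove_zeros: "nil_op (filter (\<lambda>m. m \<noteq> 0) \<mu>) = (nil_op \<mu> :: 'k :: field mat)"
proof (induction \<mu>)
  case (Cons m \<mu>)
  have "dsum (J 0) M = M" for M :: "'k mat" by (intro eq_matI) (auto simp: dsum_def)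
  then show ?case using Cons by (simp add: nil_op_Cons)
qed simp

lemma decomposes_as_cong_mset:
  fixes X :: "'k :: field triple"
  assumes "decomposes_as X xs" "mset xs = mset ys" "X \<in> triple_space a b"
  shows "decomposes_as X ys"
proof -
  have v: "\<forall>x\<in>set xs. valid_indec x" "\<forall>x\<in>set ys. valid_indec x"
    and iso: "isomorphic X (direct_sum (map indec_triple xs))"
    using assms(1) mset_eq_setD[OF assms(2)] by (auto simp: decomposes_as_def)
  show ?thesis unfolding decomposes_as_def using v(2)
     isomorphic_trans[OF iso direct_sum_permute[OF v(1) assms(2)] assms(3) direct_sum_triple_space[OF v(1)] direct_sum_triple_space[OF v(2)]] by blast
qed

lemma decomposes_as_isomorphic:
  fixes X :: "'k :: field triple"
  assumes "isomorphic Y X" "decomposes_as X xs" "X \<in> triple_space a b" "Y \<in> triple_space a' b'"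
  shows "decomposes_as Y xs"
proof -
  have v: "\<forall>x\<in>set xs. valid_indec x" and iso: "isomorphic X (direct_sum (map indec_triple xs))"
    using assms(2) by (auto simp: decomposes_as_def)
  show ?thesis unfolding decomposes_as_def using v
     isomorphic_trans[OF assms(1) iso assms(4,3) direct_sum_triple_space[OF v]] by blast
qed

lemma S2_objects_triple_space:
  assumes "X \<in> S2_objects \<beta> \<gamma>"
  obtains \<alpha> where "X \<in> triple_space (sum_list \<alpha>) (sum_list \<beta>)" "snd (snd X) = nil_op \<beta>"
proof -
  obtain \<alpha> F where X: "X = (nil_op \<alpha>, F, nil_op \<beta>)" "is_mono \<alpha> \<beta> F" using assms unfolding S2_objects_def by blast
  then have "X \<in> triple_space (sum_list \<alpha>) (sum_list \<beta>)" by (auto simp: triple_space_iff is_mono_def)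
  then show thesis using that X(1) by simp
qed

text \<open>
  The operator \<open>B\<close> is similar to the one of \<open>N\<^sub>\<beta>\<close> by assumption. For \<open>A\<close> the partition \<open>\<alpha>\<close> is read off a
  decomposition, with the summands sorted by the dimension of their submodules; conjugating \<open>F\<close> by the
  two base changes gives the object.
\<close>

lemma rep_space_object:
  fixes x :: "'k :: field triple"
  assumes x: "x \<in> rep_space \<beta> \<gamma>"
  obtains X where "X \<in> S2_objects \<beta> \<gamma>" "isomorphic x X"
proof -
  obtain A F B where eq: "x = (A, F, B)" by (cases x)
  define a b where ab: "a = sum_list \<beta> - sum_list \<gamma>" "b = sum_list \<beta>"
  have *: "(A, F, B) \<in> triple_space a b" "F * A = B * F" "nilpotent_of_type B \<beta>" "coker_iso F B \<gamma>"
    using x unfolding eq rep_space_def Let_def ab by auto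
  note d = *(1)[unfolded triple_space_iff]
  have s2: "s2_triple a b (A, F, B)" using rep_space_s2_triple[OF x] unfolding eq ab .
  then have injF: "inj_mat F" by (simp add: s2_triple_def)
  obtain xs where xs: "decomposes_as (A, F, B) xs" using s2_triple_decomposes[OF s2] by blast
  define ys where "ys = rev (sort_key sub_dim xs)"
  have m: "mset xs = mset ys" by (simp add: ys_def)
  have ys: "decomposes_as (A, F, B) ys" by (rule decomposes_as_cong_mset[OF xs m *(1)])
  then have v: "\<forall>x\<in>set ys. valid_indec x" and iso: "isomorphic (A, F, B) (direct_sum (map indec_triple ys))"
    by (auto simp: decomposes_as_def)
  obtain A' F' B' where eq': "direct_sum (map indec_triple ys) = (A', F', B' :: 'k mat)" by (cases "direct_sum (map indec_triple ys) :: 'k triple")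
  define \<alpha> where "\<alpha> = filter (\<lambda>m. m \<noteq> 0) (map sub_dim ys)"
  have A': "A' = nil_op \<alpha>" using operators_of_direct_sum(1)[of ys, where 'k = 'k] unfolding eq' \<alpha>_def nil_op_remove_zeros by simp
  have "sorted_wrt (\<ge>) (map sub_dim ys)"
    unfolding ys_def rev_map[symmetric] sorted_wrt_rev by (metis (mono_tags, lifting) sorted_sort_key sorted_wrt_mono_rel)
  then have "sorted_wrt (\<ge>) \<alpha>" unfolding \<alpha>_def by (rule sorted_wrt_filter)
  then have part: "is_partition \<alpha>" by (auto simp: is_partition_def \<alpha>_def)
  have "sub_dim x \<le> 2" if "valid_indec x" for x using that by (cases x) auto
  then have le2: "\<forall>m\<in>set \<alpha>. m \<le> 2" using v by (auto simp: \<alpha>_def)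
  have "similar_mat A (nil_op \<alpha>)"
    using isomorphic_similar(1)[OF iso[unfolded eq'] *(1) direct_sum_triple_space[OF v, where 'k = 'k, unfolded eq']] A' by simp
  moreover have sum\<alpha>: "sum_list \<alpha> = a"
  proof -
    have "sum_list \<alpha> = sum_list (map sub_dim ys)"
      using arg_cong[OF nil_op_remove_zeros[of "map sub_dim ys", where 'k = 'k], of dim_row] by (simp add: \<alpha>_def)
    then show ?thesis using isomorphic_dims[OF iso *(1) direct_sum_triple_space[OF v]] by simp
  qed
  ultimately obtain g g' where g: "inverse_pair a g g'" "g * A = nil_op \<alpha> * g"
    using similar_mat_iff_inverse_pair[of A a "nil_op \<alpha>"] d by auto
  have "similar_mat B (nil_op \<beta>)" using *(3) by (simp add: nilpotent_of_type_def jordan_nf_def nil_op_def)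
  then obtain h h' where h: "inverse_pair b h h'" "h * B = nil_op \<beta> * h"
    using similar_mat_iff_inverse_pair[of B b "nil_op \<beta>"] d ab(2) by auto
  note dims = d inverse_pairD[OF g(1)] inverse_pairD[OF h(1)] sum\<alpha> ab(2)[symmetric]
  define G where "G = h * F * g'"
  have dG: "dim_row G = b" "dim_col G = a" by (simp_all add: G_def dims)
  have Gg: "G * g = h * F" by (simp add: G_def dims mult_assoc mult_one_right)
  have X: "(nil_op \<alpha>, G, nil_op \<beta>) \<in> triple_space a b" by (simp add: triple_space_iff dG dims)
  have iso': "isomorphic x (nil_op \<alpha>, G, nil_op \<beta>)" unfolding eq
    by (rule isomorphicI[OF *(1) X g(1) h(1) g(2) h(2) Gg])
  have "coker_iso G (nil_op \<beta> :: 'k mat) \<gamma>"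
    by (rule coker_iso_transport[OF _ _ _ _ _ _ _ _ g(1) h(1) Gg h(2) *(4)]) (simp_all add: dims dG)
  moreover have "G * nil_op \<alpha> = nil_op \<beta> * G"
  proof -
    have "g' * nil_op \<alpha> = A * g'" by (rule intertwiner_inverse[OF g(2,1,1)]) (simp_all add: dims)
    then have "G * nil_op \<alpha> = h * (F * A) * g'" by (simp add: G_def dims mult_assoc)
    also have "\<dots> = (h * B) * (F * g')" unfolding *(2) by (simp add: dims mult_assoc)
    also have "\<dots> = nil_op \<beta> * G" unfolding h(2) by (simp add: G_def dims mult_assoc)
    finally show ?thesis .
  qed
  moreover have "inj_on ((*\<^sub>v) G) (carrier_vec (sum_list \<alpha>))"
  proof -
    obtain Z where Z: "dim_row Z = a" "dim_col Z = b" "Z * F = 1\<^sub>m a" using inj_mat_left_inverse[OF injF] d by metis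
    have "(g * Z * h') * G = g * ((Z * F) * g')" by (simp add: G_def dims Z(1,2) mult_assoc)
    then have 1: "(g * Z * h') * G = 1\<^sub>m a" unfolding Z(3) by (simp add: dims mult_one_left)
    have 2: "g * Z * h' \<in> carrier_mat a b" "G \<in> carrier_mat b a" by (auto intro!: carrier_matI simp: dims Z dG)
    have "(g * Z * h') *\<^sub>v (G *\<^sub>v v) = v" if "v \<in> carrier_vec a" for v
      using assoc_mult_mat_vec[OF 2 that] that unfolding 1 by simp
    then show ?thesis unfolding sum\<alpha> by (rule inj_on_inverseI)
  qed
  moreover have "G \<in> carrier_mat (sum_list \<beta>) (sum_list \<alpha>)" by (auto intro!: carrier_matI simp: dG dims)
  ultimately have "is_mono \<alpha> \<beta> G" "coker_iso G (nil_op \<beta> :: 'k mat) \<gamma>" by (auto simp: is_mono_def)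
  then have "(nil_op \<alpha>, G, nil_op \<beta>) \<in> S2_objects \<beta> \<gamma>" unfolding S2_objects_def using part le2 by blast
  then show thesis using that iso' by blast
qed

section \<open>Regular functions\<close>

text \<open>
  Polynomial functions are constrained only on the space of triples of the given size, because
  entries of matrix products have no polynomial form outside it.
\<close>

definition regular :: "nat \<Rightarrow> nat \<Rightarrow> ('k :: field triple \<Rightarrow> 'k) \<Rightarrow> bool" where
  "regular a b q \<longleftrightarrow> (\<exists>p \<in> poly_functions a b. \<forall>x \<in> triple_space a b. q x = p x)"

lemma regular_const: "regular a b (\<lambda>_. c)"
  unfolding regular_def by (rule bexI[OF _ poly_functions.const[of c]]) simp

lemma regular_add: "regular a b p \<Longrightarrow> regular a b q \<Longrightarrow> regular a b (\<lambda>x. p x + q x)"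
proof -
  assume "regular a b p" "regular a b q"
  then obtain p' q' where "p' \<in> poly_functions a b" "q' \<in> poly_functions a b"
    "\<forall>x \<in> triple_space a b. p x = p' x" "\<forall>x \<in> triple_space a b. q x = q' x" unfolding regular_def by blast
  then show ?thesis unfolding regular_def by (intro bexI[OF _ poly_functions.add[of p' a b q']]) simp_all
qed

lemma regular_mult: "regular a b p \<Longrightarrow> regular a b q \<Longrightarrow> regular a b (\<lambda>x. p x * q x)"
proof -
  assume "regular a b p" "regular a b q"
  then obtain p' q' where "p' \<in> poly_functions a b" "q' \<in> poly_functions a b"
    "\<forall>x \<in> triple_space a b. p x = p' x" "\<forall>x \<in> triple_space a b. q x = q' x" unfolding regular_def by blast
  then show ?thesis unfolding regular_def by (intro bexI[OF _ poly_functions.mult[of p' a b q']]) simp_all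
qed

lemma regular_sum: "(\<And>i. i \<in> I \<Longrightarrow> regular a b (p i)) \<Longrightarrow> regular a b (\<lambda>x. \<Sum>i\<in>I. p i x)"
  by (induction I rule: infinite_finite_induct) (auto intro: regular_const regular_add)

lemma regular_prod: "(\<And>i. i \<in> I \<Longrightarrow> regular a b (p i)) \<Longrightarrow> regular a b (\<lambda>x. \<Prod>i\<in>I. p i x)"
  by (induction I rule: infinite_finite_induct) (auto intro: regular_const regular_mult)

lemma regular_cong: "(\<And>x. x \<in> triple_space a b \<Longrightarrow> p x = q x) \<Longrightarrow> regular a b q \<Longrightarrow> regular a b p"
  unfolding regular_def by auto

definition regular_mat :: "nat \<Rightarrow> nat \<Rightarrow> nat \<Rightarrow> nat \<Rightarrow> ('k :: field triple \<Rightarrow> 'k mat) \<Rightarrow> bool" where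
  "regular_mat a b n k M \<longleftrightarrow> (\<forall>x \<in> triple_space a b. dim_row (M x) = n \<and> dim_col (M x) = k) \<and>
     (\<forall>i < n. \<forall>j < k. regular a b (\<lambda>x. M x $$ (i, j)))"

lemma regular_mat_const: "dim_row C = n \<Longrightarrow> dim_col C = k \<Longrightarrow> regular_mat a b n k (\<lambda>_. C)"
  by (simp add: regular_mat_def regular_const)

lemma regular_mat_components:
  "regular_mat a b a a (fst :: 'k :: field triple \<Rightarrow> 'k mat)" "regular_mat a b b a (\<lambda>x :: 'k triple. fst (snd x))"
  "regular_mat a b b b (\<lambda>x :: 'k triple. snd (snd x))"
proof -
  have "regular a b (\<lambda>x :: 'k triple. fst x $$ (i, j))" if "i < a" "j < a" for i j
    unfolding regular_def by (rule bexI[OF _ poly_functions.coord1[OF that]]) auto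
  moreover have "regular a b (\<lambda>x :: 'k triple. fst (snd x) $$ (i, j))" if "i < b" "j < a" for i j
    unfolding regular_def by (rule bexI[OF _ poly_functions.coord[OF that]]) auto
  moreover have "regular a b (\<lambda>x :: 'k triple. snd (snd x) $$ (i, j))" if "i < b" "j < b" for i j
    unfolding regular_def by (rule bexI[OF _ poly_functions.coord2[OF that]]) auto
  ultimately show "regular_mat a b a a (fst :: 'k triple \<Rightarrow> _)" "regular_mat a b b a (\<lambda>x :: 'k triple. fst (snd x))"
    "regular_mat a b b b (\<lambda>x :: 'k triple. snd (snd x))"
    by (auto simp: regular_mat_def triple_space_iff)
qed

lemma regular_mat_mult:
  fixes M N :: "'k :: field triple \<Rightarrow> 'k mat"
  assumes "regular_mat a b n k M" "regular_mat a b k l N"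
  shows "regular_mat a b n l (\<lambda>x. M x * N x)"
  unfolding regular_mat_def
proof (intro conjI ballI allI impI)
  fix i j assume ij: "i < n" "j < l"
  show "regular a b (\<lambda>x. (M x * N x) $$ (i, j))"
  proof (rule regular_cong)
    fix x :: "'k triple" assume "x \<in> triple_space a b"
    then have d: "dim_row (M x) = n" "dim_col (M x) = k" "dim_row (N x) = k" "dim_col (N x) = l"
      using assms by (simp_all add: regular_mat_def)
    then show "(M x * N x) $$ (i, j) = (\<Sum>t\<in>{0..<k}. M x $$ (i, t) * N x $$ (t, j))"
      using ij by (simp add: scalar_prod_def)
  next
    show "regular a b (\<lambda>x. \<Sum>t\<in>{0..<k}. M x $$ (i, t) * N x $$ (t, j))"
      using assms ij by (intro regular_sum regular_mult) (simp_all add: regular_mat_def)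
  qed
qed (use assms in \<open>auto simp: regular_mat_def\<close>)

lemma regular_mat_pow: "regular_mat a b n n M \<Longrightarrow> regular_mat a b n n (\<lambda>x. M x ^\<^sub>m i)"
proof (induction i)
  case 0
  show ?case unfolding regular_mat_def
  proof (intro conjI ballI allI impI)
    fix i j assume ij: "i < n" "j < n"
    show "regular a b (\<lambda>x. (M x ^\<^sub>m 0) $$ (i, j))"
      using 0 ij by (intro regular_cong[OF _ regular_const[of _ _ "if i = j then 1 else 0"]]) (auto simp: regular_mat_def)
  qed (use 0 in \<open>auto simp: regular_mat_def\<close>)
next
  case (Suc i)
  then show ?case using regular_mat_mult[OF Suc.IH[OF Suc.prems] Suc.prems] by simp
qed

lemma regular_mat_hcat:
  assumes "regular_mat a b n k M" "regular_mat a b n l N"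
  shows "regular_mat a b n (k + l) (\<lambda>x. hcat (M x) (N x))"
  unfolding regular_mat_def
proof (intro conjI ballI allI impI)
  fix i j assume ij: "i < n" "j < k + l"
  show "regular a b (\<lambda>x. hcat (M x) (N x) $$ (i, j))"
  proof (cases "j < k")
    case True
    show ?thesis by (rule regular_cong[of _ _ _ "\<lambda>x. M x $$ (i, j)"]) (use assms ij True in \<open>simp_all add: regular_mat_def index_hcat\<close>)
  next
    case False
    show ?thesis by (rule regular_cong[of _ _ _ "\<lambda>x. N x $$ (i, j - k)"]) (use assms ij False in \<open>simp_all add: regular_mat_def index_hcat\<close>)
  qed
qed (use assms in \<open>auto simp: regular_mat_def\<close>)

lemma regular_mat_vcat:
  assumes "regular_mat a b n k M" "regular_mat a b l k N"
  shows "regular_mat a b (n + l) k (\<lambda>x. vcat (M x) (N x))"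
  unfolding regular_mat_def
proof (intro conjI ballI allI impI)
  fix i j assume ij: "i < n + l" "j < k"
  show "regular a b (\<lambda>x. vcat (M x) (N x) $$ (i, j))"
  proof (cases "i < n")
    case True
    show ?thesis by (rule regular_cong[of _ _ _ "\<lambda>x. M x $$ (i, j)"]) (use assms ij True in \<open>simp_all add: regular_mat_def index_vcat\<close>)
  next
    case False
    show ?thesis by (rule regular_cong[of _ _ _ "\<lambda>x. N x $$ (i - n, j)"]) (use assms ij False in \<open>simp_all add: regular_mat_def index_vcat\<close>)
  qed
qed (use assms in \<open>auto simp: regular_mat_def\<close>)

lemma regular_mat_cong: "(\<And>x. x \<in> triple_space a b \<Longrightarrow> M x = N x) \<Longrightarrow> regular_mat a b n k N \<Longrightarrow> regular_mat a b n k M"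
  unfolding regular_mat_def using regular_cong by (metis (no_types, lifting))

lemma regular_mat_dsum:
  fixes M N :: "'k :: field triple \<Rightarrow> 'k mat"
  assumes "regular_mat a b n k M" "regular_mat a b n' k' N"
  shows "regular_mat a b (n + n') (k + k') (\<lambda>x. dsum (M x) (N x))"
proof (rule regular_mat_cong)
  fix x :: "'k triple" assume "x \<in> triple_space a b"
  then have "dim_row (M x) = n" "dim_col (M x) = k" "dim_row (N x) = n'" "dim_col (N x) = k'"
    using assms by (simp_all add: regular_mat_def)
  then show "dsum (M x) (N x) = vcat (hcat (M x) (0\<^sub>m n k')) (hcat (0\<^sub>m n' k) (N x))"
    by (simp add: dsum_def four_block_eq_vcat)
qed (intro regular_mat_vcat regular_mat_hcat assms regular_mat_const; simp)

lemma regular_det: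
  fixes M :: "'k :: field triple \<Rightarrow> 'k mat"
  assumes "regular_mat a b n n M"
  shows "regular a b (\<lambda>x. det (M x))"
proof (rule regular_cong)
  fix x :: "'k triple" assume "x \<in> triple_space a b"
  then have "M x \<in> carrier_mat n n" using assms by (auto simp: regular_mat_def intro!: carrier_matI)
  then show "det (M x) = (\<Sum>p \<in> {p. p permutes {0..<n}}. signof p * (\<Prod>i\<in>{0..<n}. M x $$ (i, p i)))"
    by (rule det_def')
next
  show "regular a b (\<lambda>x. \<Sum>p \<in> {p. p permutes {0..<n}}. signof p * (\<Prod>i\<in>{0..<n}. M x $$ (i, p i)))"
  proof (intro regular_sum regular_mult regular_const regular_prod)
    fix p i assume "p \<in> {p. p permutes {0..<n}}" "i \<in> {0..<n}"
    then have "i < n" "p i < n" by (auto simp: permutes_in_image[of p "{0..<n}" i, simplified])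
    then show "regular a b (\<lambda>x. M x $$ (i, p i))" using assms by (simp add: regular_mat_def)
  qed
qed

lemma zariski_open_nonvanishing:
  assumes "\<And>q. q \<in> Q \<Longrightarrow> regular a b q"
  shows "zariski_open a b {x \<in> triple_space a b. \<exists>q \<in> Q. q x \<noteq> 0}"
proof -
  from assms have "\<forall>q\<in>Q. \<exists>p \<in> poly_functions a b. \<forall>x \<in> triple_space a b. q x = p x" unfolding regular_def by blast
  then obtain f where f: "\<forall>q\<in>Q. f q \<in> poly_functions a b \<and> (\<forall>x \<in> triple_space a b. q x = f q x)" by metis
  then have "{x \<in> triple_space a b. \<exists>q \<in> Q. q x \<noteq> 0} = triple_space a b - {x. \<forall>p \<in> f ` Q. p x = 0}" by auto
  then show ?thesis unfolding zariski_open_def using f by (intro exI[of _ "f ` Q"]) auto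
qed

text \<open>Lower bounds for the rank through determinants, which are polynomials in the entries of \<open>M\<close>.\<close>

lemma rank_ge_iff_det:
  "rank_ge M s \<longleftrightarrow> (\<exists>P Q. P \<in> carrier_mat s (dim_row M) \<and> Q \<in> carrier_mat (dim_col M) s \<and> det (P * M * Q) \<noteq> 0)"
proof
  assume "rank_ge M s"
  then obtain P Q where "P \<in> carrier_mat s (dim_row M)" "Q \<in> carrier_mat (dim_col M) s" "P * M * Q = 1\<^sub>m s"
    unfolding rank_ge_def by blast
  moreover from this have "det (P * M * Q) \<noteq> 0" by simp
  ultimately show "\<exists>P Q. P \<in> carrier_mat s (dim_row M) \<and> Q \<in> carrier_mat (dim_col M) s \<and> det (P * M * Q) \<noteq> 0" by blast
next
  assume "\<exists>P Q. P \<in> carrier_mat s (dim_row M) \<and> Q \<in> carrier_mat (dim_col M) s \<and> det (P * M * Q) \<noteq> 0"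
  then obtain P Q where PQ: "P \<in> carrier_mat s (dim_row M)" "Q \<in> carrier_mat (dim_col M) s" "det (P * M * Q) \<noteq> 0" by blast
  then have c: "P * M * Q \<in> carrier_mat s s" by (auto intro!: carrier_matI)
  have "inj_mat (P * M * Q)" unfolding inj_mat_iff_vec[OF c] using det_0_iff_vec_prod_zero_field[OF c] PQ(3) by blast
  then obtain Z where "inverse_pair s (P * M * Q) Z"
    by (rule inj_mat_square_inverse) (use carrier_matD[OF c] in simp_all)
  note Z = inverse_pairD(3-5)[OF this]
  show "rank_ge M s" unfolding rank_ge_def
    using PQ Z by (intro exI[of _ P] exI[of _ "Q * Z"]) (auto simp: mult_assoc intro!: carrier_matI)
qed

lemma rank_ge_open:
  fixes M :: "'k :: field triple \<Rightarrow> 'k mat"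
  assumes "regular_mat a b n k M"
  shows "zariski_open a b {x \<in> triple_space a b. rank_ge (M x) s}"
proof -
  let ?Q = "(\<lambda>(P, Q) x. det (P * M x * Q)) ` (carrier_mat s n \<times> carrier_mat k s)"
  have "{x \<in> triple_space a b. rank_ge (M x) s} = {x \<in> triple_space a b. \<exists>q \<in> ?Q. q x \<noteq> 0}"
  proof (intro Collect_cong conj_cong refl)
    fix x :: "'k triple" assume "x \<in> triple_space a b"
    then have d: "dim_row (M x) = n" "dim_col (M x) = k" using assms by (auto simp: regular_mat_def)
    have "(\<exists>q \<in> ?Q. q x \<noteq> 0) \<longleftrightarrow> (\<exists>p \<in> carrier_mat s n \<times> carrier_mat k s. det (fst p * M x * snd p) \<noteq> 0)"
      by (simp add: case_prod_beta)
    then show "rank_ge (M x) s \<longleftrightarrow> (\<exists>q \<in> ?Q. q x \<noteq> 0)" unfolding rank_ge_iff_det d by auto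
  qed
  moreover have "regular a b q" if q: "q \<in> ?Q" for q
  proof -
    obtain P Q where "q = (\<lambda>x. det (P * M x * Q))" "P \<in> carrier_mat s n" "Q \<in> carrier_mat k s" using q by auto
    then show ?thesis
      using regular_det[OF regular_mat_mult[OF regular_mat_mult[OF regular_mat_const[of P s n] assms] regular_mat_const[of Q k s]]] by simp
  qed
  ultimately show ?thesis using zariski_open_nonvanishing[of ?Q a b] by simp
qed

lemma regular_height_mat: "regular_mat a b (b + b) (a + (b + b)) (height_mat j i :: 'k :: field triple \<Rightarrow> 'k mat)"
proof (rule regular_mat_cong)
  show "height_mat j i x = hcat (vcat (fst (snd x)) (snd (snd x) * fst (snd x))) (dsum (snd (snd x) ^\<^sub>m j) (snd (snd x) ^\<^sub>m i))"
    for x :: "'k triple" by (cases x) (simp add: height_mat_def)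
qed (intro regular_mat_hcat regular_mat_vcat regular_mat_dsum regular_mat_mult[where k = b] regular_mat_pow regular_mat_components)

section \<open>The group action\<close>

text \<open>
  The inverses are parts of the group element, so that the action is visibly polynomial.
\<close>

fun act :: "'k :: field mat \<times> 'k mat \<times> 'k mat \<times> 'k mat \<Rightarrow> 'k triple \<Rightarrow> 'k triple" where
  "act (g, g', h, h') (A, F, B) = (g * A * g', h * F * g', h * B * h')"

definition group_element :: "nat \<Rightarrow> nat \<Rightarrow> 'k :: field mat \<times> 'k mat \<times> 'k mat \<times> 'k mat \<Rightarrow> bool" where
  "group_element a b G = (case G of (g, g', h, h') \<Rightarrow> inverse_pair a g g' \<and> inverse_pair b h h')"

lemma regular_mat_act:
  assumes "group_element a b G"
  shows "regular_mat a b a a (\<lambda>x. fst (act G x))" "regular_mat a b b a (\<lambda>x. fst (snd (act G x)))"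
    "regular_mat a b b b (\<lambda>x. snd (snd (act G x)))"
proof -
  obtain g g' h h' where G: "G = (g, g', h, h')" by (cases G)
  have d: "dim_row g = a" "dim_col g = a" "dim_row g' = a" "dim_col g' = a" "dim_row h = b" "dim_col h = b" "dim_row h' = b" "dim_col h' = b"
    using assms by (simp_all add: group_element_def G inverse_pair_def)
  have *: "act G x = (g * fst x * g', h * fst (snd x) * g', h * snd (snd x) * h')" for x by (cases x) (simp add: G)
  show "regular_mat a b a a (\<lambda>x. fst (act G x))" "regular_mat a b b a (\<lambda>x. fst (snd (act G x)))"
    "regular_mat a b b b (\<lambda>x. snd (snd (act G x)))"
    unfolding * fst_conv snd_conv
    by (rule regular_mat_mult regular_mat_const regular_mat_components d)+
qed

lemma act_triple_space: "group_element a b G \<Longrightarrow> x \<in> triple_space a b \<Longrightarrow> act G x \<in> triple_space a b"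
  by (cases G, cases x) (simp add: group_element_def inverse_pair_def triple_space_iff)

lemma regular_comp_act:
  assumes G: "group_element a b G" and p: "p \<in> poly_functions a b"
  shows "regular a b (\<lambda>x. p (act G x))"
  using p
proof induction
  case (const c)
  show ?case by (rule regular_const)
next
  case (coord1 i j)
  then show ?case using regular_mat_act(1)[OF G] by (simp add: regular_mat_def case_prod_beta)
next
  case (coord i j)
  then show ?case using regular_mat_act(2)[OF G] by (simp add: regular_mat_def case_prod_beta)
next
  case (coord2 i j)
  then show ?case using regular_mat_act(3)[OF G] by (simp add: regular_mat_def case_prod_beta)
qed (auto intro: regular_add regular_mult)

lemma act_preimage_open:
  assumes G: "group_element a b G" and U: "zariski_open a b U"
  shows "zariski_open a b {x \<in> triple_space a b. act G x \<in> U}"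
proof -
  obtain P where P: "P \<subseteq> poly_functions a b" "U = triple_space a b - {x. \<forall>p \<in> P. p x = 0}"
    using U unfolding zariski_open_def by blast
  have "{x \<in> triple_space a b. act G x \<in> U} = {x \<in> triple_space a b. \<exists>q \<in> (\<lambda>p x. p (act G x)) ` P. q x \<noteq> 0}"
    unfolding P(2) using act_triple_space[OF G] by auto
  then show ?thesis using zariski_open_nonvanishing[of "(\<lambda>p x. p (act G x)) ` P" a b] regular_comp_act[OF G] P(1) by auto
qed

lemma isomorphic_imp_act:
  assumes "isomorphic x y" "x \<in> triple_space a b" "y \<in> triple_space a b"
  obtains G where "group_element a b G" "y = act G x"
proof -
  obtain A F B A' F' B' where eq: "x = (A, F, B)" "y = (A', F', B')" by (cases x, cases y)
  note d = assms(2,3)[unfolded eq triple_space_iff]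
  obtain g g' h h' where *: "inverse_pair a g g'" "inverse_pair b h h'"
    "g * A = A' * g" "h * B = B' * h" "F' * g = h * F" by (rule isomorphicE[OF assms[unfolded eq]])
  have "act (g, g', h, h') x = (A' * g * g', F' * g * g', B' * h * h')" by (simp add: eq *(3-))
  also have "\<dots> = y" unfolding eq
    by (simp add: d inverse_pairD[OF *(1)] inverse_pairD[OF *(2)] mult_assoc mult_one_right)
  finally show thesis using that[of "(g, g', h, h')"] * by (simp add: group_element_def)
qed

lemma act_isomorphic:
  assumes G: "group_element a b G" and x: "x \<in> triple_space a b"
  shows "isomorphic x (act G x)"
proof -
  obtain A F B where eq: "x = (A, F, B)" by (cases x)
  obtain g g' h h' where G': "G = (g, g', h, h')" by (cases G)
  have g: "inverse_pair a g g'" and h: "inverse_pair b h h'" using G by (simp_all add: G' group_element_def)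
  show ?thesis unfolding eq G' act.simps
    by (rule isomorphicI[OF x[unfolded eq] _ g h])
      (simp_all add: x[unfolded eq triple_space_iff] triple_space_iff inverse_pairD[OF g] inverse_pairD[OF h] mult_assoc mult_one_right)
qed

lemma act_rep_space:
  fixes x :: "'k :: field triple"
  assumes G: "group_element (sum_list \<beta> - sum_list \<gamma>) (sum_list \<beta>) G" and x: "x \<in> rep_space \<beta> \<gamma>"
  shows "act G x \<in> rep_space \<beta> \<gamma>"
proof -
  obtain a b where ab: "sum_list \<beta> - sum_list \<gamma> = a" "sum_list \<beta> = b" by blast
  obtain A F B where eq: "x = (A, F, B)" by (cases x)
  obtain g g' h h' where G': "G = (g, g', h, h')" by (cases G)
  have g: "inverse_pair a g g'" and h: "inverse_pair b h h'"
    using G unfolding ab(1) unfolding ab(2) by (simp_all add: G' group_element_def)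
  have X: "(A, F, B) \<in> triple_space a b" "A * A = 0\<^sub>m a a" "F * A = B * F" "nilpotent_of_type B \<beta>" "vec_space.rank b F = a" "coker_iso F B \<gamma>"
    using x unfolding eq rep_space_def Let_def ab(1) unfolding ab(2) by auto
  note d = X(1)[unfolded triple_space_iff] inverse_pairD[OF g] inverse_pairD[OF h]
  have Y: "(g * A * g', h * F * g', h * B * h') \<in> triple_space a b" by (simp add: d triple_space_iff)
  have iso: "isomorphic (A, F, B) (g * A * g', h * F * g', h * B * h')"
    using act_isomorphic[of a b G, OF _ X(1)] g h by (simp add: group_element_def G')
  have "(g * A * g') * (g * A * g') = g * (A * A) * g'" by (simp add: d mult_assoc)
  then have 1: "(g * A * g') * (g * A * g') = 0\<^sub>m a a" by (simp add: X(2) d mat_simps)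
  have "(h * F * g') * (g * A * g') = h * (F * A) * g'" by (simp add: d mult_assoc)
  also have "\<dots> = (h * B * h') * (h * F * g')" unfolding X(3) by (simp add: d mult_assoc)
  finally have 2: "(h * F * g') * (g * A * g') = (h * B * h') * (h * F * g')" .
  have "similar_mat (h * B * h') B" by (rule similar_mat_sym[OF isomorphic_similar(2)[OF iso X(1) Y]])
  then have 3: "nilpotent_of_type (h * B * h') \<beta>" using X(4) similar_mat_trans
    unfolding nilpotent_of_type_def jordan_nf_def by blast
  have c: "F \<in> carrier_mat b a" "h * F * g' \<in> carrier_mat b a" by (auto intro!: carrier_matI simp: d)
  have "inj_mat F" using full_rank_iff_inj_mat[OF c(1)] X(5) by blast
  then obtain Z where Z: "dim_row Z = a" "dim_col Z = b" "Z * F = 1\<^sub>m a" using inj_mat_left_inverse d by metis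
  have "(g * Z * h') * (h * F * g') = g * (Z * F) * g'" using Z(1,2) by (simp add: d mult_assoc)
  then have "(g * Z * h') * (h * F * g') = 1\<^sub>m a" unfolding Z(3) by (simp add: d mult_one_right)
  then have "inj_mat (h * F * g')" using Z(1,2) by (intro left_inverse_inj_mat[of "g * Z * h'"]) (simp_all add: d)
  then have 4: "vec_space.rank b (h * F * g') = a" using full_rank_iff_inj_mat[OF c(2)] by blast
  have 5: "coker_iso (h * F * g') (h * B * h') \<gamma>"
    by (rule coker_iso_transport[OF _ _ _ _ _ _ _ _ g h _ _ X(6)]) (simp_all add: d mult_assoc mult_one_right)
  show ?thesis using Y 1 2 3 4 5 unfolding rep_space_def Let_def ab(1) unfolding ab(2) by (simp add: eq G')
qed

section \<open>The stratification\<close>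

lemma rep_space_triple_space: "x \<in> rep_space \<beta> \<gamma> \<Longrightarrow> x \<in> triple_space (sum_list \<beta> - sum_list \<gamma>) (sum_list \<beta>)"
  by (auto simp: rep_space_def Let_def)

text \<open>
  The object in the definition of a stratum can be dispensed with, as a point and its object have the
  same decompositions.
\<close>

lemma in_stratum_iff:
  fixes x :: "'k :: field triple"
  shows "x \<in> stratum \<beta> \<gamma> \<Delta> \<longleftrightarrow> x \<in> rep_space \<beta> \<gamma> \<and> has_arc_diagram x \<Delta>"
proof
  assume x: "x \<in> stratum \<beta> \<gamma> \<Delta>"
  then obtain X where X: "X \<in> S2_objects \<beta> \<gamma>" "isomorphic x X" "has_arc_diagram X \<Delta>" and xV: "x \<in> rep_space \<beta> \<gamma>"
    unfolding stratum_def by blast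
  obtain \<alpha> where "X \<in> triple_space (sum_list \<alpha>) (sum_list \<beta>)" by (rule S2_objects_triple_space[OF X(1)])
  then have "has_arc_diagram x \<Delta>"
    using X(3) decomposes_as_isomorphic[OF X(2) _ _ rep_space_triple_space[OF xV]] unfolding has_arc_diagram_def by blast
  with xV show "x \<in> rep_space \<beta> \<gamma> \<and> has_arc_diagram x \<Delta>" by blast
next
  assume x: "x \<in> rep_space \<beta> \<gamma> \<and> has_arc_diagram x \<Delta>"
  obtain X where X: "X \<in> S2_objects \<beta> \<gamma>" "isomorphic x X" using x rep_space_object[of x \<beta> \<gamma>] by blast
  obtain \<alpha> where "X \<in> triple_space (sum_list \<alpha>) (sum_list \<beta>)" by (rule S2_objects_triple_space[OF X(1)])
  then have "has_arc_diagram X \<Delta>"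
    using x decomposes_as_isomorphic[OF isomorphic_sym[OF X(2)] _ rep_space_triple_space[of x \<beta> \<gamma>]] unfolding has_arc_diagram_def by blast
  then show "x \<in> stratum \<beta> \<gamma> \<Delta>" unfolding stratum_def using x X by blast
qed

lemma rep_space_decomposition:
  fixes x :: "'k :: field triple"
  assumes "x \<in> rep_space \<beta> \<gamma>" "decomposes_as x xs"
  shows "size_mset xs = mset \<beta>" "\<forall>x\<in>set xs. valid_indec x"
proof -
  obtain A F B where eq: "x = (A, F, B)" by (cases x)
  have "nilpotent_of_type B \<beta>" using assms(1) by (auto simp: eq rep_space_def Let_def)
  then show "size_mset xs = mset \<beta>"
    using decomposes_as_size_mset[OF assms(2)[unfolded eq] rep_space_triple_space[OF assms(1), unfolded eq]] by blast
  show "\<forall>x\<in>set xs. valid_indec x" using assms(2) by (simp add: decomposes_as_def)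
qed

lemma stratum_isomorphic:
  fixes x y :: "'k :: field triple"
  assumes "x \<in> stratum \<beta> \<gamma> \<Delta>" "y \<in> stratum \<beta> \<gamma> \<Delta>"
  shows "isomorphic x y"
proof -
  from assms obtain xs ys where *: "x \<in> rep_space \<beta> \<gamma>" "y \<in> rep_space \<beta> \<gamma>" "decomposes_as x xs" "decomposes_as y ys" "diagram_of xs = \<Delta>" "diagram_of ys = \<Delta>"
    unfolding in_stratum_iff has_arc_diagram_def by blast
  note v = rep_space_decomposition[OF *(1,3)] rep_space_decomposition[OF *(2,4)]
  have "mset xs = mset ys" by (rule mset_eq_if_diagram_eq[OF v(2,4)]) (simp_all add: v *(5,6))
  from decomposes_as_cong_mset[OF *(3) this rep_space_triple_space[OF *(1)]]
  have "isomorphic x (direct_sum (map indec_triple ys))" by (simp add: decomposes_as_def)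
  moreover have "isomorphic (direct_sum (map indec_triple ys)) y" using *(4) by (rule_tac isomorphic_sym) (simp add: decomposes_as_def)
  ultimately show ?thesis
    by (rule isomorphic_trans[OF _ _ rep_space_triple_space[OF *(1)] direct_sum_triple_space[OF v(4)] rep_space_triple_space[OF *(2)]])
qed

lemma stratum_unique_diagram:
  fixes x :: "'k :: field triple"
  assumes "x \<in> stratum \<beta> \<gamma> \<Delta>" "x \<in> stratum \<beta> \<gamma> \<Delta>'"
  shows "\<Delta> = \<Delta>'"
proof -
  from assms obtain xs ys where *: "x \<in> rep_space \<beta> \<gamma>" "decomposes_as x xs" "decomposes_as x ys" "diagram_of xs = \<Delta>" "diagram_of ys = \<Delta>'"
    unfolding in_stratum_iff has_arc_diagram_def by blast
  note v = rep_space_decomposition[OF *(1,2)] rep_space_decomposition[OF *(1,3)]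
  note sp = rep_space_triple_space[OF *(1)]
  have "mset xs = mset ys"
  proof (rule mset_eq_if_height_dims_eq[OF v(2,4)])
    show "\<forall>m\<in>#size_mset xs. m \<le> sum_list \<beta>" unfolding v(1) by (auto intro: member_le_sum_list)
    show "sum_list (map (height_dim j i) xs) = sum_list (map (height_dim j i) ys)" for j i
      by (rule has_dim_unique[OF decomposes_as_height_dim[OF *(2) sp] decomposes_as_height_dim[OF *(3) sp]])
  qed (simp add: v)
  then show ?thesis using diagram_of_cong *(4,5) by metis
qed

lemma rep_space_rank_height_mat:
  fixes x :: "'k :: field triple"
  assumes x: "x \<in> rep_space \<beta> \<gamma>" "decomposes_as x xs" and s: "is_rank (dsum (nil_op \<beta> ^\<^sub>m j) (nil_op \<beta> ^\<^sub>m i) :: 'k mat) s"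
  shows "is_rank (height_mat j i x) (sum_list \<beta> - sum_list \<gamma> - sum_list (map (height_dim j i) xs) + s)"
    "sum_list (map (height_dim j i) xs) \<le> sum_list \<beta> - sum_list \<gamma>"
proof -
  obtain A F B where eq: "x = (A, F, B)" by (cases x)
  define b where b: "b = sum_list \<beta>"
  note sp = rep_space_triple_space[OF x(1)]
  note hd = decomposes_as_height_dim[OF x(2) sp, of j i]
  have dB: "dim_row B = b" "dim_col B = b" using sp by (simp_all add: eq triple_space_iff b)
  have "similar_mat B (nil_op \<beta>)" using x(1) by (auto simp: eq rep_space_def Let_def nilpotent_of_type_def jordan_nf_def nil_op_def)
  then obtain h h' where h: "inverse_pair b h h'" "h * B = nil_op \<beta> * h"
    using similar_mat_iff_inverse_pair[of B b "nil_op \<beta>"] dB by (auto simp: b)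
  note d = inverse_pairD[OF h(1)] b[symmetric]
  have pow: "B ^\<^sub>m k = h' * nil_op \<beta> ^\<^sub>m k * h" for k
  proof -
    have "h * B ^\<^sub>m k = nil_op \<beta> ^\<^sub>m k * h" by (rule pow_mat_commute_intertwiner[OF h(2)]) (simp_all add: d dB)
    then have "h' * (h * B ^\<^sub>m k) = h' * nil_op \<beta> ^\<^sub>m k * h" by (simp add: d mult_assoc)
    then show ?thesis by (simp add: d dB)
  qed
  have "is_rank (dsum h' h' * dsum (nil_op \<beta> ^\<^sub>m j) (nil_op \<beta> ^\<^sub>m i) * dsum h h) s"
    by (rule is_rank_equivalent[OF s, of "dsum h h" _ _ "dsum h' h'"]) (simp_all add: d dsum_mult_dsum dsum_one)
  also have "dsum h' h' * dsum (nil_op \<beta> ^\<^sub>m j) (nil_op \<beta> ^\<^sub>m i) * dsum h h = dsum (B ^\<^sub>m j) (B ^\<^sub>m i)"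
    unfolding pow by (simp add: d dsum_mult_dsum)
  finally show "is_rank (height_mat j i x) (sum_list \<beta> - sum_list \<gamma> - sum_list (map (height_dim j i) xs) + s)"
    using rank_height_mat[OF sp[unfolded eq] hd[unfolded eq]] unfolding eq by blast
  show "sum_list (map (height_dim j i) xs) \<le> sum_list \<beta> - sum_list \<gamma>" by (rule has_dim_le[OF hd])
qed

text \<open>
  Both \<open>\<Delta>\<close> and the ranks determine the summands of a point, so either determines the other. The ranks
  are those of the given point \<open>x0\<close>.
\<close>

lemma stratum_rank_conditions:
  fixes x0 :: "'k :: field triple"
  assumes "x0 \<in> stratum \<beta> \<gamma> \<Delta>"
  obtains R where "\<forall>x :: 'k triple. x \<in> stratum \<beta> \<gamma> \<Delta> \<longleftrightarrow> x \<in> rep_space \<beta> \<gamma> \<and>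
     (\<forall>j \<le> sum_list \<beta>. \<forall>i \<le> sum_list \<beta>. is_rank (height_mat j i x) (R j i))"
proof -
  from assms obtain xs where x0: "x0 \<in> rep_space \<beta> \<gamma>" "decomposes_as x0 xs" "diagram_of xs = \<Delta>"
    unfolding in_stratum_iff has_arc_diagram_def by blast
  have "\<forall>j i. \<exists>s. is_rank (dsum (nil_op \<beta> ^\<^sub>m j) (nil_op \<beta> ^\<^sub>m i) :: 'k mat) s" using ex_is_rank by blast
  then obtain s where s: "\<And>j i. is_rank (dsum (nil_op \<beta> ^\<^sub>m j) (nil_op \<beta> ^\<^sub>m i) :: 'k mat) (s j i)" by metis
  define a where "a = sum_list \<beta> - sum_list \<gamma>"
  define R where "R j i = a - sum_list (map (height_dim j i) xs) + s j i" for j i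
  note v = rep_space_decomposition[OF x0(1,2)]
  have "x \<in> stratum \<beta> \<gamma> \<Delta> \<longleftrightarrow> x \<in> rep_space \<beta> \<gamma> \<and>
     (\<forall>j \<le> sum_list \<beta>. \<forall>i \<le> sum_list \<beta>. is_rank (height_mat j i x) (R j i))" for x :: "'k triple"
  proof
    assume "x \<in> stratum \<beta> \<gamma> \<Delta>"
    then obtain ys where x: "x \<in> rep_space \<beta> \<gamma>" "decomposes_as x ys" "diagram_of ys = \<Delta>"
      unfolding in_stratum_iff has_arc_diagram_def by blast
    note v' = rep_space_decomposition[OF x(1,2)]
    have "mset xs = mset ys" by (rule mset_eq_if_diagram_eq[OF v(2) v'(2)]) (simp_all add: v v' x0 x)
    then have "sum_list (map (height_dim j i) xs) = sum_list (map (height_dim j i) ys)" for j i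
      by (metis mset_map sum_mset_sum_list)
    then show "x \<in> rep_space \<beta> \<gamma> \<and> (\<forall>j \<le> sum_list \<beta>. \<forall>i \<le> sum_list \<beta>. is_rank (height_mat j i x) (R j i))"
      using rep_space_rank_height_mat(1)[OF x(1,2) s] x(1) by (simp add: R_def a_def)
  next
    assume *: "x \<in> rep_space \<beta> \<gamma> \<and> (\<forall>j \<le> sum_list \<beta>. \<forall>i \<le> sum_list \<beta>. is_rank (height_mat j i x) (R j i))"
    then obtain ys where ys: "decomposes_as x ys" using s2_triple_decomposes[OF rep_space_s2_triple] by blast
    note v' = rep_space_decomposition[OF conjunct1[OF *] ys]
    have "mset xs = mset ys"
    proof (rule mset_eq_if_height_dims_eq[OF v(2) v'(2)])
      show "\<forall>m\<in>#size_mset xs. m \<le> sum_list \<beta>" unfolding v(1) by (auto intro: member_le_sum_list)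
      fix j i assume ji: "j \<le> sum_list \<beta>" "i \<le> sum_list \<beta>"
      have "a - sum_list (map (height_dim j i) xs) + s j i = a - sum_list (map (height_dim j i) ys) + s j i"
        using is_rank_unique[OF _ rep_space_rank_height_mat(1)[OF conjunct1[OF *] ys s]] * ji unfolding R_def a_def by blast
      then show "sum_list (map (height_dim j i) xs) = sum_list (map (height_dim j i) ys)"
        using rep_space_rank_height_mat(2)[OF conjunct1[OF *] ys s, of j i] rep_space_rank_height_mat(2)[OF x0(1,2) s, of j i]
        unfolding a_def by linarith
    qed (simp add: v v')
    then have "diagram_of ys = \<Delta>" using diagram_of_cong x0(3) by metis
    then show "x \<in> stratum \<beta> \<gamma> \<Delta>" unfolding in_stratum_iff has_arc_diagram_def
      using conjunct1[OF *] ys by auto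
  qed
  then show thesis by (intro that[of R] allI)
qed

lemma topspace_zariski: "topspace (zariski a b :: 'k :: field triple topology) = triple_space a b"
proof -
  have "openin (zariski a b :: 'k triple topology) (triple_space a b)"
    unfolding openin_zariski zariski_open_def
    by (intro exI[of _ "{\<lambda>_. 1}"]) (auto intro: poly_functions.const)
  moreover have "U \<subseteq> triple_space a b" if "openin (zariski a b :: 'k triple topology) U" for U
    using that unfolding openin_zariski zariski_open_def by blast
  ultimately show ?thesis unfolding topspace_def by blast
qed

lemma topspace_rep_topology: "topspace (rep_topology \<beta> \<gamma> :: 'k :: field triple topology) = rep_space \<beta> \<gamma>"
  unfolding rep_topology_def topspace_subtopology topspace_zariski using rep_space_triple_space by blast

lemma rank_ge_open_in_rep_topology:
  "openin (rep_topology \<beta> \<gamma>) {x \<in> rep_space \<beta> \<gamma>. rank_ge (height_mat j i x) s}"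
proof -
  let ?a = "sum_list \<beta> - sum_list \<gamma>" and ?b = "sum_list \<beta>"
  have "{x \<in> rep_space \<beta> \<gamma>. rank_ge (height_mat j i x) s} = {x \<in> triple_space ?a ?b. rank_ge (height_mat j i x) s} \<inter> rep_space \<beta> \<gamma>"
    using rep_space_triple_space by blast
  then show ?thesis unfolding rep_topology_def openin_subtopology openin_zariski
    using rank_ge_open[OF regular_height_mat, of ?a ?b j i s] by blast
qed

text \<open>
  Each condition \<open>rank = R\<close> is the conjunction of the open condition \<open>rank \<ge> R\<close> and the closed condition
  \<open>rank < R + 1\<close>.
\<close>

lemma stratum_locally_closed:
  "locally_closed_in (rep_topology \<beta> \<gamma>) (stratum \<beta> \<gamma> \<Delta> :: 'k :: field triple set)"
proof (cases "stratum \<beta> \<gamma> \<Delta> = ({} :: 'k triple set)")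
  case True
  then show ?thesis unfolding locally_closed_in_def by (intro exI[of _ "{}"]) simp
next
  case False
  then obtain x0 :: "'k triple" where x0: "x0 \<in> stratum \<beta> \<gamma> \<Delta>" by blast
  obtain R where R: "\<forall>x :: 'k triple. x \<in> stratum \<beta> \<gamma> \<Delta> \<longleftrightarrow> x \<in> rep_space \<beta> \<gamma> \<and>
     (\<forall>j \<le> sum_list \<beta>. \<forall>i \<le> sum_list \<beta>. is_rank (height_mat j i x) (R j i))"
    by (rule stratum_rank_conditions[OF x0])
  let ?T = "rep_topology \<beta> \<gamma> :: 'k triple topology" and ?I = "{..sum_list \<beta>} \<times> {..sum_list \<beta>}"
  define W where "W s = (\<lambda>(j, i). {x \<in> rep_space \<beta> \<gamma>. rank_ge (height_mat j i (x :: 'k triple)) (s j i)})" for s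
  have op: "openin ?T (W s p)" for s p unfolding W_def by (cases p) (simp add: rank_ge_open_in_rep_topology)
  have "openin ?T (\<Inter>p\<in>?I. W R p)" by (rule openin_INT2) (auto simp: op)
  moreover have "closedin ?T (rep_space \<beta> \<gamma> - (\<Union>p\<in>?I. W (\<lambda>j i. Suc (R j i)) p))"
    by (rule closedin_diff) (auto simp: op simp flip: topspace_rep_topology)
  moreover have "stratum \<beta> \<gamma> \<Delta> = (\<Inter>p\<in>?I. W R p) \<inter> (rep_space \<beta> \<gamma> - (\<Union>p\<in>?I. W (\<lambda>j i. Suc (R j i)) p))"
    using R by (auto simp: is_rank_iff W_def)
  ultimately show ?thesis unfolding locally_closed_in_def by blast
qed

text \<open>
  Each indecomposable contributes at least one to the dimension \<open>|\<beta>|\<close>, and its parameters are at most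
  \<open>|\<beta>|\<close>.
\<close>

lemma finite_arc_diagrams: "finite (arc_diagrams TYPE('k :: field) \<beta> \<gamma>)"
proof -
  let ?b = "sum_list \<beta>"
  let ?D = "(\<lambda>(l, m). Picket l m) ` ({..2} \<times> {..?b}) \<union> (\<lambda>(m, r). Bipicket m r) ` ({..?b} \<times> {..?b})"
  have "arc_diagrams TYPE('k) \<beta> \<gamma> \<subseteq> diagram_of ` {xs. set xs \<subseteq> ?D \<and> length xs \<le> ?b}"
  proof
    fix \<Delta> assume "\<Delta> \<in> arc_diagrams TYPE('k) \<beta> \<gamma>"
    then obtain X :: "'k triple" and xs where X: "X \<in> S2_objects \<beta> \<gamma>" "decomposes_as X xs" "diagram_of xs = \<Delta>"
      unfolding arc_diagrams_def has_arc_diagram_def by blast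
    have v: "\<forall>x\<in>set xs. valid_indec x" and iso: "isomorphic X (direct_sum (map indec_triple xs))"
      using X(2) by (auto simp: decomposes_as_def)
    obtain \<alpha> where sp: "X \<in> triple_space (sum_list \<alpha>) ?b" by (rule S2_objects_triple_space[OF X(1)])
    have b: "sum_list (map (sum_list \<circ> jordan_sizes) xs) = ?b"
      using isomorphic_dims[OF iso sp direct_sum_triple_space[OF v]] by blast
    have pos: "1 \<le> sum_list (jordan_sizes x)" if "x \<in> set xs" for x using v that by (cases x) auto
    have "length xs \<le> sum_list (map (sum_list \<circ> jordan_sizes) xs)"
      using sum_list_mono[of xs "\<lambda>_. 1" "sum_list \<circ> jordan_sizes"] pos by (simp add: sum_list_triv o_def)
    moreover have "x \<in> ?D" if x: "x \<in> set xs" for x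
    proof -
      have "sum_list (jordan_sizes x) \<le> ?b" unfolding b[symmetric] using x by (intro member_le_sum_list) auto
      moreover have "valid_indec x" using v x by blast
      ultimately show ?thesis by (cases x) (force+)
    qed
    ultimately show "\<Delta> \<in> diagram_of ` {xs. set xs \<subseteq> ?D \<and> length xs \<le> ?b}"
      using X(3) b by (intro image_eqI[of _ diagram_of xs]) auto
  qed
  then show ?thesis by (rule finite_subset) (intro finite_imageI finite_lists_length_le finite_UnI finite_cartesian_product; simp)
qed

lemma rep_space_eq_Union_strata:
  "(rep_space \<beta> \<gamma> :: 'k :: field triple set) = (\<Union>\<Delta> \<in> arc_diagrams TYPE('k) \<beta> \<gamma>. stratum \<beta> \<gamma> \<Delta>)"
proof (intro equalityI subsetI)
  fix x :: "'k triple" assume x: "x \<in> rep_space \<beta> \<gamma>"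
  obtain xs where xs: "decomposes_as x xs" using s2_triple_decomposes[OF rep_space_s2_triple[OF x]] by blast
  then have "x \<in> stratum \<beta> \<gamma> (diagram_of xs)" using x by (auto simp: in_stratum_iff has_arc_diagram_def)
  moreover from this have "diagram_of xs \<in> arc_diagrams TYPE('k) \<beta> \<gamma>" unfolding stratum_def arc_diagrams_def by blast
  ultimately show "x \<in> (\<Union>\<Delta> \<in> arc_diagrams TYPE('k) \<beta> \<gamma>. stratum \<beta> \<gamma> \<Delta>)" by blast
qed (auto simp: stratum_def)

text \<open>
  The isomorphism is given by a group element, which acts by a homeomorphism preserving the stratum.
\<close>

lemma closure_of_stratum_invariant:
  fixes x y :: "'k :: field triple"
  assumes x: "x \<in> rep_topology \<beta> \<gamma> closure_of stratum \<beta> \<gamma> \<Delta>" and y: "y \<in> rep_space \<beta> \<gamma>" and iso: "isomorphic x y"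
  shows "y \<in> rep_topology \<beta> \<gamma> closure_of stratum \<beta> \<gamma> \<Delta>"
proof -
  let ?a = "sum_list \<beta> - sum_list \<gamma>" and ?b = "sum_list \<beta>"
  have xV: "x \<in> rep_space \<beta> \<gamma>" using x unfolding in_closure_of topspace_rep_topology by (rule conjunct1)
  obtain G where G: "group_element ?a ?b G" "y = act G x"
    by (rule isomorphic_imp_act[OF iso rep_space_triple_space[OF xV] rep_space_triple_space[OF y]])
  show ?thesis unfolding in_closure_of topspace_rep_topology
  proof (intro conjI allI impI y)
    fix T assume T: "y \<in> T \<and> openin (rep_topology \<beta> \<gamma>) T"
    then obtain U where U: "zariski_open ?a ?b U" "T = U \<inter> rep_space \<beta> \<gamma>"
      unfolding rep_topology_def openin_subtopology openin_zariski by blast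
    let ?T = "{z \<in> triple_space ?a ?b. act G z \<in> U} \<inter> rep_space \<beta> \<gamma>"
    have "openin (rep_topology \<beta> \<gamma>) ?T" unfolding rep_topology_def openin_subtopology openin_zariski
      using act_preimage_open[OF G(1) U(1)] by blast
    moreover have "x \<in> ?T" using T rep_space_triple_space[OF xV] xV by (simp add: U(2) G(2))
    ultimately have "x \<in> ?T \<and> openin (rep_topology \<beta> \<gamma>) ?T" by (intro conjI)
    from x[unfolded in_closure_of, THEN conjunct2, THEN spec, THEN mp, OF this]
    obtain z where z: "z \<in> stratum \<beta> \<gamma> \<Delta>" "z \<in> ?T" by (elim exE conjE)
    then have zV: "z \<in> rep_space \<beta> \<gamma>" by blast
    have gz: "act G z \<in> rep_space \<beta> \<gamma>" by (rule act_rep_space[OF G(1) zV])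
    note sp = rep_space_triple_space[OF zV]
    have "has_arc_diagram (act G z) \<Delta>"
      using z(1) decomposes_as_isomorphic[OF isomorphic_sym[OF act_isomorphic[OF G(1) sp]] _ sp rep_space_triple_space[OF gz]]
      unfolding in_stratum_iff has_arc_diagram_def by blast
    then have "act G z \<in> stratum \<beta> \<gamma> \<Delta>" using gz by (simp add: in_stratum_iff)
    moreover have "act G z \<in> T" using z(2) gz U(2) by blast
    ultimately show "\<exists>z. z \<in> stratum \<beta> \<gamma> \<Delta> \<and> z \<in> T" by blast
  qed
qed

theorem proposition1p3:
  fixes \<beta> \<gamma> :: "nat list"
  assumes "is_partition \<beta>" and "is_partition \<gamma>" and "partition_le \<gamma> \<beta>"
  shows "(\<forall>\<Delta> \<in> arc_diagrams TYPE('k::alg_closed_field) \<beta> \<gamma>.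
            locally_closed_in (rep_topology \<beta> \<gamma>) (stratum \<beta> \<gamma> \<Delta> :: 'k triple set)) \<and>
         ((rep_space \<beta> \<gamma> :: 'k triple set) = (\<Union>\<Delta> \<in> arc_diagrams TYPE('k) \<beta> \<gamma>. stratum \<beta> \<gamma> \<Delta>) \<and>
          disjoint_family_on (stratum \<beta> \<gamma> :: arc_diagram \<Rightarrow> 'k triple set)
            (arc_diagrams TYPE('k) \<beta> \<gamma>)) \<and>
         (\<forall>\<Delta> \<in> arc_diagrams TYPE('k) \<beta> \<gamma>.
            \<exists>U. finite U \<and> U \<subseteq> arc_diagrams TYPE('k) \<beta> \<gamma> \<and>
              rep_topology \<beta> \<gamma> closure_of (stratum \<beta> \<gamma> \<Delta> :: 'k triple set) =
                (\<Union>\<Gamma> \<in> U. stratum \<beta> \<gamma> \<Gamma>))"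
proof (intro conjI ballI)
  show "locally_closed_in (rep_topology \<beta> \<gamma>) (stratum \<beta> \<gamma> \<Delta> :: 'k triple set)" for \<Delta>
    by (rule stratum_locally_closed)
  show "(rep_space \<beta> \<gamma> :: 'k triple set) = (\<Union>\<Delta> \<in> arc_diagrams TYPE('k) \<beta> \<gamma>. stratum \<beta> \<gamma> \<Delta>)"
    by (rule rep_space_eq_Union_strata)
  show "disjoint_family_on (stratum \<beta> \<gamma> :: arc_diagram \<Rightarrow> 'k triple set) (arc_diagrams TYPE('k) \<beta> \<gamma>)"
    unfolding disjoint_family_on_def using stratum_unique_diagram by blast
next
  fix \<Delta> assume "\<Delta> \<in> arc_diagrams TYPE('k) \<beta> \<gamma>"
  let ?C = "rep_topology \<beta> \<gamma> closure_of (stratum \<beta> \<gamma> \<Delta> :: 'k triple set)"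
  define U where "U = {\<Gamma> \<in> arc_diagrams TYPE('k) \<beta> \<gamma>. stratum \<beta> \<gamma> \<Gamma> \<inter> ?C \<noteq> {}}"
  have "finite U" unfolding U_def by (rule finite_subset[OF Collect_subset finite_arc_diagrams])
  moreover have "?C = (\<Union>\<Gamma> \<in> U. stratum \<beta> \<gamma> \<Gamma>)"
  proof (intro equalityI subsetI)
    fix x assume x: "x \<in> ?C"
    then have "x \<in> rep_space \<beta> \<gamma>" unfolding in_closure_of topspace_rep_topology by (rule conjunct1)
    then obtain \<Gamma> where "\<Gamma> \<in> arc_diagrams TYPE('k) \<beta> \<gamma>" "x \<in> stratum \<beta> \<gamma> \<Gamma>"
      using rep_space_eq_Union_strata by blast
    with x show "x \<in> (\<Union>\<Gamma> \<in> U. stratum \<beta> \<gamma> \<Gamma>)" unfolding U_def by blast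
  next
    fix y assume "y \<in> (\<Union>\<Gamma> \<in> U. stratum \<beta> \<gamma> \<Gamma> :: 'k triple set)"
    then obtain \<Gamma> x where *: "y \<in> stratum \<beta> \<gamma> \<Gamma>" "x \<in> stratum \<beta> \<gamma> \<Gamma>" "x \<in> ?C" unfolding U_def by blast
    show "y \<in> ?C"
      by (rule closure_of_stratum_invariant[OF *(3) _ stratum_isomorphic[OF *(2,1)]]) (use *(1) in \<open>simp add: in_stratum_iff\<close>)
  qed
  moreover have "U \<subseteq> arc_diagrams TYPE('k) \<beta> \<gamma>" unfolding U_def by (rule Collect_subset)
  ultimately show "\<exists>U. finite U \<and> U \<subseteq> arc_diagrams TYPE('k) \<beta> \<gamma> \<and> ?C = (\<Union>\<Gamma> \<in> U. stratum \<beta> \<gamma> \<Gamma>)"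
    by (intro exI[of _ U] conjI)
qed

end
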